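(* Let $S$ be a closed orientable surface of genus at least $2$, let $C$ be a nonseparating simple closed curve in $S$, and let $t_C$ be the left-handed Dehn twist about $C$. Let $n>1$ and $1\le\ell<n$ be integers with $\gcd(\ell,n)=1$, and suppose that $h\in\mathrm{Mod}(S)$ is a side-preserving fractional power of $t_C$ of exponent $\ell/\!/n$. Then $h=(h')^{\ell}$ for some root $h'$ of $t_C$ of degree $n$.
   Context: $\mathrm{Mod}(S)$ is the mapping class group of the closed oriented surface $S$. A fractional power of $t_C$ of exponent $\ell/\!/n$ (a formal symbol recording the pair $(\ell,n)$) is an $h\in\mathrm{Mod}(S)$ with $h^n=t_C^{\ell}$. Such an $h$ preserves the isotopy class of $C$, so one may take a representative with $h(C)=C$. It is side-exchanging if it interchanges the two sides of $C$, and side-preserving otherwise. A root of $t_C$ of degree $n$ is an $h'\in\mathrm{Mod}(S)$ with $(h')^n=t_C$. *)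

theory Defs
  imports
    "HOL-Analysis.Analysis"
    "HOL-Complex_Analysis.Winding_Numbers"
    "HOL-Algebra.Bij"
    "HOL-Algebra.Coset"
begin

section \<open>Oriented closed surfaces\<close>

text \<open>
  Meant for open \<open>U\<close> and continuous injective \<open>f\<close>. The complex plane carries its standard
  (counterclockwise) orientation, and \<open>f\<close> preserves it if its local degree is \<open>1\<close> everywhere:
  the image of a counterclockwise circle around \<open>z\<close> winds once counterclockwise around \<open>f z\<close>.
\<close>

definition orientation_preserving_on :: "complex set \<Rightarrow> (complex \<Rightarrow> complex) \<Rightarrow> bool" where
  "orientation_preserving_on U f \<longleftrightarrow>
     (\<forall>z\<in>U. \<forall>r>0. cball z r \<subseteq> U \<longrightarrow> winding_number (f \<circ> circlepath z r) (f z) = 1)"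

text \<open>
  A surface is an abstract topological space \<open>S\<close>; its orientation is given by a set \<open>\<A>\<close> of
  parametrizations (inverses of charts), each an open embedding of the whole complex plane.
  \<open>orients \<A> U g\<close> says that \<open>g\<close>, defined on the open planar set \<open>U\<close>, is orientation preserving
  when read in every chart of \<open>\<A>\<close>.
\<close>

definition orients :: "(complex \<Rightarrow> 'a) set \<Rightarrow> complex set \<Rightarrow> (complex \<Rightarrow> 'a) \<Rightarrow> bool" where
  "orients \<A> U g \<longleftrightarrow>
     (\<forall>q\<in>\<A>. orientation_preserving_on {z \<in> U. g z \<in> range q} (inv_into UNIV q \<circ> g))"

definition oriented_atlas :: "'a topology \<Rightarrow> (complex \<Rightarrow> 'a) set \<Rightarrow> bool" where
  "oriented_atlas S \<A> \<longleftrightarrow>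
     (\<forall>p\<in>\<A>. embedding_map euclidean S p \<and> openin S (range p)) \<and>
     (\<Union>p\<in>\<A>. range p) = topspace S \<and>
     (\<forall>p\<in>\<A>. orients \<A> UNIV p)"

text \<open>Second countability is automatic, since \<open>S\<close> is compact.\<close>

definition closed_oriented_surface :: "'a topology \<Rightarrow> (complex \<Rightarrow> 'a) set \<Rightarrow> bool" where
  "closed_oriented_surface S \<A> \<longleftrightarrow>
     Hausdorff_space S \<and> compact_space S \<and> connected_space S \<and> oriented_atlas S \<A>"

definition simple_closed_curve :: "'a topology \<Rightarrow> 'a set \<Rightarrow> bool" where
  "simple_closed_curve S C \<longleftrightarrow>
     C \<subseteq> topspace S \<and>
     subtopology S C homeomorphic_space top_of_set (sphere (0::complex) 1)"

definition nonseparating :: "'a topology \<Rightarrow> 'a set \<Rightarrow> bool" where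
  "nonseparating S C \<longleftrightarrow> connectedin S (topspace S - C)"

text \<open>
  The genus is the maximal number of pairwise disjoint simple closed curves whose union does not
  separate \<open>S\<close>. It is taken in \<^typ>\<open>enat\<close> so that the supremum always has its intended meaning.
\<close>

definition genus :: "'a topology \<Rightarrow> enat" where
  "genus S = (SUP \<C> \<in> {\<C>. finite \<C> \<and> (\<forall>C\<in>\<C>. simple_closed_curve S C) \<and>
                          pairwise disjnt \<C> \<and> nonseparating S (\<Union>\<C>)}. enat (card \<C>))"

section \<open>The mapping class group\<close>

text \<open>
  As for \<^const>\<open>BijGroup\<close>, the elements are extensional functions, so that they are determined
  by their values on the surface.
\<close>

definition Homeo_plus :: "'a topology \<Rightarrow> (complex \<Rightarrow> 'a) set \<Rightarrow> ('a \<Rightarrow> 'a) monoid" where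
  "Homeo_plus S \<A> = BijGroup (topspace S)
     \<lparr>carrier := {f \<in> extensional (topspace S).
                   homeomorphic_map S S f \<and> (\<forall>p\<in>\<A>. orients \<A> UNIV (f \<circ> p))}\<rparr>"

definition isotopic :: "'a topology \<Rightarrow> ('a \<Rightarrow> 'a) \<Rightarrow> ('a \<Rightarrow> 'a) \<Rightarrow> bool" where
  "isotopic S = homotopic_with (homeomorphic_map S S) S S"

definition Homeo_zero :: "'a topology \<Rightarrow> (complex \<Rightarrow> 'a) set \<Rightarrow> ('a \<Rightarrow> 'a) set" where
  "Homeo_zero S \<A> = {f \<in> carrier (Homeo_plus S \<A>). isotopic S (\<lambda>x\<in>topspace S. x) f}"

text \<open>
  The elements are cosets, i.e. isotopy classes, so that \<open>f \<in> h\<close> means that the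
  homeomorphism \<open>f\<close> represents the mapping class \<open>h\<close>.
\<close>

definition MCG :: "'a topology \<Rightarrow> (complex \<Rightarrow> 'a) set \<Rightarrow> ('a \<Rightarrow> 'a) set monoid" where
  "MCG S \<A> = Homeo_plus S \<A> Mod Homeo_zero S \<A>"

definition mapping_class ::
    "'a topology \<Rightarrow> (complex \<Rightarrow> 'a) set \<Rightarrow> ('a \<Rightarrow> 'a) \<Rightarrow> ('a \<Rightarrow> 'a) set" where
  "mapping_class S \<A> f = Homeo_zero S \<A> #>\<^bsub>Homeo_plus S \<A>\<^esub> f"

section \<open>Dehn twists\<close>

definition annulus :: "complex set" where
  "annulus = {z. 1 \<le> norm z \<and> norm z \<le> 2}"

text \<open>
  In polar coordinates this is \<open>(r, \<theta>) \<mapsto> (r, \<theta> + 2 \<pi> (r - 1))\<close>: an arc that crosses the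
  annulus radially, in either direction, is made to turn left.
\<close>

definition left_twist :: "complex \<Rightarrow> complex" where
  "left_twist z = z * cis (2 * pi * (norm z - 1))"

text \<open>An orientation preserving parametrization of an annular neighbourhood with core \<open>C\<close>.\<close>

definition annular_neighbourhood ::
    "'a topology \<Rightarrow> (complex \<Rightarrow> 'a) set \<Rightarrow> 'a set \<Rightarrow> (complex \<Rightarrow> 'a) \<Rightarrow> bool" where
  "annular_neighbourhood S \<A> C e \<longleftrightarrow>
     embedding_map (top_of_set annulus) S e \<and>
     orients \<A> (interior annulus) e \<and>
     e ` sphere 0 (3/2) = C"

definition twist_along :: "'a topology \<Rightarrow> (complex \<Rightarrow> 'a) \<Rightarrow> 'a \<Rightarrow> 'a" where
  "twist_along S e =
     (\<lambda>x\<in>topspace S. if x \<in> e ` annulus then e (left_twist (inv_into annulus e x)) else x)"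

text \<open>
  \<open>t = t\<^sub>C\<close>. Classically every \<open>C\<close> has an annular neighbourhood and the mapping class of the
  twist does not depend on it, so that exactly one \<open>t\<close> satisfies this predicate.
\<close>

definition is_left_Dehn_twist ::
    "'a topology \<Rightarrow> (complex \<Rightarrow> 'a) set \<Rightarrow> 'a set \<Rightarrow> ('a \<Rightarrow> 'a) set \<Rightarrow> bool" where
  "is_left_Dehn_twist S \<A> C t \<longleftrightarrow>
     (\<exists>e. annular_neighbourhood S \<A> C e \<and> t = mapping_class S \<A> (twist_along S e))"

section \<open>Fractional powers and roots\<close>

definition is_fractional_power ::
    "('g, 'm) monoid_scheme \<Rightarrow> 'g \<Rightarrow> nat \<Rightarrow> nat \<Rightarrow> 'g \<Rightarrow> bool" where
  "is_fractional_power G t l n h \<longleftrightarrow> h \<in> carrier G \<and> h [^]\<^bsub>G\<^esub> n = t [^]\<^bsub>G\<^esub> l"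

definition is_root :: "('g, 'm) monoid_scheme \<Rightarrow> 'g \<Rightarrow> nat \<Rightarrow> 'g \<Rightarrow> bool" where
  "is_root G t n h \<longleftrightarrow> h \<in> carrier G \<and> h [^]\<^bsub>G\<^esub> n = t"

text \<open>
  For a homeomorphism \<open>f\<close> with \<open>f ` C = C\<close>: points close to \<open>C\<close> on one side of \<open>C\<close> in an annular
  neighbourhood are mapped to the other side, and vice versa.
\<close>

definition interchanges_sides ::
    "'a topology \<Rightarrow> (complex \<Rightarrow> 'a) set \<Rightarrow> 'a set \<Rightarrow> ('a \<Rightarrow> 'a) \<Rightarrow> bool" where
  "interchanges_sides S \<A> C f \<longleftrightarrow>
     (\<exists>e \<delta>. annular_neighbourhood S \<A> C e \<and> \<delta> > 0 \<and>
        f ` e ` {z \<in> annulus. 3/2 - \<delta> < norm z \<and> norm z < 3/2}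
          \<subseteq> e ` {z \<in> annulus. norm z > 3/2} \<and>
        f ` e ` {z \<in> annulus. 3/2 < norm z \<and> norm z < 3/2 + \<delta>}
          \<subseteq> e ` {z \<in> annulus. norm z < 3/2})"

text \<open>
  The notions below concern mapping classes that preserve the isotopy class of \<open>C\<close>, i.e. that
  have a representative \<open>f\<close> with \<open>f ` C = C\<close>; they refer to such a representative.
\<close>

definition side_exchanging ::
    "'a topology \<Rightarrow> (complex \<Rightarrow> 'a) set \<Rightarrow> 'a set \<Rightarrow> ('a \<Rightarrow> 'a) set \<Rightarrow> bool" where
  "side_exchanging S \<A> C h \<longleftrightarrow> (\<exists>f\<in>h. f ` C = C \<and> interchanges_sides S \<A> C f)"

definition side_preserving ::
    "'a topology \<Rightarrow> (complex \<Rightarrow> 'a) set \<Rightarrow> 'a set \<Rightarrow> ('a \<Rightarrow> 'a) set \<Rightarrow> bool" where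
  "side_preserving S \<A> C h \<longleftrightarrow> (\<exists>f\<in>h. f ` C = C \<and> \<not> interchanges_sides S \<A> C f)"

end

theory Submission
  imports Defs "HOL-Complex_Analysis.Riemann_Mapping"
begin

text \<open>
  If \<open>h\<close> commutes with \<open>t\<close> and \<open>l a = n b + 1\<close>, then \<open>h' = h\<^sup>a t\<^sup>-\<^sup>b\<close> satisfies \<open>h'\<^sup>n = t\<close> and
  \<open>h'\<^sup>l = h\<close>. A representative \<open>f\<close> of \<open>h\<close> with \<open>f ` C = C\<close> conjugates the twist along an annular
  neighbourhood \<open>e\<close> of \<open>C\<close> to the twist along \<open>f \<circ> e\<close>, which is another annular neighbourhood of
  \<open>C\<close>, so it is enough that the isotopy class of the twist depends only on \<open>C\<close>.

  No annulus theorem is needed for this. Twists that map each circle of an annulus to itself can be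
  deformed linearly in the angle, so a twist can be moved to either half of its annulus. After a
  half turn of \<open>e'\<close>, if necessary, the sides of \<open>e\<close> and \<open>e'\<close> agree; then so do the directions
  of their cores, because both preserve orientation, and the inner half of \<open>e\<close>, reparametrized
  on its circles, together with a thin collar on the outer side of \<open>e'\<close> forms a third annulus. A
  twist along it is moved from the half that belongs to \<open>e\<close> to the half that belongs to \<open>e'\<close>.
\<close>

section \<open>Local degree in the plane\<close>

text \<open>Charts and homeomorphisms are only continuous, so orientation has to be expressed by
  winding numbers of images of small circles, and this degree must first be shown to multiply under
  composition. Two annular neighbourhoods of \<open>C\<close> may overlap in any manner away from
  \<open>C\<close>, and on \<open>C\<close> their parametrizations differ by an arbitrary
  homeomorphism of the circle. Only the behaviour in an arbitrarily thin collar of \<open>C\<close>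
  can be controlled, which is why the twists are moved rather than the annuli. The linear
  deformation works on lifts to the line: increasing functions that commute with the translation by
  \<open>2 * pi\<close> form a convex set, and the identity and the full turn, prescribed on the two
  boundary circles, persist during the deformation. The directions of the cores matter because
  gluing an inner half along a reversed core would turn a left twist into a right one; excluding
  this is the only place where the topology of the plane, in the form of a degree -1 against a
  degree 1, enters the comparison.\<close>

lemma exp_lift_diff_const:
  fixes f g :: "'b::topological_space \<Rightarrow> complex"
  assumes "connected S" "continuous_on S f" "continuous_on S g"
    and eq: "\<And>x. x \<in> S \<Longrightarrow> exp (f x) = exp (g x)" and "a \<in> S" "b \<in> S"
  shows "f a - g a = f b - g b"
proof -
  have *: "\<exists>n::int. f x - g x = of_int n * (2 * of_real pi * \<i>)" if x: "x \<in> S" for x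
  proof -
    obtain n :: int where "f x = g x + (of_int (2 * n) * pi) * \<i>"
      using eq[OF x] unfolding exp_eq by blast
    then have "f x - g x = of_int n * (2 * of_real pi * \<i>)"
      by (simp add: algebra_simps)
    then show ?thesis ..
  qed
  have "(\<lambda>x. f x - g x) constant_on S"
  proof (rule continuous_discrete_range_constant)
    show "connected S" "continuous_on S (\<lambda>x. f x - g x)"
      using assms by (auto intro: continuous_intros)
    fix x assume x: "x \<in> S"
    show "\<exists>e>0. \<forall>y. y \<in> S \<and> f y - g y \<noteq> f x - g x \<longrightarrow> e \<le> cmod (f y - g y - (f x - g x))"
    proof (intro exI[of _ "2 * pi"] conjI allI impI)
      fix y assume y: "y \<in> S \<and> f y - g y \<noteq> f x - g x"
      obtain m n :: int where mn: "f x - g x = of_int n * (2 * of_real pi * \<i>)"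
          "f y - g y = of_int m * (2 * of_real pi * \<i>)"
        using * x y by meson
      then have "m \<noteq> n" using y by auto
      then have "1 \<le> \<bar>real_of_int (m - n)\<bar>" by linarith
      moreover have "f y - g y - (f x - g x) = of_int (m - n) * (2 * of_real pi * \<i>)"
        unfolding mn by (simp add: algebra_simps)
      ultimately show "2 * pi \<le> cmod (f y - g y - (f x - g x))"
        by (simp add: norm_mult del: of_int_diff)
    qed auto
  qed
  then show ?thesis using assms by (auto simp: constant_on_def)
qed

text \<open>Two continuous logarithms of one path differ by a constant, so any of them gives the
  winding number. Later degrees are read off from explicit choices of \<open>L\<close>.\<close>

lemma winding_number_exp_path:
  assumes L: "path L" and p: "\<And>t. t \<in> {0..1} \<Longrightarrow> p t = z + exp (L t)"
  shows "winding_number p z = (L 1 - L 0) / (2 * of_real pi * \<i>)"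
proof -
  have cL: "continuous_on {0..1} L" using L by (simp add: path_def)
  have "continuous_on {0..1} p"
    by (rule continuous_on_eq[of _ "\<lambda>t. z + exp (L t)"]) (auto intro!: continuous_intros cL simp: p)
  then have "path p" by (simp add: path_def)
  moreover have "z \<notin> path_image p" by (auto simp: path_image_def p)
  ultimately obtain q where q: "path q"
      "pathfinish q - pathstart q = 2 * of_real pi * \<i> * winding_number p z"
      "\<And>t. t \<in> {0..1} \<Longrightarrow> p t = z + exp (q t)"
    using winding_number_as_continuous_log[of p z] by blast
  have "q 1 - L 1 = q 0 - L 0"
    by (rule exp_lift_diff_const[of "{0..1::real}"]) (use q p cL in \<open>auto simp: path_def\<close>)
  then have "L 1 - L 0 = 2 * of_real pi * \<i> * winding_number p z"
    using q(2) by (simp add: pathfinish_def pathstart_def algebra_simps)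
  then show ?thesis by simp
qed

text \<open>Multiplicativity of the degree. The map \<open>\<lambda>u. z + exp u\<close> presents
  the punctured disc as the quotient of a half plane by the translation by
  \<open>2 * pi * \<i>\<close>. A logarithm of \<open>f - f z\<close> pulled back to the half plane
  changes by a fixed amount under this translation, and a loop that winds \<open>k\<close> times
  lifts to a path between points that differ by \<open>k\<close> translations.\<close>

lemma winding_number_comp_circle:
  assumes r: "0 < r" "r < R" and f: "continuous_on (ball z R) f"
    and ne: "\<And>w. w \<in> ball z R \<Longrightarrow> w \<noteq> z \<Longrightarrow> f w \<noteq> f z"
    and g: "path g" "pathfinish g = pathstart g" and im: "path_image g \<subseteq> ball z R - {z}"
  shows "winding_number (f \<circ> g) (f z)
       = winding_number g z * winding_number (f \<circ> circlepath z r) (f z)"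
proof -
  define HP where "HP = {u. Re u < ln R}"
  have cvx: "convex HP" unfolding HP_def by (simp add: convex_halfspace_Re_lt)
  have exp_in: "z + exp u \<in> ball z R \<and> z + exp u \<noteq> z" if "u \<in> HP" for u
  proof -
    have "exp (Re u) < exp (ln R)" using that unfolding HP_def by simp
    then have "exp (Re u) < R" using r by simp
    then show ?thesis by (simp add: dist_norm)
  qed
  have in_HP: "u \<in> HP" if "z + exp u \<in> ball z R" for u
  proof -
    have "exp (Re u) < exp (ln R)" using that r by (simp add: dist_norm)
    then show ?thesis unfolding HP_def by simp
  qed
  have "continuous_on HP (\<lambda>u. f (z + exp u) - f z)"
    by (intro continuous_intros continuous_on_compose2[OF f]) (use exp_in in auto)
  then obtain \<Lambda> where \<Lambda>: "continuous_on HP \<Lambda>"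
      "\<And>u. u \<in> HP \<Longrightarrow> f (z + exp u) - f z = exp (\<Lambda> u)"
    by (rule continuous_logarithm_on_contractible)
      (use cvx ne exp_in convex_imp_contractible in auto)
  \<comment> \<open>The increment of the lifted logarithm over one turn, that is,
    \<open>2 * pi * \<i>\<close> times the degree of \<open>f\<close> on the circle of radius
    \<open>r\<close>.\<close>
  define c where "c = \<Lambda> (of_real (ln r) + 2 * of_real pi * \<i>) - \<Lambda> (of_real (ln r))"
  have lnr: "of_real (ln r) \<in> HP" using r by (simp add: HP_def)
  have shift: "u + of_real x * \<i> \<in> HP" if "u \<in> HP" for u x using that by (simp add: HP_def)
  have \<Lambda>1: "\<Lambda> (u + 2 * of_real pi * \<i>) = \<Lambda> u + c" if u: "u \<in> HP" for u
  proof -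
    have "\<Lambda> (u + 2 * of_real pi * \<i>) - \<Lambda> u
        = \<Lambda> (of_real (ln r) + 2 * of_real pi * \<i>) - \<Lambda> (of_real (ln r))"
    proof (rule exp_lift_diff_const[of HP])
      show "connected HP" using cvx convex_connected by blast
      show "continuous_on HP (\<lambda>u. \<Lambda> (u + 2 * of_real pi * \<i>))"
        by (intro continuous_on_compose2[OF \<Lambda>(1)] continuous_intros)
           (use shift[of _ "2*pi"] in auto)
      show "exp (\<Lambda> (u + 2 * of_real pi * \<i>)) = exp (\<Lambda> u)" if "u \<in> HP" for u
        using \<Lambda>(2)[OF that] \<Lambda>(2)[OF shift[OF that, of "2*pi"]] by (simp add: exp_add)
    qed (use \<Lambda> u lnr in auto)
    then show ?thesis unfolding c_def diff_eq_eq by (simp add: add.commute)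
  qed
  have \<Lambda>k: "\<Lambda> (u + of_int k * (2 * of_real pi * \<i>)) = \<Lambda> u + of_int k * c" if "u \<in> HP" for u k
  proof (induction k rule: int_induct[of _ 0])
    case (step1 k)
    then show ?case
      using \<Lambda>1[OF shift[OF that, of "of_int k * (2 * pi)"]] by (simp add: algebra_simps)
  next
    case (step2 k)
    then show ?case
      using \<Lambda>1[OF shift[OF that, of "of_int (k - 1) * (2 * pi)"]] by (simp add: algebra_simps)
  qed auto
  have "winding_number (f \<circ> circlepath z r) (f z)
      = (\<Lambda> (of_real (ln r) + of_real (2 * pi * 1) * \<i>) - \<Lambda> (of_real (ln r) + of_real (2 * pi * 0) * \<i>))
          / (2 * of_real pi * \<i>)"
  proof (rule winding_number_exp_path)
    show "path (\<lambda>t. \<Lambda> (of_real (ln r) + of_real (2 * pi * t) * \<i>))"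
      unfolding path_def
      by (intro continuous_on_compose2[OF \<Lambda>(1)] continuous_intros)
         (use shift[OF lnr] in \<open>auto simp del: of_real_mult\<close>)
    show "(f \<circ> circlepath z r) t = f z + exp (\<Lambda> (of_real (ln r) + of_real (2 * pi * t) * \<i>))" for t
      using \<Lambda>(2)[OF shift[OF lnr, of "2 * pi * t"]] r
      by (simp add: circlepath exp_add exp_of_real algebra_simps)
  qed
  then have wc: "winding_number (f \<circ> circlepath z r) (f z) = c / (2 * of_real pi * \<i>)"
    by (simp add: c_def)
  have zg: "z \<notin> path_image g" using im by auto
  obtain q where q: "path q" "pathfinish q - pathstart q = 2 * of_real pi * \<i> * winding_number g z"
      "\<And>t. t \<in> {0..1} \<Longrightarrow> g t = z + exp (q t)"
    using winding_number_as_continuous_log[OF g(1) zg] by blast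
  have qHP: "q t \<in> HP" if "t \<in> {0..1}" for t
  proof (rule in_HP)
    have "g t \<in> path_image g" using that by (simp add: path_image_def)
    then show "z + exp (q t) \<in> ball z R" using im q(3)[OF that] by auto
  qed
  have wg: "winding_number (f \<circ> g) (f z) = (\<Lambda> (q 1) - \<Lambda> (q 0)) / (2 * of_real pi * \<i>)"
  proof (rule winding_number_exp_path)
    show "path (\<lambda>t. \<Lambda> (q t))" unfolding path_def
      by (intro continuous_on_compose2[OF \<Lambda>(1)]) (use qHP q(1) in \<open>auto simp: path_def\<close>)
    show "(f \<circ> g) t = f z + exp (\<Lambda> (q t))" if "t \<in> {0..1}" for t
      using \<Lambda>(2)[OF qHP[OF that]] q(3)[OF that] by (simp add: diff_eq_eq add.commute)
  qed
  obtain k :: int where k: "winding_number g z = of_int k"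
    using integer_winding_number[OF g zg] by (auto elim: Ints_cases)
  have "q 1 = q 0 + of_int k * (2 * of_real pi * \<i>)"
    using q(2) by (simp add: k pathfinish_def pathstart_def algebra_simps)
  then have "\<Lambda> (q 1) = \<Lambda> (q 0) + of_int k * c" using \<Lambda>k qHP by simp
  then show ?thesis by (simp add: wg wc k)
qed

section \<open>Invariance of winding numbers in families of injective maps\<close>

lemma winding_number_family_eq:
  fixes H :: "real \<Rightarrow> real \<Rightarrow> complex"
  assumes H: "continuous_on ({0..1} \<times> {0..1}) (\<lambda>(s, t). H s t)" and c: "continuous_on {0..1} c"
    and ne: "\<And>s t. s \<in> {0..1} \<Longrightarrow> t \<in> {0..1} \<Longrightarrow> H s t \<noteq> c s"
    and loop: "\<And>s. s \<in> {0..1} \<Longrightarrow> H s 0 = H s 1"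
  shows "winding_number (H 0) (c 0) = winding_number (H 1) (c 1)"
proof -
  have "continuous_on ({0..1} \<times> {0..1}) (\<lambda>x. (\<lambda>(s, t). H s t) x - c (fst x))"
    by (intro continuous_intros H continuous_on_compose2[OF c]) auto
  then have "continuous_on ({0..1} \<times> {0..1}) (\<lambda>(s, t). H s t - c s)"
    by (simp add: case_prod_unfold)
  then have "homotopic_loops (-{0}) (\<lambda>t. H 0 t - c 0) (\<lambda>t. H 1 t - c 1)"
    unfolding homotopic_loops
    by (intro exI[of _ "\<lambda>(s, t). H s t - c s"])
       (use ne loop in \<open>auto simp: pathfinish_def pathstart_def\<close>)
  then have "winding_number (\<lambda>t. H 0 t - c 0) 0 = winding_number (\<lambda>t. H 1 t - c 1) 0"
    by (rule winding_number_homotopic_loops)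
  then show ?thesis by (simp add: winding_number_offset[of _ "c _"])
qed

lemma circlepath_in_cball: "0 \<le> r \<Longrightarrow> circlepath z r t \<in> cball z r"
  by (simp add: circlepath dist_norm norm_mult)

lemma circlepath_neq: "0 < r \<Longrightarrow> circlepath z r t \<noteq> z"
  by (simp add: circlepath)

text \<open>Injectivity keeps the image of the circle away from the image of its centre at every
  time, so the winding number cannot jump.\<close>

lemma winding_number_inj_family:
  fixes H :: "real \<Rightarrow> complex \<Rightarrow> complex"
  assumes r: "0 < r" and H: "continuous_on ({0..1} \<times> cball z r) (\<lambda>(s, w). H s w)"
    and inj: "\<And>s. s \<in> {0..1} \<Longrightarrow> inj_on (H s) (cball z r)"
  shows "winding_number (H 0 \<circ> circlepath z r) (H 0 z) = winding_number (H 1 \<circ> circlepath z r) (H 1 z)"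
proof -
  have H': "continuous_on X (\<lambda>x. H (a x) (b x))"
    if "continuous_on X a" "continuous_on X b" "a ` X \<subseteq> {0..1}" "b ` X \<subseteq> cball z r"
    for X :: "'z::topological_space set" and a b
    using continuous_on_compose2[OF H, of X "\<lambda>x. (a x, b x)"] that
    by (auto intro: continuous_intros)
  have "winding_number ((\<lambda>s t. H s (circlepath z r t)) 0) ((\<lambda>s. H s z) 0)
      = winding_number ((\<lambda>s t. H s (circlepath z r t)) 1) ((\<lambda>s. H s z) 1)"
  proof (rule winding_number_family_eq)
    have "continuous_on ({0..1} \<times> {0..1}) (\<lambda>x::real \<times> real. H (fst x) (circlepath z r (snd x)))"
    proof (rule H')
      show "continuous_on ({0..1} \<times> {0..1}) (\<lambda>x::real \<times> real. circlepath z r (snd x))"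
        unfolding circlepath by (intro continuous_intros)
    qed (use r circlepath_in_cball[of r z] in \<open>auto intro: continuous_intros\<close>)
    then show "continuous_on ({0..1} \<times> {0..1}) (\<lambda>(s, t). H s (circlepath z r t))"
      by (simp add: case_prod_unfold)
    show "continuous_on {0..1} (\<lambda>s. H s z)"
      using r by (intro H') (auto intro: continuous_intros)
    show "H s (circlepath z r t) \<noteq> H s z" if "s \<in> {0..1}" for s t
      using inj_onD[OF inj[OF that], of "circlepath z r t" z] r circlepath_in_cball[of r z t]
        circlepath_neq[OF r, of z t] by auto
  qed (simp add: circlepath)
  then show ?thesis by (simp add: o_def)
qed

lemma winding_number_inj_circles_eq:
  assumes f: "continuous_on B f" "inj_on f B" "convex B"
    and r: "0 < r" "cball z r \<subseteq> B" "0 < r'" "cball z' r' \<subseteq> B"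
  shows "winding_number (f \<circ> circlepath z r) (f z) = winding_number (f \<circ> circlepath z' r') (f z')"
proof -
  \<comment> \<open>The two discs are joined through discs whose centre and radius are convex
    combinations. Here \<open>w\<close> runs over the unit disc, and the radius
    \<open>(1 - s) * r + s * r'\<close> stays positive.\<close>
  define H where "H = (\<lambda>s w. f ((1 - s) *\<^sub>R (z + of_real r * w) + s *\<^sub>R (z' + of_real r' * w)))"
  have inB: "(1 - s) *\<^sub>R (z + of_real r * w) + s *\<^sub>R (z' + of_real r' * w) \<in> B"
    if "s \<in> {0..1}" "w \<in> cball 0 1" for s and w :: complex
  proof (rule convexD_alt[OF f(3)])
    show "z + of_real r * w \<in> B"
      using r that mult_left_le[of "cmod w" r] by (intro subsetD[OF r(2)]) (simp add: dist_norm norm_mult)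
    show "z' + of_real r' * w \<in> B"
      using r that mult_left_le[of "cmod w" r'] by (intro subsetD[OF r(4)]) (simp add: dist_norm norm_mult)
  qed (use that in auto)
  have "winding_number (H 0 \<circ> circlepath 0 1) (H 0 0) = winding_number (H 1 \<circ> circlepath 0 1) (H 1 0)"
  proof (rule winding_number_inj_family)
    show "continuous_on ({0..1} \<times> cball 0 1) (\<lambda>(s, w). H s w)"
      unfolding H_def case_prod_unfold
      by (rule continuous_on_compose2[OF f(1)]) (use inB in \<open>auto intro!: continuous_intros\<close>)
    show "inj_on (H s) (cball 0 1)" if s: "s \<in> {0..1}" for s
    proof (rule inj_onI)
      fix v w assume vw: "v \<in> cball 0 1" "w \<in> cball 0 1" "H s v = H s w"
      then have "(1 - s) *\<^sub>R (z + of_real r * v) + s *\<^sub>R (z' + of_real r' * v)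
          = (1 - s) *\<^sub>R (z + of_real r * w) + s *\<^sub>R (z' + of_real r' * w)"
        using inj_onD[OF f(2)] inB[OF s] unfolding H_def by blast
      then have "of_real ((1 - s) * r + s * r') * v = of_real ((1 - s) * r + s * r') * w"
        by (simp add: algebra_simps scaleR_conv_of_real)
      moreover have "(1 - s) * r + s * r' > 0"
        using r s by (cases "s = 0") (auto intro: add_nonneg_pos)
      then have "complex_of_real ((1 - s) * r + s * r') \<noteq> 0" unfolding of_real_eq_0_iff by simp
      ultimately show "v = w" using mult_left_cancel by blast
    qed
  qed auto
  then show ?thesis by (simp add: H_def o_def circlepath)
qed

text \<open>Depends only on the germ of \<open>f\<close> at \<open>z\<close>. Continuity and
  injectivity near \<open>z\<close> are included so that the notion passes to composites and every
  small circle can be used.\<close>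

definition oriented_at :: "(complex \<Rightarrow> complex) \<Rightarrow> complex \<Rightarrow> bool" where
  "oriented_at f z \<longleftrightarrow> (\<exists>R>0. continuous_on (ball z R) f \<and> inj_on f (ball z R) \<and>
     (\<forall>r. 0 < r \<and> r < R \<longrightarrow> winding_number (f \<circ> circlepath z r) (f z) = 1))"

text \<open>Concentric circles in a disc on which the map is injective have equal winding numbers,
  so one of them decides.\<close>

lemma oriented_atI:
  assumes U: "open U" "z \<in> U" "continuous_on U f" "inj_on f U"
    and w: "0 < r" "cball z r \<subseteq> U" "winding_number (f \<circ> circlepath z r) (f z) = 1"
  shows "oriented_at f z"
proof -
  have sub: "ball z r \<subseteq> U" using w by auto
  have "winding_number (f \<circ> circlepath z r') (f z) = 1" if r': "0 < r'" "r' < r" for r'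
  proof -
    have "winding_number (f \<circ> circlepath z r') (f z) = winding_number (f \<circ> circlepath z r) (f z)"
      using assms r' subset_cball[of r' r z]
      by (intro winding_number_inj_circles_eq[of "cball z r" f])
         (auto intro: continuous_on_subset inj_on_subset)
    then show ?thesis using w by simp
  qed
  then show ?thesis unfolding oriented_at_def
    using w sub U by (intro exI[of _ r]) (auto intro: continuous_on_subset inj_on_subset)
qed

lemma oriented_atD:
  assumes "oriented_at f z" "continuous_on (cball z r) f" "inj_on f (cball z r)" "0 < r"
  shows "winding_number (f \<circ> circlepath z r) (f z) = 1"
proof -
  obtain R where R: "R > 0" "\<And>r. 0 < r \<Longrightarrow> r < R \<Longrightarrow> winding_number (f \<circ> circlepath z r) (f z) = 1"
    using assms(1) unfolding oriented_at_def by auto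
  define r' where "r' = min r (R / 2)"
  have r': "0 < r'" "r' < R" "r' \<le> r" using R assms(4) by (auto simp: r'_def)
  have "winding_number (f \<circ> circlepath z r) (f z) = winding_number (f \<circ> circlepath z r') (f z)"
    using assms r' subset_cball[of r' r z]
    by (intro winding_number_inj_circles_eq[of "cball z r" f]) auto
  then show ?thesis using R(2) r' by simp
qed

text \<open>Replaces a condition on all discs in \<open>U\<close> by a pointwise one, which is
  easier to compose.\<close>

lemma orientation_preserving_on_iff:
  assumes "open U" "continuous_on U f" "inj_on f U"
  shows "orientation_preserving_on U f \<longleftrightarrow> (\<forall>z\<in>U. oriented_at f z)"
proof (intro iffI ballI)
  fix z assume o: "orientation_preserving_on U f" and z: "z \<in> U"
  obtain r where "0 < r" "cball z r \<subseteq> U" using assms(1) z open_contains_cball by meson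
  then show "oriented_at f z"
    using o z assms unfolding orientation_preserving_on_def by (intro oriented_atI[of U]) auto
next
  assume "\<forall>z\<in>U. oriented_at f z"
  then show "orientation_preserving_on U f"
    unfolding orientation_preserving_on_def
    using assms by (auto intro!: oriented_atD intro: continuous_on_subset inj_on_subset)
qed

section \<open>Composition and continuation of local orientations\<close>

lemma oriented_at_mono_ball:
  assumes "oriented_at f z"
  obtains R where "R > 0" "\<And>r. 0 < r \<Longrightarrow> r \<le> R \<Longrightarrow>
     continuous_on (ball z r) f \<and> inj_on f (ball z r) \<and>
     (\<forall>s. 0 < s \<and> s < r \<longrightarrow> winding_number (f \<circ> circlepath z s) (f z) = 1)"
proof -
  obtain R where R: "R > 0" "continuous_on (ball z R) f" "inj_on f (ball z R)"
      "\<And>r. 0 < r \<Longrightarrow> r < R \<Longrightarrow> winding_number (f \<circ> circlepath z r) (f z) = 1"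
    using assms unfolding oriented_at_def by auto
  show ?thesis
  proof (rule that[OF R(1)])
    fix r assume r: "0 < r" "r \<le> R"
    then have "ball z r \<subseteq> ball z R" by auto
    then show "continuous_on (ball z r) f \<and> inj_on f (ball z r) \<and>
     (\<forall>s. 0 < s \<and> s < r \<longrightarrow> winding_number (f \<circ> circlepath z s) (f z) = 1)"
      using R r by (auto intro: continuous_on_subset inj_on_subset)
  qed
qed

lemma oriented_at_cong:
  assumes f: "oriented_at f z" and U: "open U" "z \<in> U" "\<And>w. w \<in> U \<Longrightarrow> f w = g w"
  shows "oriented_at g z"
proof -
  obtain R where R: "R > 0" "\<And>r. 0 < r \<Longrightarrow> r \<le> R \<Longrightarrow>
     continuous_on (ball z r) f \<and> inj_on f (ball z r) \<and>
     (\<forall>s. 0 < s \<and> s < r \<longrightarrow> winding_number (f \<circ> circlepath z s) (f z) = 1)"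
    using oriented_at_mono_ball[OF f] by blast
  obtain r where r: "0 < r" "ball z r \<subseteq> U" using U open_contains_ball by meson
  define r' where "r' = min r R"
  have r': "0 < r'" "r' \<le> R" "ball z r' \<subseteq> U" using r R by (auto simp: r'_def)
  have eq: "f w = g w" if "w \<in> ball z r'" for w using that U r' by auto
  have "winding_number (g \<circ> circlepath z s) (g z) = 1" if s: "0 < s" "s < r'" for s
  proof -
    have "winding_number (f \<circ> circlepath z s) (f z) = 1" using R(2)[OF r'(1,2)] s by blast
    moreover have "circlepath z s t \<in> ball z r'" for t
      using s circlepath_in_cball[of s z t] by simp
    then have "f \<circ> circlepath z s = g \<circ> circlepath z s"
      by (simp add: fun_eq_iff eq)
    ultimately show ?thesis using U by simp
  qed
  moreover have "continuous_on (ball z r') g" "inj_on g (ball z r')"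
    using R(2)[OF r'(1,2)] eq continuous_on_eq inj_on_cong by metis+
  ultimately show ?thesis unfolding oriented_at_def using r' by blast
qed

text \<open>Degrees multiply and \<open>f\<close> has degree 1. The equivalence, more than closure
  under composition, is what later determines the orientation of inverse maps.\<close>

lemma oriented_at_comp_iff:
  assumes f: "oriented_at f z" and V: "open V" "f z \<in> V" "continuous_on V g" "inj_on g V"
  shows "oriented_at (g \<circ> f) z \<longleftrightarrow> oriented_at g (f z)"
proof -
  obtain R where R: "R > 0" "\<And>r. 0 < r \<Longrightarrow> r \<le> R \<Longrightarrow>
     continuous_on (ball z r) f \<and> inj_on f (ball z r) \<and>
     (\<forall>s. 0 < s \<and> s < r \<longrightarrow> winding_number (f \<circ> circlepath z s) (f z) = 1)"
    using oriented_at_mono_ball[OF f] by blast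
  obtain s where s: "s > 0" "ball (f z) s \<subseteq> V" using V open_contains_ball by meson
  have "continuous_on (ball z R) f" using R by blast
  then have "open (f -` ball (f z) s \<inter> ball z R)"
    by (meson continuous_on_open_vimage open_ball)
  moreover have "z \<in> f -` ball (f z) s \<inter> ball z R" using s R by auto
  ultimately obtain r where r: "r > 0" "ball z r \<subseteq> f -` ball (f z) s \<inter> ball z R"
    using open_contains_ball by meson
  have "r \<le> R" using r R ball_subset_ball_iff[of z r z R] by auto
  then have fr: "continuous_on (ball z r) f" "inj_on f (ball z r)"
     "\<And>q. 0 < q \<Longrightarrow> q < r \<Longrightarrow> winding_number (f \<circ> circlepath z q) (f z) = 1"
    using R(2)[OF r(1)] by blast+
  have gs: "continuous_on (ball (f z) s) g" "inj_on g (ball (f z) s)"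
    using s V continuous_on_subset inj_on_subset by metis+
  have imf: "f ` ball z r \<subseteq> ball (f z) s" using r by auto
  have gf: "continuous_on (ball z r) (g \<circ> f)" "inj_on (g \<circ> f) (ball z r)"
    using fr gs imf by (meson continuous_on_compose continuous_on_subset comp_inj_on inj_on_subset)+
  have key: "winding_number (g \<circ> f \<circ> circlepath z (r/2)) ((g \<circ> f) z) = winding_number (g \<circ> circlepath (f z) (s/2)) (g (f z))"
  proof -
    have in_r: "circlepath z (r/2) t \<in> ball z r" for t
      using circlepath_in_cball[of "r/2" z t] r by (simp add: dist_norm)
    have "winding_number (g \<circ> (f \<circ> circlepath z (r/2))) (g (f z))
        = winding_number (f \<circ> circlepath z (r/2)) (f z) * winding_number (g \<circ> circlepath (f z) (s/2)) (g (f z))"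
    proof (rule winding_number_comp_circle)
      show "0 < s/2" "s/2 < s" "continuous_on (ball (f z) s) g" using s gs by auto
      show "g w \<noteq> g (f z)" if "w \<in> ball (f z) s" "w \<noteq> f z" for w
        using gs(2) that s by (auto dest: inj_onD)
      show "path (f \<circ> circlepath z (r/2))"
        by (rule path_continuous_image) (use in_r fr in \<open>auto intro: continuous_on_subset simp: path_image_def\<close>)
      show "pathfinish (f \<circ> circlepath z (r/2)) = pathstart (f \<circ> circlepath z (r/2))"
        by (simp add: pathfinish_compose pathstart_compose)
      show "path_image (f \<circ> circlepath z (r/2)) \<subseteq> ball (f z) s - {f z}"
        using imf in_r circlepath_neq[of "r/2" z] r inj_onD[OF fr(2), of "circlepath z (r/2) _" z]
        by (auto simp: path_image_def) blast
    qed
    moreover have "winding_number (f \<circ> circlepath z (r/2)) (f z) = 1" using r by (intro fr) auto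
    ultimately show ?thesis by (simp add: o_assoc)
  qed
  show ?thesis
  proof
    assume "oriented_at (g \<circ> f) z"
    then have "winding_number (g \<circ> f \<circ> circlepath z (r/2)) ((g \<circ> f) z) = 1"
      using r gf by (intro oriented_atD) (auto intro: continuous_on_subset inj_on_subset)
    then show "oriented_at g (f z)"
      using s gs unfolding key by (intro oriented_atI[where r="s/2" and U="ball (f z) s"]) auto
  next
    assume "oriented_at g (f z)"
    then have "winding_number (g \<circ> circlepath (f z) (s/2)) (g (f z)) = 1"
      using s gs by (intro oriented_atD) (auto intro: continuous_on_subset inj_on_subset)
    then show "oriented_at (g \<circ> f) z"
      using r gf unfolding key[symmetric] by (intro oriented_atI[where r="r/2" and U="ball z r"]) auto
  qed
qed

lemma oriented_at_comp:
  assumes "oriented_at f z" "oriented_at g (f z)"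
  shows "oriented_at (g \<circ> f) z"
proof -
  obtain R where "R > 0" "continuous_on (ball (f z) R) g" "inj_on g (ball (f z) R)"
    using assms(2) unfolding oriented_at_def by auto
  then show ?thesis using oriented_at_comp_iff[OF assms(1), of "ball (f z) R" g] assms(2) by auto
qed

lemma oriented_at_id: "oriented_at (\<lambda>w. w) z"
  by (rule oriented_atI[of UNIV _ _ 1]) (auto simp: o_def winding_number_circlepath continuous_on_id)

text \<open>The degree is constant on a disc of injectivity. This carries orientation to points near
  which no single formula for the map holds, such as the boundary of a twisted annulus.\<close>

lemma oriented_at_locally_const:
  assumes f: "continuous_on (ball z R) f" "inj_on f (ball z R)"
    and w: "w \<in> ball z R" "oriented_at f w"
  shows "oriented_at f z"
proof -
  have "0 < R" using w(1) by (metis ball_empty empty_iff linorder_not_less)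
  obtain r where r: "r > 0" "cball w r \<subseteq> ball z R"
    using w open_contains_cball[of "ball z R"] by (meson open_ball)
  have "winding_number (f \<circ> circlepath w r) (f w) = 1"
    using r w f by (intro oriented_atD) (auto intro: continuous_on_subset inj_on_subset)
  moreover have "winding_number (f \<circ> circlepath w r) (f w) = winding_number (f \<circ> circlepath z (R/2)) (f z)"
    using \<open>0 < R\<close> r f by (intro winding_number_inj_circles_eq[of "ball z R"]) auto
  ultimately show ?thesis
    using f \<open>0 < R\<close> by (intro oriented_atI[where r="R/2" and U="ball z R"]) auto
qed

text \<open>On the circle of radius 1/2 the distance from \<open>exp w\<close> to
  \<open>1 + w\<close> is less than \<open>cmod w\<close>, so \<open>exp\<close> winds around
  \<open>1\<close> just as the identity winds around \<open>0\<close>.\<close>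

lemma oriented_at_exp: "oriented_at exp 0"
proof (rule oriented_atI[of "ball 0 1" _ _ "1/2"])
  show "inj_on exp (ball (0::complex) 1)"
  proof (rule inj_onI)
    fix x y :: complex assume "x \<in> ball 0 1" "y \<in> ball 0 1" "exp x = exp y"
    then have "\<bar>Im x - Im y\<bar> < 2 * pi"
      using abs_Im_le_cmod[of x] abs_Im_le_cmod[of y] pi_gt3 by simp
    then show "x = y"
      using \<open>exp x = exp y\<close> by (rule exp_complex_eqI)
  qed
  \<comment> \<open>The Taylor remainder is at most \<open>exp \<bar>Re w\<bar> / 4\<close>, and
    this exponential is below 2.\<close>
  have bd: "cmod (exp w - 1 - w) < cmod w" if "cmod w = 1/2" for w
  proof -
    have "cmod (exp w - (\<Sum>i\<le>1. w ^ i / fact i)) \<le> exp \<bar>Re w\<bar> * (cmod w) ^ Suc 1 / fact 1"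
      by (rule Taylor_exp)
    moreover have "exp \<bar>Re w\<bar> < 2"
    proof -
      have "exp \<bar>Re w\<bar> \<le> exp (1/2)" using that abs_Re_le_cmod[of w] by simp
      also have "(exp (1/2)::real) \<le> 1 + 1/2 + (1/2)^2" by (rule exp_bound) auto
      also have "\<dots> < 2" by (simp add: power2_eq_square)
      finally show ?thesis .
    qed
    ultimately show ?thesis using that by (simp add: power2_eq_square diff_diff_eq)
  qed
  have "winding_number (exp \<circ> circlepath 0 (1/2)) (exp 0) = winding_number (\<lambda>t. 1 + circlepath 0 (1/2) t) 1"
  proof (simp, rule winding_number_nearby_loops_eq)
    show "cmod ((exp \<circ> circlepath 0 (1/2)) t - (1 + circlepath 0 (1/2) t)) < cmod (1 + circlepath 0 (1/2) t - 1)" for t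
      using bd[of "circlepath 0 (1/2) t"] by (simp add: circlepath norm_mult diff_diff_eq)
    show "path (\<lambda>t. 1 + circlepath 0 (1/2) t)" "path (exp \<circ> circlepath 0 (1/2))"
      unfolding path_def circlepath o_def by (intro continuous_intros)+
  qed (auto simp: pathfinish_def pathstart_def circlepath exp_eq_1)
  also have "(\<lambda>t. 1 + circlepath 0 (1/2) t) = circlepath 1 (1/2)"
    by (simp add: circlepath)
  finally show "winding_number (exp \<circ> circlepath 0 (1/2)) (exp 0) = 1"
    by (simp add: winding_number_circlepath o_def)
qed (auto intro: continuous_intros)

section \<open>Orientations of maps into a surface\<close>

definition orients_at :: "(complex \<Rightarrow> 'a) set \<Rightarrow> (complex \<Rightarrow> 'a) \<Rightarrow> complex \<Rightarrow> bool" where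
  "orients_at \<A> g z \<longleftrightarrow> (\<forall>q\<in>\<A>. g z \<in> range q \<longrightarrow> oriented_at (inv_into UNIV q \<circ> g) z)"

lemma orients_at_comp:
  assumes "orients_at \<A> g (f z)" "oriented_at f z"
  shows "orients_at \<A> (g \<circ> f) z"
  using assms oriented_at_comp[of f z "inv_into UNIV _ \<circ> g"]
  unfolding orients_at_def by (simp add: o_assoc)

lemma orients_at_cong:
  assumes "orients_at \<A> f z" "open U" "z \<in> U" "\<And>w. w \<in> U \<Longrightarrow> f w = g w"
  shows "orients_at \<A> g z"
  unfolding orients_at_def
proof (intro ballI impI)
  fix q assume q: "q \<in> \<A>" "g z \<in> range q"
  then have "oriented_at (inv_into UNIV q \<circ> f) z"
    using assms by (simp add: orients_at_def)
  then show "oriented_at (inv_into UNIV q \<circ> g) z"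
    by (rule oriented_at_cong) (use assms in auto)
qed

locale closed_surface =
  fixes S :: "'a topology" and \<A> :: "(complex \<Rightarrow> 'a) set"
  assumes closed_oriented: "closed_oriented_surface S \<A>"
begin

lemma Hausdorff: "Hausdorff_space S" and compact: "compact_space S"
  using closed_oriented by (auto simp: closed_oriented_surface_def)

lemma chart:
  assumes "p \<in> \<A>"
  shows chart_embedding: "embedding_map euclidean S p" and chart_inj: "inj p"
    and chart_continuous: "continuous_map euclidean S p"
    and chart_open: "\<And>U. open U \<Longrightarrow> openin S (p ` U)"
    and chart_in_topspace: "p z \<in> topspace S"
proof -
  show em: "embedding_map euclidean S p"
    using assms closed_oriented by (auto simp: closed_oriented_surface_def oriented_atlas_def)
  have op: "openin S (range p)"
    using assms closed_oriented by (auto simp: closed_oriented_surface_def oriented_atlas_def)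
  have hm: "homeomorphic_map euclidean (subtopology S (range p)) p"
    using em by (simp add: embedding_map_def)
  show "inj p" using hm by (auto simp: homeomorphic_eq_everything_map)
  show c: "continuous_map euclidean S p"
    using homeomorphic_imp_continuous_map[OF hm] by (simp add: continuous_map_in_subtopology)
  show "p z \<in> topspace S" using c by (auto simp: continuous_map_def)
  show "openin S (p ` U)" if "open U" for U
    using hm op that unfolding homeomorphic_eq_everything_map open_map_def
    by (metis open_openin openin_trans_full)
qed

lemma chart_cover: "x \<in> topspace S \<Longrightarrow> \<exists>p\<in>\<A>. x \<in> range p"
  using closed_oriented unfolding closed_oriented_surface_def oriented_atlas_def by blast

lemma chart_inverse_continuous:
  assumes "p \<in> \<A>"
  shows "continuous_map (subtopology S (range p)) euclidean (inv_into UNIV p)"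
proof -
  have "homeomorphic_map euclidean (subtopology S (range p)) p"
    using chart_embedding[OF assms] by (simp add: embedding_map_def)
  then obtain g where g: "homeomorphic_maps euclidean (subtopology S (range p)) p g"
    by (auto simp: homeomorphic_map_maps)
  have "g y = inv_into UNIV p y" if "y \<in> range p" for y
    using g that chart_inj[OF assms] by (auto simp: homeomorphic_maps_def)
  then show ?thesis
    using g by (auto simp: homeomorphic_maps_def intro: continuous_map_eq)
qed

lemma chart_read:
  assumes U: "open U" and g: "continuous_map (top_of_set U) S g" "inj_on g U" and q: "q \<in> \<A>"
  shows chart_read_open: "open {z \<in> U. g z \<in> range q}"
    and chart_read_continuous: "continuous_on {z \<in> U. g z \<in> range q} (inv_into UNIV q \<circ> g)"
    and chart_read_inj: "inj_on (inv_into UNIV q \<circ> g) {z \<in> U. g z \<in> range q}"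
proof -
  have "openin S (range q)" using chart_open[OF q] by simp
  then have "openin (top_of_set U) {z \<in> topspace (top_of_set U). g z \<in> range q}"
    using g(1) by (rule openin_continuous_map_preimage[rotated])
  then show "open {z \<in> U. g z \<in> range q}"
    using U by (simp add: openin_open_eq)
  have "continuous_map (top_of_set {z \<in> U. g z \<in> range q}) S g"
    by (rule continuous_map_from_subtopology_mono[OF g(1)]) auto
  then have "continuous_map (top_of_set {z \<in> U. g z \<in> range q}) (subtopology S (range q)) g"
    by (auto simp: continuous_map_in_subtopology)
  then have "continuous_map (top_of_set {z \<in> U. g z \<in> range q}) euclidean (inv_into UNIV q \<circ> g)"
    using chart_inverse_continuous[OF q] by (rule continuous_map_compose)
  then show "continuous_on {z \<in> U. g z \<in> range q} (inv_into UNIV q \<circ> g)"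
    by simp
  show "inj_on (inv_into UNIV q \<circ> g) {z \<in> U. g z \<in> range q}"
  proof (rule inj_onI)
    fix x y assume xy: "x \<in> {z \<in> U. g z \<in> range q}" "y \<in> {z \<in> U. g z \<in> range q}"
      "(inv_into UNIV q \<circ> g) x = (inv_into UNIV q \<circ> g) y"
    then have "g x = g y" by (auto dest: inv_into_injective)
    then show "x = y" using xy g(2) by (auto dest: inj_onD)
  qed
qed

lemma orients_iff:
  assumes "open U" "continuous_map (top_of_set U) S g" "inj_on g U"
  shows "orients \<A> U g \<longleftrightarrow> (\<forall>z\<in>U. orients_at \<A> g z)"
proof -
  have "orients \<A> U g \<longleftrightarrow>
    (\<forall>q\<in>\<A>. \<forall>z\<in>{z \<in> U. g z \<in> range q}. oriented_at (inv_into UNIV q \<circ> g) z)"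
    unfolding orients_def
    by (intro ball_cong refl orientation_preserving_on_iff chart_read assms)
  then show ?thesis unfolding orients_at_def by blast
qed

lemma chart_orients_at: "p \<in> \<A> \<Longrightarrow> orients_at \<A> p z"
  using closed_oriented orients_iff[of UNIV p] chart_continuous[of p] chart_inj[of p]
  by (auto simp: closed_oriented_surface_def oriented_atlas_def)

text \<open>Openness is local in the image: near each of its points a chart reduces the claim to
  invariance of domain in the plane.\<close>

lemma invariance_of_domain_surface:
  fixes g :: "complex \<Rightarrow> 'a"
  assumes U: "open U" and g: "continuous_map (top_of_set U) S g" "inj_on g U"
  shows "openin S (g ` U)"
proof (subst openin_subopen, intro ballI)
  fix x assume "x \<in> g ` U"
  then obtain z where z: "z \<in> U" "x = g z" by auto
  then have "x \<in> topspace S" using g(1) by (auto simp: continuous_map_def)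
  then obtain q where q: "q \<in> \<A>" "x \<in> range q" using chart_cover by blast
  let ?V = "{z \<in> U. g z \<in> range q}"
  have "open ((inv_into UNIV q \<circ> g) ` ?V)"
    using invariance_of_domain[OF chart_read_continuous[OF U g q(1)]
        chart_read_open[OF U g q(1)] chart_read_inj[OF U g q(1)]] .
  then have "openin S (q ` (inv_into UNIV q \<circ> g) ` ?V)"
    using chart_open[OF q(1)] by blast
  also have "q ` (inv_into UNIV q \<circ> g) ` ?V = g ` ?V"
    by (force simp: image_image f_inv_into_f)
  finally show "\<exists>T. openin S T \<and> x \<in> T \<and> T \<subseteq> g ` U"
    using z q by (intro exI[of _ "g ` ?V"]) auto
qed

text \<open>Transition maps of the atlas preserve orientation, so a single chart around
  \<open>g z\<close> decides.\<close>

lemma orients_atI: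
  assumes U: "open U" "z \<in> U" "continuous_map (top_of_set U) S g" "inj_on g U"
    and q: "q \<in> \<A>" "g z \<in> range q" "oriented_at (inv_into UNIV q \<circ> g) z"
  shows "orients_at \<A> g z"
  unfolding orients_at_def
proof (intro ballI impI)
  fix q' assume q': "q' \<in> \<A>" "g z \<in> range q'"
  let ?w = "inv_into UNIV q (g z)"
  have "orients_at \<A> q ?w" using q(1) by (rule chart_orients_at)
  then have "oriented_at (inv_into UNIV q' \<circ> q) ?w"
    using q q' by (auto simp: orients_at_def f_inv_into_f)
  then have "oriented_at ((inv_into UNIV q' \<circ> q) \<circ> (inv_into UNIV q \<circ> g)) z"
    using q(3) by (intro oriented_at_comp) auto
  then show "oriented_at (inv_into UNIV q' \<circ> g) z"
    by (rule oriented_at_cong[where U="{z \<in> U. g z \<in> range q}"])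
       (use chart_read_open[OF U(1,3,4) q(1)] U q in \<open>auto simp: f_inv_into_f\<close>)
qed

text \<open>Read in the chart \<open>p\<close>, \<open>e\<close> is oriented, and followed by
  \<open>e' \<circ> p\<close> it is the identity near \<open>w\<close>; since degrees multiply,
  \<open>e' \<circ> p\<close> is oriented as well. Its continuity comes from \<open>e\<close> being
  open, by invariance of domain.\<close>

lemma left_inverse_oriented_at:
  assumes U: "open U" "w \<in> U" "continuous_map (top_of_set U) S e" "inj_on e U"
    and inv: "\<And>w. w \<in> U \<Longrightarrow> e' (e w) = w" and p: "p \<in> \<A>" "p z = e w" and e: "orients_at \<A> e w"
  shows "oriented_at (e' \<circ> p) z"
proof -
  have op: "open (p -` e ` W)" if "open W" "W \<subseteq> U" for W
  proof -
    have "openin S (e ` W)"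
      by (rule invariance_of_domain_surface)
         (use that U in \<open>auto intro: continuous_map_from_subtopology_mono inj_on_subset\<close>)
    then have "openin euclidean {z \<in> topspace euclidean. p z \<in> e ` W}"
      using chart_continuous[OF p(1)] by (rule openin_continuous_map_preimage[rotated])
    then show ?thesis by (simp add: vimage_def)
  qed
  define V where "V = p -` e ` U"
  have V: "open V" "z \<in> V" using op[of U] U p by (auto simp: V_def)
  have "continuous_on V (e' \<circ> p)"
    unfolding continuous_on_open_vimage[OF V(1)]
  proof (intro allI impI)
    fix B :: "complex set" assume "open B"
    then have "open (p -` e ` (B \<inter> U))" using op U by auto
    also have "p -` e ` (B \<inter> U) = (e' \<circ> p) -` B \<inter> V"
      using inv by (auto simp: V_def)
    finally show "open ((e' \<circ> p) -` B \<inter> V)" .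
  qed
  moreover have "inj_on (e' \<circ> p) V"
  proof (rule inj_onI)
    fix x y assume "x \<in> V" "y \<in> V" "(e' \<circ> p) x = (e' \<circ> p) y"
    then have "p x = p y" using inv by (auto simp: V_def)
    then show "x = y" using chart_inj[OF p(1)] by (auto dest: injD)
  qed
  moreover have *: "inv_into UNIV p (e w) = z"
    using p chart_inj[OF p(1)] by (metis inv_f_f)
  moreover have "oriented_at (inv_into UNIV p \<circ> e) w"
    using e p by (metis orients_at_def rangeI)
  moreover have "oriented_at ((e' \<circ> p) \<circ> (inv_into UNIV p \<circ> e)) w"
  proof (rule oriented_at_cong[OF oriented_at_id, of "{w \<in> U. e w \<in> range p}"])
    show "open {w \<in> U. e w \<in> range p}"
      using chart_read_open[OF U(1,3,4) p(1)] .
    show "w \<in> {w \<in> U. e w \<in> range p}" using U p by (metis (mono_tags) mem_Collect_eq rangeI)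
  qed (auto simp: f_inv_into_f inv)
  ultimately show ?thesis
    using oriented_at_comp_iff[of "inv_into UNIV p \<circ> e" w V "e' \<circ> p"] V by simp
qed

section \<open>Orientation preserving homeomorphisms\<close>

definition orientation_homeo :: "('a \<Rightarrow> 'a) \<Rightarrow> bool" where
  "orientation_homeo f \<longleftrightarrow> homeomorphic_map S S f \<and> (\<forall>p\<in>\<A>. \<forall>z. orients_at \<A> (f \<circ> p) z)"

lemma homeo_chart:
  assumes f: "homeomorphic_map S S f" and p: "p \<in> \<A>"
  shows "continuous_map euclidean S (f \<circ> p)" "inj (f \<circ> p)"
proof -
  show "continuous_map euclidean S (f \<circ> p)"
    using chart_continuous[OF p] homeomorphic_imp_continuous_map[OF f] by (rule continuous_map_compose)
  have "range p \<subseteq> topspace S" using chart_in_topspace[OF p] by blast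
  then show "inj (f \<circ> p)"
    using homeomorphic_imp_injective_map[OF f] chart_inj[OF p] by (blast intro: comp_inj_on inj_on_subset)
qed

text \<open>Near \<open>z\<close> the map factors as
  \<open>(f \<circ> p) \<circ> (inv_into UNIV p \<circ> g)\<close> with a chart \<open>p\<close>
  around \<open>g z\<close>, and both factors are oriented.\<close>

lemma orientation_homeo_comp_orients_at:
  assumes f: "orientation_homeo f"
    and U: "open U" "z \<in> U" "continuous_map (top_of_set U) S g" "inj_on g U" and g: "orients_at \<A> g z"
  shows "orients_at \<A> (f \<circ> g) z"
proof -
  have "g z \<in> topspace S" using U by (auto simp: continuous_map_def)
  then obtain p where p: "p \<in> \<A>" "g z \<in> range p" using chart_cover by blast
  have "orients_at \<A> (f \<circ> p) ((inv_into UNIV p \<circ> g) z)"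
    using f p by (auto simp: orientation_homeo_def)
  moreover have "oriented_at (inv_into UNIV p \<circ> g) z" using g p by (auto simp: orients_at_def)
  ultimately have "orients_at \<A> ((f \<circ> p) \<circ> (inv_into UNIV p \<circ> g)) z"
    by (rule orients_at_comp)
  then show ?thesis
    by (rule orients_at_cong[where U="{z \<in> U. g z \<in> range p}"])
       (use chart_read_open[OF U(1,3,4) p(1)] U p in \<open>auto simp: f_inv_into_f\<close>)
qed

lemma orientation_homeo_comp:
  assumes "orientation_homeo f" "orientation_homeo g"
  shows "orientation_homeo (f \<circ> g)"
proof -
  have "orients_at \<A> (f \<circ> (g \<circ> p)) z" if "p \<in> \<A>" for p z
    by (rule orientation_homeo_comp_orients_at[where U=UNIV])
       (use assms that homeo_chart[of g p] in \<open>auto simp: orientation_homeo_def\<close>)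
  then show ?thesis using assms
    by (auto simp: orientation_homeo_def o_assoc intro: homeomorphic_map_compose)
qed

lemma orientation_homeo_inverse:
  assumes f: "orientation_homeo f" and g: "homeomorphic_maps S S f g"
  shows "orientation_homeo g"
proof -
  have "orients_at \<A> (g \<circ> p) z" if p: "p \<in> \<A>" for p z
  proof -
    have hg: "homeomorphic_map S S g" using g by (simp add: homeomorphic_maps_map)
    have pz: "p z \<in> topspace S" using chart_in_topspace[OF p] .
    then have "g (p z) \<in> topspace S" using hg homeomorphic_imp_surjective_map by fast
    then obtain q where q: "q \<in> \<A>" "g (p z) \<in> range q" using chart_cover by blast
    then obtain w where w: "g (p z) = q w" by auto
    have qin: "q v \<in> topspace S" for v using chart_in_topspace[OF q(1)] .
    \<comment> \<open>The embedding to be inverted is \<open>f \<circ> q\<close>, with left inverse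
      \<open>inv_into UNIV q \<circ> g\<close>.\<close>
    have "oriented_at ((inv_into UNIV q \<circ> g) \<circ> p) z"
    proof (rule left_inverse_oriented_at[where U=UNIV and e="f \<circ> q" and w=w])
      show "continuous_map (top_of_set UNIV) S (f \<circ> q)" "inj (f \<circ> q)"
        using f q homeo_chart[of f q] by (auto simp: orientation_homeo_def)
      show "(inv_into UNIV q \<circ> g) ((f \<circ> q) v) = v" for v
        using g qin chart_inj[OF q(1)] by (simp add: homeomorphic_maps_def)
      show "p z = (f \<circ> q) w" using g pz w by (simp add: homeomorphic_maps_def flip: w)
      show "orients_at \<A> (f \<circ> q) w" using f q by (simp add: orientation_homeo_def)
    qed (use p in auto)
    then show ?thesis
      by (intro orients_atI[where U=UNIV and q=q])
         (use q homeo_chart[OF hg p] in \<open>auto simp: o_assoc\<close>)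
  qed
  then show ?thesis using g by (auto simp: orientation_homeo_def homeomorphic_maps_map)
qed

text \<open>Passes between plain functions and their restrictions to the surface, which are the
  elements of \<open>\<H>\<close>.\<close>

lemma orientation_homeo_cong:
  assumes "orientation_homeo f" "\<And>x. x \<in> topspace S \<Longrightarrow> f x = g x"
  shows "orientation_homeo g"
proof -
  have "f \<circ> p = g \<circ> p" if "p \<in> \<A>" for p
    using assms(2) chart_in_topspace[OF that] by (simp add: fun_eq_iff)
  then show ?thesis
    using assms homeomorphic_map_eq[of S S f g] by (simp add: orientation_homeo_def)
qed

section \<open>Mapping class groups as groups\<close>

abbreviation "\<H> \<equiv> Homeo_plus S \<A>"

lemma carrier_Homeo_plus: "f \<in> carrier \<H> \<longleftrightarrow> f \<in> extensional (topspace S) \<and> orientation_homeo f"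
  using orients_iff[of UNIV "f \<circ> _"] homeo_chart[of f]
  by (auto simp: Homeo_plus_def orientation_homeo_def)

lemma carrier_Bij: "f \<in> carrier \<H> \<Longrightarrow> f \<in> Bij (topspace S)"
  by (auto simp: carrier_Homeo_plus orientation_homeo_def Bij_def bij_betw_def
      homeomorphic_eq_everything_map)

lemma mult_Homeo_plus:
  assumes "f \<in> carrier \<H>" "g \<in> carrier \<H>"
  shows "f \<otimes>\<^bsub>\<H>\<^esub> g = compose (topspace S) f g"
  using assms[THEN carrier_Bij] by (simp add: Homeo_plus_def BijGroup_def)

lemma one_Homeo_plus: "\<one>\<^bsub>\<H>\<^esub> = (\<lambda>x\<in>topspace S. x)"
  by (simp add: Homeo_plus_def BijGroup_def)

lemma inverse_carrier:
  assumes "f \<in> carrier \<H>"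
  shows "homeomorphic_maps S S f (\<lambda>x\<in>topspace S. inv_into (topspace S) f x)"
    and "(\<lambda>x\<in>topspace S. inv_into (topspace S) f x) \<in> carrier \<H>"
proof -
  have f: "orientation_homeo f" "homeomorphic_map S S f"
    using assms by (auto simp: carrier_Homeo_plus orientation_homeo_def)
  obtain g where g: "homeomorphic_maps S S f g" using f(2) by (auto simp: homeomorphic_map_maps)
  have "g x = inv_into (topspace S) f x" if "x \<in> topspace S" for x
    using g that f(2)
    by (metis homeomorphic_imp_injective_map homeomorphic_imp_surjective_map homeomorphic_maps_map
        imageI inv_into_f_f)
  then show *: "homeomorphic_maps S S f (\<lambda>x\<in>topspace S. inv_into (topspace S) f x)"
    using g by (auto intro: homeomorphic_maps_eq)
  show "(\<lambda>x\<in>topspace S. inv_into (topspace S) f x) \<in> carrier \<H>"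
    using orientation_homeo_inverse[OF f(1) *] by (auto simp: carrier_Homeo_plus)
qed

lemma orientation_homeo_id: "orientation_homeo (\<lambda>x. x)"
  using chart_orients_at by (auto simp: orientation_homeo_def o_def homeomorphic_map_id[unfolded id_def])

lemma subgroup_Homeo_plus: "subgroup (carrier \<H>) (BijGroup (topspace S))"
proof
  show "carrier \<H> \<subseteq> carrier (BijGroup (topspace S))"
    using carrier_Bij by (auto simp: BijGroup_def)
  show "f \<otimes>\<^bsub>BijGroup (topspace S)\<^esub> g \<in> carrier \<H>" if "f \<in> carrier \<H>" "g \<in> carrier \<H>" for f g
  proof -
    have "orientation_homeo (f \<circ> g)"
      using that by (auto simp: carrier_Homeo_plus intro: orientation_homeo_comp)
    then have "orientation_homeo (compose (topspace S) f g)"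
      by (rule orientation_homeo_cong) (simp add: compose_def)
    then show ?thesis
      using that[THEN carrier_Bij] by (simp add: carrier_Homeo_plus BijGroup_def)
  qed
  show "\<one>\<^bsub>BijGroup (topspace S)\<^esub> \<in> carrier \<H>"
    using orientation_homeo_cong[OF orientation_homeo_id] by (auto simp: carrier_Homeo_plus BijGroup_def)
  show "inv\<^bsub>BijGroup (topspace S)\<^esub> f \<in> carrier \<H>" if "f \<in> carrier \<H>" for f
    using inverse_carrier[OF that] by (simp add: inv_BijGroup carrier_Bij that)
qed

lemma group_Homeo_plus: "group \<H>"
proof -
  have "\<H> = BijGroup (topspace S)\<lparr>carrier := carrier \<H>\<rparr>" by (simp add: Homeo_plus_def)
  then show ?thesis
    using subgroup.subgroup_is_group[OF subgroup_Homeo_plus group_BijGroup] by simp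
qed

end

section \<open>Isotopy as a congruence\<close>

lemma isotopic_sym: "isotopic S f g \<Longrightarrow> isotopic S g f"
  unfolding isotopic_def by (rule homotopic_with_symD)

lemma isotopic_trans: "isotopic S f g \<Longrightarrow> isotopic S g k \<Longrightarrow> isotopic S f k"
  unfolding isotopic_def by (rule homotopic_with_trans)

lemma isotopic_homeomorphic: "isotopic S f g \<Longrightarrow> homeomorphic_map S S f \<and> homeomorphic_map S S g"
  unfolding isotopic_def by (rule homotopic_with_imp_property)

lemma isotopic_equal:
  assumes "homeomorphic_map S S f" "\<And>x. x \<in> topspace S \<Longrightarrow> f x = g x"
  shows "isotopic S f g"
  unfolding isotopic_def
  by (rule homotopic_with_equal) (use assms homeomorphic_map_eq homeomorphic_imp_continuous_map in metis)+

lemma isotopic_cong: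
  assumes fg: "isotopic S f g" and "\<And>x. x \<in> topspace S \<Longrightarrow> f x = f' x"
    and "\<And>x. x \<in> topspace S \<Longrightarrow> g x = g' x"
  shows "isotopic S f' g'"
  using isotopic_homeomorphic[OF fg] assms isotopic_equal[of S f f'] isotopic_equal[of S g g']
  by (meson isotopic_sym isotopic_trans)

lemma isotopic_comp_right:
  "isotopic S f g \<Longrightarrow> homeomorphic_map S S k \<Longrightarrow> isotopic S (f \<circ> k) (g \<circ> k)"
  unfolding isotopic_def
  by (rule homotopic_with_compose_continuous_map_right[where p="homeomorphic_map S S"])
     (auto intro: homeomorphic_map_compose homeomorphic_imp_continuous_map)

lemma isotopic_comp_left:
  "isotopic S f g \<Longrightarrow> homeomorphic_map S S k \<Longrightarrow> isotopic S (k \<circ> f) (k \<circ> g)"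
  unfolding isotopic_def
  by (rule homotopic_with_compose_continuous_map_left[where p="homeomorphic_map S S"])
     (auto intro: homeomorphic_map_compose homeomorphic_imp_continuous_map)

context closed_surface
begin

section \<open>The group of isotopy classes\<close>

interpretation Hp: group \<H> by (rule group_Homeo_plus)

lemma isotopic_mult:
  assumes "f \<in> carrier \<H>" "f' \<in> carrier \<H>" "g \<in> carrier \<H>" "g' \<in> carrier \<H>"
    and "isotopic S f f'" "isotopic S g g'"
  shows "isotopic S (f \<otimes>\<^bsub>\<H>\<^esub> g) (f' \<otimes>\<^bsub>\<H>\<^esub> g')"
proof -
  have "isotopic S (f \<circ> g) (f' \<circ> g)" "isotopic S (f' \<circ> g) (f' \<circ> g')"
    using assms by (auto intro!: isotopic_comp_left isotopic_comp_right
      simp: carrier_Homeo_plus orientation_homeo_def)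
  then have "isotopic S (f \<circ> g) (f' \<circ> g')" by (rule isotopic_trans)
  then show ?thesis
    using assms by (auto intro: isotopic_cong simp: mult_Homeo_plus compose_def)
qed

lemma isotopic_self: "f \<in> carrier \<H> \<Longrightarrow> isotopic S f f"
  by (simp add: isotopic_equal carrier_Homeo_plus orientation_homeo_def)

lemma mem_Homeo_zero: "f \<in> Homeo_zero S \<A> \<longleftrightarrow> f \<in> carrier \<H> \<and> isotopic S \<one>\<^bsub>\<H>\<^esub> f"
  by (simp add: Homeo_zero_def one_Homeo_plus)

lemma normal_Homeo_zero: "Homeo_zero S \<A> \<lhd> \<H>"
  unfolding Hp.normal_inv_iff
proof (intro conjI ballI)
  show "subgroup (Homeo_zero S \<A>) \<H>"
  proof
    show "Homeo_zero S \<A> \<subseteq> carrier \<H>" by (auto simp: mem_Homeo_zero)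
    show "\<one>\<^bsub>\<H>\<^esub> \<in> Homeo_zero S \<A>" by (simp add: mem_Homeo_zero isotopic_self)
    show "f \<otimes>\<^bsub>\<H>\<^esub> g \<in> Homeo_zero S \<A>" if "f \<in> Homeo_zero S \<A>" "g \<in> Homeo_zero S \<A>" for f g
      using that isotopic_mult[of "\<one>\<^bsub>\<H>\<^esub>" f "\<one>\<^bsub>\<H>\<^esub>" g] by (simp add: mem_Homeo_zero)
    show "inv\<^bsub>\<H>\<^esub> f \<in> Homeo_zero S \<A>" if "f \<in> Homeo_zero S \<A>" for f
      using that isotopic_mult[of "inv\<^bsub>\<H>\<^esub> f" "inv\<^bsub>\<H>\<^esub> f" "\<one>\<^bsub>\<H>\<^esub>" f]
      by (simp add: mem_Homeo_zero isotopic_self isotopic_sym)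
  qed
  fix f g assume fg: "f \<in> carrier \<H>" "g \<in> Homeo_zero S \<A>"
  then have "isotopic S (f \<otimes>\<^bsub>\<H>\<^esub> \<one>\<^bsub>\<H>\<^esub> \<otimes>\<^bsub>\<H>\<^esub> inv\<^bsub>\<H>\<^esub> f) (f \<otimes>\<^bsub>\<H>\<^esub> g \<otimes>\<^bsub>\<H>\<^esub> inv\<^bsub>\<H>\<^esub> f)"
    by (intro isotopic_mult isotopic_self) (auto simp: mem_Homeo_zero)
  then show "f \<otimes>\<^bsub>\<H>\<^esub> g \<otimes>\<^bsub>\<H>\<^esub> inv\<^bsub>\<H>\<^esub> f \<in> Homeo_zero S \<A>"
    using fg by (simp add: mem_Homeo_zero)
qed

lemma group_MCG: "group (MCG S \<A>)"
  unfolding MCG_def by (rule normal.factorgroup_is_group[OF normal_Homeo_zero])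

lemma carrier_MCG: "h \<in> carrier (MCG S \<A>) \<longleftrightarrow> (\<exists>f\<in>carrier \<H>. h = mapping_class S \<A> f)"
  by (auto simp: MCG_def mapping_class_def carrier_FactGroup)

lemma mapping_class_mult:
  assumes "f \<in> carrier \<H>" "g \<in> carrier \<H>"
  shows "mapping_class S \<A> f \<otimes>\<^bsub>MCG S \<A>\<^esub> mapping_class S \<A> g = mapping_class S \<A> (f \<otimes>\<^bsub>\<H>\<^esub> g)"
  using normal.rcos_sum[OF normal_Homeo_zero assms] by (simp add: MCG_def mapping_class_def)

lemma mapping_class_eqI:
  assumes "f \<in> carrier \<H>" "g \<in> carrier \<H>" "isotopic S f g"
  shows "mapping_class S \<A> f = mapping_class S \<A> g"
proof -
  have "isotopic S (g \<otimes>\<^bsub>\<H>\<^esub> inv\<^bsub>\<H>\<^esub> g) (f \<otimes>\<^bsub>\<H>\<^esub> inv\<^bsub>\<H>\<^esub> g)"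
    using assms by (intro isotopic_mult isotopic_self isotopic_sym[OF assms(3)]) auto
  then have "f \<otimes>\<^bsub>\<H>\<^esub> inv\<^bsub>\<H>\<^esub> g \<in> Homeo_zero S \<A>"
    using assms by (simp add: mem_Homeo_zero)
  then have "f \<in> Homeo_zero S \<A> #>\<^bsub>\<H>\<^esub> g"
    using assms subgroup.rcos_module_rev[OF normal_imp_subgroup[OF normal_Homeo_zero] group_Homeo_plus]
    by blast
  then show ?thesis
    unfolding mapping_class_def
    using assms Hp.repr_independence[OF _ _ normal_imp_subgroup[OF normal_Homeo_zero]] by metis
qed

lemma mapping_class_representative:
  assumes "h \<in> carrier (MCG S \<A>)" "f \<in> h"
  shows "f \<in> carrier \<H>" "h = mapping_class S \<A> f"
proof -
  have sg: "subgroup (Homeo_zero S \<A>) \<H>" by (rule normal_imp_subgroup[OF normal_Homeo_zero])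
  obtain g where g: "g \<in> carrier \<H>" "h = Homeo_zero S \<A> #>\<^bsub>\<H>\<^esub> g"
    using assms(1) unfolding carrier_MCG mapping_class_def by blast
  then show "f \<in> carrier \<H>"
    using assms(2) Hp.r_coset_subset_G[OF subgroup.subset[OF sg] g(1)] by blast
  show "h = mapping_class S \<A> f"
    using Hp.repr_independence[OF _ g(1) sg, of f] assms(2) g by (simp add: mapping_class_def)
qed

end

section \<open>Twists that act on every circle of an annulus\<close>

text \<open>Lifts to the real line of orientation preserving homeomorphisms of the circle.\<close>

definition circle_lift :: "(real \<Rightarrow> real) \<Rightarrow> bool" where
  "circle_lift v \<longleftrightarrow> continuous_on UNIV v \<and> strict_mono v \<and> (\<forall>x. v (x + 2 * pi) = v x + 2 * pi)"

lemma circle_lift_int: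
  assumes "circle_lift v"
  shows "v (x + of_int k * (2 * pi)) = v x + of_int k * (2 * pi)"
proof (induction k rule: int_induct[of _ 0])
  case (step1 k)
  have "v (x + of_int k * (2 * pi) + 2 * pi) = v (x + of_int k * (2 * pi)) + 2 * pi"
    using assms by (simp add: circle_lift_def)
  then show ?case using step1 by (simp add: algebra_simps)
next
  case (step2 k)
  have "v (x + of_int (k - 1) * (2 * pi) + 2 * pi) = v (x + of_int (k - 1) * (2 * pi)) + 2 * pi"
    using assms by (simp add: circle_lift_def)
  then show ?case using step2 by (simp add: algebra_simps)
qed auto

lemma circle_lift_eq_iff: "circle_lift v \<Longrightarrow> v x = v y \<longleftrightarrow> x = y"
  by (simp add: circle_lift_def strict_mono_eq)

lemma circle_lift_surj:
  assumes v: "circle_lift v"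
  obtains x where "v x = y"
proof -
  define k where "k = \<lfloor>(y - v 0) / (2 * pi)\<rfloor>"
  have "of_int k \<le> (y - v 0) / (2 * pi)" "(y - v 0) / (2 * pi) \<le> of_int (k + 1)"
    unfolding k_def by linarith+
  then have "of_int k * (2 * pi) \<le> y - v 0" "y - v 0 \<le> of_int (k + 1) * (2 * pi)"
    by (auto simp: field_simps)
  then have "v (of_int k * (2 * pi)) \<le> y" "y \<le> v (of_int (k + 1) * (2 * pi))"
    using circle_lift_int[OF v, of 0 k] circle_lift_int[OF v, of 0 "k + 1"] by (auto simp: algebra_simps)
  moreover have "continuous_on {of_int k * (2 * pi)..of_int (k + 1) * (2 * pi)} v"
    using v by (auto simp: circle_lift_def intro: continuous_on_subset)
  ultimately have "\<exists>x. of_int k * (2 * pi) \<le> x \<and> x \<le> of_int (k + 1) * (2 * pi) \<and> v x = y"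
    by (intro IVT') (auto simp: mult_right_mono)
  then show ?thesis using that by blast
qed

lemma circle_lift_inverse:
  assumes v: "circle_lift v"
  shows "circle_lift (inv_into UNIV v)" and "v (inv_into UNIV v x) = x"
    and "inv_into UNIV v (v x) = x"
proof -
  have inj: "inj v" using circle_lift_eq_iff[OF v] by (simp add: inj_def)
  have surj: "surj v" using circle_lift_surj[OF v] by (metis surjI surj_def)
  show 1: "v (inv_into UNIV v x) = x" for x using surj by (simp add: surj_f_inv_f)
  show 2: "inv_into UNIV v (v x) = x" for x using inj by simp
  have sm: "strict_mono (inv_into UNIV v)"
  proof (rule strict_monoI)
    fix x y :: real assume "x < y"
    then have "v (inv_into UNIV v x) < v (inv_into UNIV v y)" using 1 by simp
    then show "inv_into UNIV v x < inv_into UNIV v y"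
      using v by (simp add: circle_lift_def strict_mono_less)
  qed
  moreover have "inv_into UNIV v (x + 2 * pi) = inv_into UNIV v x + 2 * pi" for x
    using v 1 2 by (metis circle_lift_def)
  moreover have "continuous_on UNIV (inv_into UNIV v)"
  proof (rule continuous_onI_mono)
    have "range (inv_into UNIV v) = UNIV" using 2 by (metis surjI)
    then show "open (range (inv_into UNIV v))" by simp
  qed (use sm in \<open>auto simp: strict_mono_less_eq\<close>)
  ultimately show "circle_lift (inv_into UNIV v)" by (simp add: circle_lift_def)
qed

section \<open>Polar coordinates on the annulus\<close>

definition polar :: "real \<Rightarrow> real \<Rightarrow> complex" where
  "polar r x = of_real r * cis x"

lemma norm_polar: "0 \<le> r \<Longrightarrow> cmod (polar r x) = r"
  by (simp add: polar_def norm_mult)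

lemma polar_in_annulus: "polar r x \<in> annulus \<longleftrightarrow> 1 \<le> \<bar>r\<bar> \<and> \<bar>r\<bar> \<le> 2"
  by (simp add: annulus_def polar_def norm_mult)

lemma polar_norm_Arg: "polar (cmod z) (Arg z) = z"
  using rcis_cmod_Arg[of z] by (simp add: polar_def rcis_def)

lemma polar_eq_iff:
  assumes "0 < r" "0 < s"
  shows "polar r x = polar s y \<longleftrightarrow> r = s \<and> (\<exists>k::int. x = y + of_int k * (2 * pi))"
proof -
  have "cis x = cis y \<longleftrightarrow> (\<exists>k::int. x = y + of_int k * (2 * pi))"
    unfolding cis_conv_exp exp_eq by (simp add: complex_eq_iff algebra_simps)
  moreover have "polar r x = polar s y \<Longrightarrow> r = s"
    using assms norm_polar[of r x] norm_polar[of s y] by simp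
  ultimately show ?thesis using assms by (auto simp: polar_def)
qed

lemma polar_angle_shift: "polar r (x + of_int k * (2 * pi)) = polar r x"
  using polar_eq_iff[of 1 1 "x + of_int k * (2 * pi)" x] by (auto simp: polar_def)

lemma annulus_cases:
  assumes "z \<in> annulus"
  obtains r x where "r \<in> {1..2}" "z = polar r x"
  using assms polar_norm_Arg[of z] that[of "cmod z" "Arg z"] by (auto simp: annulus_def)

lemma annulus_cases_compact:
  assumes "z \<in> annulus"
  obtains r x where "r \<in> {1..2}" "x \<in> {0..2 * pi}" "z = polar r x"
proof (cases "0 \<le> Arg z")
  case True
  then show ?thesis
    using assms that[of "cmod z" "Arg z"] polar_norm_Arg[of z] Arg_bounded[of z] pi_gt_zero
    by (auto simp: annulus_def)
next
  case False
  then show ?thesis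
    using assms that[of "cmod z" "Arg z + 2 * pi"] polar_norm_Arg[of z] Arg_bounded[of z]
      polar_angle_shift[of "cmod z" "Arg z" 1] by (auto simp: annulus_def)
qed

lemma continuous_polar [continuous_intros]:
  "continuous_on X f \<Longrightarrow> continuous_on X g \<Longrightarrow> continuous_on X (\<lambda>x. polar (f x) (g x))"
  unfolding polar_def by (intro continuous_intros)

lemma open_in_interior_annulus: "1 < cmod z \<Longrightarrow> cmod z < 2 \<Longrightarrow> z \<in> interior annulus"
proof (rule interiorI)
  show "open {z. 1 < cmod z \<and> cmod z < 2}"
    by (intro open_Collect_conj open_Collect_less continuous_intros)
qed (auto simp: annulus_def)

lemma annulus_image_polar: "(\<lambda>(r, x). polar r x) ` ({1..2} \<times> {0..2 * pi}) = annulus"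
proof
  show "annulus \<subseteq> (\<lambda>(r, x). polar r x) ` ({1..2} \<times> {0..2 * pi})"
    by (force elim: annulus_cases_compact)
qed (auto simp: polar_in_annulus)

lemma compact_annulus: "compact annulus"
  unfolding annulus_image_polar[symmetric]
  by (rule compact_continuous_image)
     (auto simp: case_prod_unfold intro!: continuous_intros compact_Times)

text \<open>Angles are kept on the real line: \<open>m 1\<close> and \<open>m 2\<close> both induce
  the identity of the circle, and it is their difference of one full turn that makes the map a
  twist.\<close>

definition twist_profile :: "(real \<Rightarrow> real \<Rightarrow> real) \<Rightarrow> bool" where
  "twist_profile m \<longleftrightarrow> continuous_on ({1..2} \<times> UNIV) (\<lambda>(r, x). m r x) \<and>
     (\<forall>r\<in>{1..2}. circle_lift (m r)) \<and> (\<forall>x. m 1 x = x) \<and> (\<forall>x. m 2 x = x + 2 * pi)"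

lemma twist_profileI:
  assumes "continuous_on ({1..2} \<times> UNIV) (\<lambda>(r, x). m r x)"
    and "\<And>r x y. r \<in> {1..2} \<Longrightarrow> x < y \<Longrightarrow> m r x < m r y"
    and "\<And>r x. r \<in> {1..2} \<Longrightarrow> m r (x + 2 * pi) = m r x + 2 * pi"
    and "\<And>x. m 1 x = x" "\<And>x. m 2 x = x + 2 * pi"
  shows "twist_profile m"
proof -
  have "continuous_on UNIV (m r)" if "r \<in> {1..2}" for r
  proof -
    have "Pair r ` UNIV \<subseteq> {1..2} \<times> (UNIV :: real set)" using that by auto
    from continuous_on_compose2[OF assms(1) continuous_on_Pair[OF continuous_on_const continuous_on_id] this]
    show ?thesis by simp
  qed
  then show ?thesis using assms by (auto simp: twist_profile_def circle_lift_def strict_mono_def)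
qed

lemma twist_profile_convex:
  assumes m: "twist_profile m" "twist_profile m'" and s: "s \<in> {0..1}"
  shows "twist_profile (\<lambda>r x. (1 - s) * m r x + s * m' r x)"
proof (rule twist_profileI)
  show "continuous_on ({1..2} \<times> UNIV) (\<lambda>(r, x). (1 - s) * m r x + s * m' r x)"
    using m unfolding twist_profile_def case_prod_unfold by (intro continuous_intros) auto
  fix r x :: real assume r: "r \<in> {1..2}"
  have cl: "circle_lift (m r)" "circle_lift (m' r)" using m r by (auto simp: twist_profile_def)
  then show "(1 - s) * m r (x + 2 * pi) + s * m' r (x + 2 * pi) = (1 - s) * m r x + s * m' r x + 2 * pi"
    by (simp add: circle_lift_def algebra_simps)
  fix y assume "x < y"
  then have "m r x < m r y" "m' r x < m' r y" using cl by (auto simp: circle_lift_def strict_mono_def)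
  then show "(1 - s) * m r x + s * m' r x < (1 - s) * m r y + s * m' r y"
    using s by (cases "s = 0") (auto intro!: add_le_less_mono mult_left_mono)
qed (use m in \<open>auto simp: twist_profile_def algebra_simps\<close>)

text \<open>\<open>Arg\<close> is only one choice of angle; as each \<open>m r\<close> commutes with
  whole turns, every choice gives the same point. Being the identity everywhere off the annulus,
  even outside the surface, such maps can be equated as functions.\<close>

definition fibred_twist :: "(complex \<Rightarrow> 'a) \<Rightarrow> (real \<Rightarrow> real \<Rightarrow> real) \<Rightarrow> 'a \<Rightarrow> 'a" where
  "fibred_twist e m y =
     (if y \<in> e ` annulus
      then let z = inv_into annulus e y in e (polar (cmod z) (m (cmod z) (Arg z))) else y)"

lemma fibred_twist_polar:
  assumes e: "inj_on e annulus" and m: "circle_lift (m r)" and r: "r \<in> {1..2}"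
  shows "fibred_twist e m (e (polar r x)) = e (polar r (m r x))"
proof -
  have z: "polar r x \<in> annulus" using r by (simp add: polar_in_annulus)
  have n: "cmod (polar r x) = r" using r by (simp add: norm_polar)
  have "polar r (Arg (polar r x)) = polar r x" using polar_norm_Arg[of "polar r x"] n by simp
  then obtain k :: int where "Arg (polar r x) = x + of_int k * (2 * pi)"
    using polar_eq_iff[of r r] r by auto
  then have "polar r (m r (Arg (polar r x))) = polar r (m r x)"
    using circle_lift_int[OF m] polar_angle_shift by simp
  then show ?thesis using e z n by (simp add: fibred_twist_def)
qed

lemma fibred_twist_outside: "y \<notin> e ` annulus \<Longrightarrow> fibred_twist e m y = y"
  by (simp add: fibred_twist_def)

definition left_profile :: "real \<Rightarrow> real \<Rightarrow> real" where
  "left_profile r x = x + 2 * pi * (r - 1)"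

lemma twist_profile_left: "twist_profile left_profile"
  by (rule twist_profileI) (auto simp: left_profile_def case_prod_unfold intro!: continuous_intros)

lemma left_twist_polar: "left_twist z = polar (cmod z) (left_profile (cmod z) (Arg z))"
  using polar_norm_Arg[of z]
  by (simp add: left_twist_def left_profile_def polar_def cis_mult[symmetric] mult.assoc[symmetric])

lemma twist_along_fibred: "y \<in> topspace S \<Longrightarrow> twist_along S e y = fibred_twist e left_profile y"
  by (simp add: twist_along_def fibred_twist_def left_twist_polar Let_def)

section \<open>Deformation of twists supported in one annulus\<close>

context closed_surface
begin

text \<open>Purely topological, so that an annulus glued from pieces of two others qualifies without
  any argument about orientation along the seam.\<close>

definition annulus_in_surface :: "(complex \<Rightarrow> 'a) \<Rightarrow> bool" where
  "annulus_in_surface e \<longleftrightarrow> continuous_map (top_of_set annulus) S e \<and> inj_on e annulus"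

lemma annulus_in_surfaceD:
  assumes "annulus_in_surface e"
  shows "continuous_map (top_of_set annulus) S e" "inj_on e annulus"
    "\<And>z. z \<in> annulus \<Longrightarrow> e z \<in> topspace S"
    "closedin S (e ` annulus)" "openin S (e ` interior annulus)"
proof -
  show e: "continuous_map (top_of_set annulus) S e" "inj_on e annulus"
    using assms by (auto simp: annulus_in_surface_def)
  show "e z \<in> topspace S" if "z \<in> annulus" for z using e that by (auto simp: continuous_map_def)
  have "compactin (top_of_set annulus) annulus"
    using compact_annulus by (simp add: compactin_subtopology)
  then show "closedin S (e ` annulus)"
    using image_compactin[OF _ e(1)] compactin_imp_closedin[OF Hausdorff] by blast
  show "openin S (e ` interior annulus)"
    by (rule invariance_of_domain_surface)
       (use e interior_subset in \<open>auto intro: continuous_map_from_subtopology_mono inj_on_subset\<close>)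
qed

text \<open>On the boundary circles the profile is the identity or a full turn, and both fix every
  point.\<close>

lemma fibred_twist_boundary:
  assumes e: "annulus_in_surface e" and m: "twist_profile m" and y: "y \<notin> e ` interior annulus"
  shows "fibred_twist e m y = y"
proof (cases "y \<in> e ` annulus")
  case True
  then obtain r x where rx: "r \<in> {1..2}" "y = e (polar r x)" by (auto elim: annulus_cases)
  then have "polar r x \<notin> interior annulus" using y by auto
  then have "\<not> (1 < r \<and> r < 2)"
    using rx open_in_interior_annulus[of "polar r x"] by (auto simp: norm_polar)
  then have "r = 1 \<or> r = 2" using rx by auto
  moreover have "circle_lift (m r)" using m rx by (simp add: twist_profile_def)
  ultimately show ?thesis
    using rx fibred_twist_polar[of e m r x] annulus_in_surfaceD(2)[OF e] m
      polar_angle_shift[of r x 1] by (auto simp: twist_profile_def)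
qed (simp add: fibred_twist_outside)

text \<open>\<open>Arg\<close> jumps, so continuity cannot be read off from the definition. Over the
  annulus it is tested on a rectangle of radii and angles, which maps onto the annulus by a quotient
  map and on which only \<open>m\<close> and \<open>m'\<close> occur; elsewhere the isotopy is
  stationary.\<close>

lemma fibred_twist_isotopy_continuous:
  assumes e: "annulus_in_surface e" and m: "twist_profile m" "twist_profile m'"
  shows "continuous_map (prod_topology (top_of_set {0..1}) S) S
     (\<lambda>(s, y). fibred_twist e (\<lambda>r x. (1 - s) * m r x + s * m' r x) y)"
    (is "continuous_map ?X S ?H")
proof -
  note eD = annulus_in_surfaceD[OF e]
  let ?I = "top_of_set {0..1::real}"
  let ?K = "{0..1::real} \<times> ({1..2::real} \<times> {0..2 * pi})"
  \<comment> \<open>Two closed pieces that cover the product. The same function is used on both, so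
    there is nothing to compare on the overlap.\<close>
  let ?T = "\<lambda>b. {0..1::real} \<times> (if b then e ` annulus else topspace S - e ` interior annulus)"
  let ?Q = "\<lambda>(s::real, r::real, x). (s, e (polar r x))"
  have conv: "twist_profile (\<lambda>r x. (1 - s) * m r x + s * m' r x)" if "s \<in> {0..1}" for s
    using twist_profile_convex[OF m that] .
  have cm: "continuous_on ?K (\<lambda>(s, r, x). m r x)" if "twist_profile m" for m
    using that unfolding twist_profile_def case_prod_unfold
    by (auto intro!: continuous_on_compose2[of "{1..2} \<times> UNIV" "\<lambda>p. m (fst p) (snd p)"
          ?K snd, unfolded] continuous_intros)
  have "continuous_map (top_of_set ?K) (top_of_set annulus) (\<lambda>(s, r, x). polar r x)"
    by (auto simp: case_prod_unfold polar_in_annulus intro!: continuous_intros)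
  then have "continuous_map (top_of_set ?K) S (e \<circ> (\<lambda>(s, r, x). polar r x))"
    using eD(1) by (rule continuous_map_compose)
  then have Q1: "continuous_map (top_of_set ?K) S (\<lambda>(s, r, x). e (polar r x))"
    by (simp add: o_def case_prod_unfold)
  have "quotient_map (top_of_set ?K) (prod_topology ?I (subtopology S (e ` annulus))) ?Q"
  proof (rule continuous_imp_quotient_map)
    have "continuous_map (top_of_set ?K) ?I fst" "continuous_map (top_of_set ?K) (subtopology S (e ` annulus)) (\<lambda>(s, r, x). e (polar r x))"
      using Q1 by (auto simp: continuous_map_in_subtopology polar_in_annulus intro!: continuous_intros)
    then show "continuous_map (top_of_set ?K) (prod_topology ?I (subtopology S (e ` annulus))) ?Q"
      by (simp add: continuous_map_pairwise o_def case_prod_unfold)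
    show "compact_space (top_of_set ?K)"
      by (intro compact_space_subtopology) (simp add: compact_Times)
    show "Hausdorff_space (prod_topology ?I (subtopology S (e ` annulus)))"
      by (simp add: Hausdorff_space_prod_topology Hausdorff_space_subtopology Hausdorff)
    have "?Q ` ?K = {0..1} \<times> e ` annulus"
      unfolding annulus_image_polar[symmetric] by force
    moreover have "e ` annulus \<subseteq> topspace S" using eD(3) by auto
    ultimately show "?Q ` topspace (top_of_set ?K) = topspace (prod_topology ?I (subtopology S (e ` annulus)))"
      by (simp add: inf.absorb2)
  qed
  moreover have "continuous_map (top_of_set ?K) S (?H \<circ> ?Q)"
  proof -
    have "continuous_map (top_of_set ?K) (top_of_set annulus)
       (\<lambda>(s, r, x). polar r ((1 - s) * m r x + s * m' r x))"
      using cm[OF m(1)] cm[OF m(2)]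
      by (auto simp: case_prod_unfold polar_in_annulus intro!: continuous_intros)
    then have "continuous_map (top_of_set ?K) S
       (e \<circ> (\<lambda>(s, r, x). polar r ((1 - s) * m r x + s * m' r x)))"
      using eD(1) by (rule continuous_map_compose)
    then show ?thesis
    proof (rule continuous_map_eq)
      fix p assume "p \<in> topspace (top_of_set ?K)"
      then obtain s r x where p: "p = (s, r, x)" "s \<in> {0..1}" "r \<in> {1..2}" by auto
      then have "circle_lift (\<lambda>x. (1 - s) * m r x + s * m' r x)"
        using conv by (simp add: twist_profile_def)
      then show "(e \<circ> (\<lambda>(s, r, x). polar r ((1 - s) * m r x + s * m' r x))) p = (?H \<circ> ?Q) p"
        using fibred_twist_polar[OF eD(2), of "\<lambda>r x. (1 - s) * m r x + s * m' r x" r x] p by simp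
    qed
  qed
  ultimately have T1: "continuous_map (prod_topology ?I (subtopology S (e ` annulus))) S ?H"
    by (rule continuous_compose_quotient_map)
  have T2: "continuous_map (prod_topology ?I (subtopology S (topspace S - e ` interior annulus))) S ?H"
  proof (rule continuous_map_eq)
    show "continuous_map (prod_topology ?I (subtopology S (topspace S - e ` interior annulus))) S snd"
      using continuous_map_snd[of ?I "subtopology S (topspace S - e ` interior annulus)"]
      by (simp add: continuous_map_in_subtopology)
    fix p assume "p \<in> topspace (prod_topology ?I (subtopology S (topspace S - e ` interior annulus)))"
    then show "snd p = ?H p"
      using fibred_twist_boundary[OF e conv] by (auto simp: case_prod_unfold)
  qed
  show ?thesis
  proof (rule pasting_lemma_closed[where I="UNIV::bool set" and T="?T" and f="\<lambda>_. ?H"])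
    show "closedin ?X (?T b)" for b
      using eD(4,5) by (auto simp: closedin_prod_Times_iff)
    show "continuous_map (subtopology ?X (?T b)) S ?H" for b
      using T1 T2 by (cases b) (simp_all add: subtopology_Times subtopology_subtopology)
    fix p assume p: "p \<in> topspace ?X"
    have "p \<in> ?T True \<or> p \<in> ?T False"
      using p interior_subset[of annulus] by (cases p) auto
    then show "\<exists>b. b \<in> UNIV \<and> p \<in> ?T b \<and> ?H p = ?H p" by blast
  qed auto
qed

lemma fibred_twist_homeomorphic:
  assumes e: "annulus_in_surface e" and m: "twist_profile m"
  shows "homeomorphic_map S S (fibred_twist e m)"
proof (rule continuous_imp_homeomorphic_map)
  note eD = annulus_in_surfaceD[OF e]
  \<comment> \<open>Continuity is the time 0 slice of the isotopy from \<open>m\<close> to itself.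
    Bijectivity then suffices, the surface being compact and Hausdorff.\<close>
  have "continuous_map S (prod_topology (top_of_set {0..1}) S) (\<lambda>y. (0::real, y))"
    by (auto simp: continuous_map_pairwise o_def)
  from continuous_map_compose[OF this fibred_twist_isotopy_continuous[OF e m m]]
  show "continuous_map S S (fibred_twist e m)" by (simp add: o_def)
  have cl: "circle_lift (m r)" if "r \<in> {1..2}" for r using m that by (simp add: twist_profile_def)
  have ev: "fibred_twist e m (e (polar r x)) = e (polar r (m r x))" if "r \<in> {1..2}" for r x
    using fibred_twist_polar[of e m r x] eD(2) cl[OF that] that by blast
  have in_ann: "fibred_twist e m y \<in> e ` annulus \<longleftrightarrow> y \<in> e ` annulus" for y
  proof (cases "y \<in> e ` annulus")
    case True
    then obtain r x where "r \<in> {1..2}" "y = e (polar r x)" by (auto elim: annulus_cases)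
    then show ?thesis using True ev[of r x] by (simp add: polar_in_annulus)
  qed (simp add: fibred_twist_outside)
  show "fibred_twist e m ` topspace S = topspace S"
  proof (intro equalityI subsetI)
    fix y assume "y \<in> fibred_twist e m ` topspace S"
    then obtain x where x: "x \<in> topspace S" "y = fibred_twist e m x" by blast
    then show "y \<in> topspace S"
      using in_ann[of x] eD(3) by (cases "x \<in> e ` annulus") (auto simp: fibred_twist_outside)
  next
    fix y assume y: "y \<in> topspace S"
    show "y \<in> fibred_twist e m ` topspace S"
    proof (cases "y \<in> e ` annulus")
      case True
      then obtain r x where rx: "r \<in> {1..2}" "y = e (polar r x)" by (auto elim: annulus_cases)
      obtain x' where "m r x' = x" using circle_lift_surj[OF cl[OF rx(1)]] by blast
      then have "y = fibred_twist e m (e (polar r x'))" using ev rx by simp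
      moreover have "e (polar r x') \<in> topspace S" using rx by (intro eD) (simp add: polar_in_annulus)
      ultimately show ?thesis by blast
    next
      case False
      then show ?thesis using y fibred_twist_outside[OF False, of m] by (metis imageI)
    qed
  qed
  show "inj_on (fibred_twist e m) (topspace S)"
  proof (rule inj_onI)
    fix y y' assume eq: "fibred_twist e m y = fibred_twist e m y'"
    show "y = y'"
    proof (cases "y \<in> e ` annulus")
      case True
      then have "y' \<in> e ` annulus" using in_ann eq by metis
      then obtain r x r' x' where rx: "r \<in> {1..2}" "y = e (polar r x)" "r' \<in> {1..2}" "y' = e (polar r' x')"
        using True by (auto elim!: annulus_cases)
      have "e (polar r (m r x)) = e (polar r' (m r' x'))"
        using eq ev[OF rx(1), of x] ev[OF rx(3), of x'] rx by simp
      then have "polar r (m r x) = polar r' (m r' x')"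
        using rx by (intro inj_onD[OF eD(2)]) (auto simp: polar_in_annulus)
      then have "r = r'" and "\<exists>k::int. m r x = m r' x' + of_int k * (2 * pi)"
        using rx polar_eq_iff[of r r'] by auto
      then obtain k :: int where "m r x = m r (x' + of_int k * (2 * pi))"
        using circle_lift_int[OF cl[OF rx(1)]] by metis
      then have "x = x' + of_int k * (2 * pi)" using circle_lift_eq_iff[OF cl[OF rx(1)]] by simp
      then show ?thesis using rx \<open>r = r'\<close> by (simp add: polar_angle_shift)
    next
      case False
      then have "y' \<notin> e ` annulus" using in_ann eq by metis
      then show ?thesis using False eq by (simp add: fibred_twist_outside)
    qed
  qed
qed (use compact Hausdorff in auto)

lemma fibred_twists_isotopic:
  assumes e: "annulus_in_surface e" and m: "twist_profile m" "twist_profile m'"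
  shows "isotopic S (fibred_twist e m) (fibred_twist e m')"
proof -
  let ?H = "\<lambda>(s, y). fibred_twist e (\<lambda>r x. (1 - s) * m r x + s * m' r x) y"
  have "homeomorphic_map S S (\<lambda>y. ?H (s, y))" if "s \<in> {0..1}" for s
    using fibred_twist_homeomorphic[OF e twist_profile_convex[OF m that]]
    by (simp add: o_def)
  then show ?thesis
    unfolding isotopic_def homotopic_with_def
    using fibred_twist_isotopy_continuous[OF e m] by (intro exI[of _ ?H]) auto
qed

end

section \<open>Dehn twists are mapping classes\<close>

text \<open>The twist is joined to the identity by turning less: each \<open>H s\<close> rotates
  \<open>w\<close> by an angle that depends only on \<open>norm w\<close>, hence is injective, and
  the degree of the identity is inherited.\<close>

lemma oriented_at_left_twist: "oriented_at left_twist z"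
proof -
  define H :: "real \<Rightarrow> complex \<Rightarrow> complex" where "H = (\<lambda>s w. w * cis (2 * pi * (s * (norm w - 1))))"
  have injH: "inj (H s)" for s
  proof (rule injI)
    fix v w assume eq: "H s v = H s w"
    then have "norm (H s v) = norm (H s w)" by simp
    then have "norm v = norm w" by (simp add: H_def norm_mult)
    then show "v = w" using eq by (simp add: H_def)
  qed
  have H1: "H 1 = left_twist" by (simp add: H_def left_twist_def fun_eq_iff)
  have "winding_number (H 0 \<circ> circlepath z 1) (H 0 z) = winding_number (H 1 \<circ> circlepath z 1) (H 1 z)"
  proof (rule winding_number_inj_family)
    show "continuous_on ({0..1} \<times> cball z 1) (\<lambda>(s, w). H s w)"
      unfolding H_def case_prod_unfold by (intro continuous_intros)
  qed (auto intro: inj_on_subset[OF injH])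
  moreover have "H 0 \<circ> circlepath z 1 = circlepath z 1" "H 0 z = z" by (auto simp: H_def)
  ultimately have "winding_number (left_twist \<circ> circlepath z 1) (left_twist z) = 1"
    by (simp add: H1 winding_number_circlepath)
  moreover have "continuous_on UNIV left_twist"
    unfolding left_twist_def by (intro continuous_intros)
  ultimately show ?thesis
    using injH[of 1] by (intro oriented_atI[of UNIV _ _ 1]) (auto simp: H1)
qed

abbreviation open_annulus :: "complex set" where
  "open_annulus \<equiv> {z. 1 < cmod z \<and> cmod z < 2}"

lemma open_open_annulus: "open open_annulus"
  by (intro open_Collect_conj open_Collect_less continuous_intros)

lemma open_annulus_subset: "open_annulus \<subseteq> annulus"
  by (auto simp: annulus_def)

lemma annulus_subset_closure: "annulus \<subseteq> closure open_annulus"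
proof
  fix w assume w: "w \<in> annulus"
  \<comment> \<open>Points are moved towards the core radius 3/2 by a factor that tends to 1. The
    bound 1/5 keeps the modulus below \<open>(6/5) * (3/2) < 2\<close> in one case and at least
    \<open>(4/5) * (3/2) > 1\<close> in the other.\<close>
  define \<eta> where "\<eta> n = (if cmod w < 3/2 then 1 else -1) * inverse (real (Suc n)) / 5" for n
  have "(\<lambda>n. of_real (1 + (if cmod w < 3/2 then 1 else -1) * inverse (real (Suc n)) / 5) * w)
      \<longlonglongrightarrow> of_real (1 + (if cmod w < 3/2 then 1 else -1) * 0 / 5) * w"
    by (intro tendsto_intros LIMSEQ_inverse_real_of_nat) auto
  then have "(\<lambda>n. of_real (1 + \<eta> n) * w) \<longlonglongrightarrow> w"
    by (simp add: \<eta>_def)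
  moreover have "of_real (1 + \<eta> n) * w \<in> open_annulus" for n
  proof -
    have i: "0 < inverse (real (Suc n))" "inverse (real (Suc n)) \<le> 1" by (auto simp: field_simps)
    have \<eta>: "\<bar>\<eta> n\<bar> \<le> 1/5" using i by (simp add: \<eta>_def)
    have n: "cmod (of_real (1 + \<eta> n) * w) = (1 + \<eta> n) * cmod w"
      using \<eta> by (simp only: norm_mult norm_of_real)
    show ?thesis
    proof (cases "cmod w < 3/2")
      case True
      then have pos: "\<eta> n > 0" using i by (simp add: \<eta>_def)
      have "1 * 1 < (1 + \<eta> n) * cmod w"
        using pos w by (intro mult_less_le_imp_less) (auto simp: annulus_def)
      moreover have "(1 + \<eta> n) * cmod w < (6/5) * (3/2)"
        using \<eta> True w pos by (intro mult_le_less_imp_less) (auto simp: annulus_def)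
      ultimately show ?thesis using n by simp
    next
      case False
      then have neg: "\<eta> n < 0" using i by (simp add: \<eta>_def)
      have "(4/5) * (3/2) \<le> (1 + \<eta> n) * cmod w"
        using \<eta> False by (intro mult_mono) auto
      moreover have "(1 + \<eta> n) * cmod w < 1 * 2"
        using neg w False \<eta> by (intro mult_less_le_imp_less) (auto simp: annulus_def)
      ultimately show ?thesis using n by simp
    qed
  qed
  ultimately show "w \<in> closure open_annulus"
    unfolding closure_sequential by (intro exI[of _ "\<lambda>n. of_real (1 + \<eta> n) * w"]) blast
qed

lemma fibred_left_twist:
  assumes "inj_on e annulus" "z \<in> annulus"
  shows "fibred_twist e left_profile (e z) = e (left_twist z)"
  using assms by (simp add: fibred_twist_def left_twist_polar)

context closed_surface
begin

lemma annular_neighbourhoodD: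
  assumes "annular_neighbourhood S \<A> C e"
  shows "annulus_in_surface e" and "e ` sphere 0 (3/2) = C"
    and "\<And>z. z \<in> open_annulus \<Longrightarrow> orients_at \<A> e z"
proof -
  have hm: "homeomorphic_map (top_of_set annulus) (subtopology S (e ` annulus)) e"
    using assms by (simp add: annular_neighbourhood_def embedding_map_def)
  show e: "annulus_in_surface e"
    using homeomorphic_imp_continuous_map[OF hm] homeomorphic_imp_injective_map[OF hm]
    by (simp add: annulus_in_surface_def continuous_map_in_subtopology)
  show "e ` sphere 0 (3/2) = C" using assms by (simp add: annular_neighbourhood_def)
  have "orients \<A> (interior annulus) e \<longleftrightarrow> (\<forall>z\<in>interior annulus. orients_at \<A> e z)"
    by (rule orients_iff)
       (use annulus_in_surfaceD[OF e] interior_subset in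
          \<open>auto intro: continuous_map_from_subtopology_mono inj_on_subset\<close>)
  then show "orients_at \<A> e z" if "z \<in> open_annulus" for z
    using that assms open_in_interior_annulus by (auto simp: annular_neighbourhood_def)
qed

lemma annulus_in_surface_open:
  assumes "annulus_in_surface e" "open U" "U \<subseteq> annulus"
  shows "continuous_map (top_of_set U) S e" "inj_on e U" "openin S (e ` U)"
proof -
  show *: "continuous_map (top_of_set U) S e" "inj_on e U"
    using annulus_in_surfaceD(1,2)[OF assms(1)] assms(3)
    by (auto intro: continuous_map_from_subtopology_mono inj_on_subset)
  show "openin S (e ` U)" using assms(2) * by (rule invariance_of_domain_surface)
qed

text \<open>In the open annulus the twist is \<open>left_twist\<close> in oriented coordinates, and
  off the closed annulus it is the identity. On the boundary circles neither description holds in a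
  full neighbourhood; there a nearby point of the open annulus determines the degree, which is
  constant on a small disc in a chart.\<close>

lemma twist_orientation_homeo:
  assumes "annular_neighbourhood S \<A> C e"
  shows "orientation_homeo (fibred_twist e left_profile)"
proof -
  note eN = annular_neighbourhoodD[OF assms]
  note eD = annulus_in_surfaceD[OF eN(1)]
  note eO = annulus_in_surface_open[OF eN(1) open_open_annulus open_annulus_subset]
  define T where "T = fibred_twist e left_profile"
  have hT: "homeomorphic_map S S T"
    unfolding T_def using eN(1) twist_profile_left by (rule fibred_twist_homeomorphic)
  have pre: "open (p -` W)" if "openin S W" "p \<in> \<A>" for p W
    using openin_continuous_map_preimage[OF chart_continuous[OF that(2)] that(1)]
    by (simp add: vimage_def)
  have inside: "orients_at \<A> (T \<circ> p) z" if p: "p \<in> \<A>" and z: "p z \<in> e ` open_annulus" for p z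
  proof -
    obtain w where w: "w \<in> open_annulus" "p z = e w" using z by blast
    let ?\<xi> = "inv_into annulus e \<circ> p"
    have inv: "inv_into annulus e (e v) = v" if "v \<in> open_annulus" for v
      using that open_annulus_subset eD(2) by (intro inv_into_f_f) auto
    have "oriented_at ?\<xi> z"
      using open_open_annulus w(1) eO(1,2) inv p w(2) eN(3)[OF w(1)] by (rule left_inverse_oriented_at)
    then have "oriented_at (left_twist \<circ> ?\<xi>) z"
      using oriented_at_left_twist by (rule oriented_at_comp)
    moreover have "(left_twist \<circ> ?\<xi>) z \<in> open_annulus"
      using w inv by (simp add: left_twist_def norm_mult)
    ultimately have "orients_at \<A> (e \<circ> (left_twist \<circ> ?\<xi>)) z"
      by (intro orients_at_comp eN(3))
    then show ?thesis
    proof (rule orients_at_cong)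
      show "open (p -` e ` open_annulus)" using eO(3) p by (rule pre)
      show "z \<in> p -` e ` open_annulus" using z by simp
      fix v assume "v \<in> p -` e ` open_annulus"
      then obtain u where u: "u \<in> open_annulus" "p v = e u" by auto
      then show "(e \<circ> (left_twist \<circ> ?\<xi>)) v = (T \<circ> p) v"
        using inv[OF u(1)] open_annulus_subset fibred_left_twist[OF eD(2), of u] by (auto simp: T_def)
    qed
  qed
  have "orients_at \<A> (T \<circ> p) z" if p: "p \<in> \<A>" for p z
  proof (cases "p z \<in> e ` annulus")
    case False
    have "open (p -` (topspace S - e ` annulus))" using eD(4) p by (intro pre) auto
    then show ?thesis
      using False chart_in_topspace[OF p]
      by (intro orients_at_cong[OF chart_orients_at[OF p], of "p -` (topspace S - e ` annulus)"])
         (auto simp: T_def fibred_twist_outside)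
  next
    case True
    then obtain w where w: "w \<in> annulus" "p z = e w" by blast
    note cT = homeo_chart[OF hT p]
    have "T (p z) \<in> topspace S"
      using hT chart_in_topspace[OF p] homeomorphic_imp_surjective_map by fast
    then obtain q where q: "q \<in> \<A>" "T (p z) \<in> range q" using chart_cover by blast
    let ?V = "{v \<in> UNIV. (T \<circ> p) v \<in> range q}"
    have "open ?V" "z \<in> ?V"
      using chart_read_open[of UNIV "T \<circ> p" q] cT q by auto
    then obtain R where R: "R > 0" "ball z R \<subseteq> ?V" using open_contains_ball by meson
    have "openin S (p ` ball z R)" using chart_open[OF p] by simp
    from openin_continuous_map_preimage[OF eD(1) this]
    have "openin (top_of_set annulus) {v \<in> annulus. e v \<in> p ` ball z R}" by simp
    moreover have "w \<in> {v \<in> annulus. e v \<in> p ` ball z R}" using w R by (auto intro: image_eqI[of _ _ z])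
    ultimately obtain \<epsilon> where \<epsilon>: "\<epsilon> > 0" "ball w \<epsilon> \<inter> annulus \<subseteq> {v \<in> annulus. e v \<in> p ` ball z R}"
      by (metis (no_types, lifting) openin_contains_ball)
    have "w \<in> closure open_annulus" using w annulus_subset_closure by blast
    then obtain v where v: "v \<in> open_annulus" "dist v w < \<epsilon>"
      using \<epsilon>(1) by (auto simp: closure_approachable)
    then have "v \<in> ball w \<epsilon> \<inter> annulus" using open_annulus_subset by (auto simp: dist_commute)
    then obtain z' where z': "z' \<in> ball z R" "p z' = e v" using \<epsilon>(2) by force
    have "orients_at \<A> (T \<circ> p) z'" using v z' by (intro inside p) auto
    moreover have "(T \<circ> p) z' \<in> range q" using R z' by blast
    ultimately have "oriented_at (inv_into UNIV q \<circ> (T \<circ> p)) z'"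
      using q by (simp add: orients_at_def)
    moreover have "continuous_on (ball z R) (inv_into UNIV q \<circ> (T \<circ> p))"
      "inj_on (inv_into UNIV q \<circ> (T \<circ> p)) (ball z R)"
      using chart_read[of UNIV "T \<circ> p" q] cT q R by (auto intro: continuous_on_subset inj_on_subset)
    ultimately have "oriented_at (inv_into UNIV q \<circ> (T \<circ> p)) z"
      using z' by (intro oriented_at_locally_const[of z R])
    then show ?thesis
      using q cT by (intro orients_atI[where U=UNIV and q=q]) auto
  qed
  then show ?thesis using hT by (simp add: orientation_homeo_def T_def)
qed

lemma twist_along_carrier:
  assumes "annular_neighbourhood S \<A> C e"
  shows "twist_along S e \<in> carrier \<H>"
  using orientation_homeo_cong[OF twist_orientation_homeo[OF assms]] twist_along_fibred[of _ S e]
  by (auto simp: carrier_Homeo_plus twist_along_def)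

section \<open>Conjugation of twists by homeomorphisms\<close>

lemma twist_along_comp:
  assumes f: "homeomorphic_map S S f" and e: "annulus_in_surface e" and y: "y \<in> topspace S"
  shows "twist_along S (f \<circ> e) (f y) = f (twist_along S e y)"
proof -
  have fi: "inj_on f (topspace S)" "f y \<in> topspace S"
    using f y homeomorphic_imp_injective_map homeomorphic_imp_surjective_map by fast+
  have "fibred_twist (f \<circ> e) left_profile (f y) = f (fibred_twist e left_profile y)"
  proof (cases "y \<in> e ` annulus")
    case True
    then obtain z where z: "z \<in> annulus" "y = e z" by blast
    have "e ` annulus \<subseteq> topspace S" using annulus_in_surfaceD(3)[OF e] by blast
    then have "inj_on (f \<circ> e) annulus"
      using annulus_in_surfaceD(2)[OF e] fi by (blast intro: comp_inj_on inj_on_subset)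
    then show ?thesis
      using fibred_left_twist[of "f \<circ> e" z] fibred_left_twist[OF annulus_in_surfaceD(2)[OF e], of z] z by simp
  next
    case False
    then have "f y \<notin> (f \<circ> e) ` annulus"
      using annulus_in_surfaceD(3)[OF e] inj_onD[OF fi(1)] y by auto
    then show ?thesis using False by (simp add: fibred_twist_outside)
  qed
  then show ?thesis using y fi by (simp add: twist_along_fibred)
qed

lemma annular_neighbourhood_image:
  assumes f: "orientation_homeo f" and e: "annular_neighbourhood S \<A> C e" and fC: "f ` C = C"
  shows "annular_neighbourhood S \<A> C (f \<circ> e)"
proof -
  have hf: "homeomorphic_map S S f" using f by (simp add: orientation_homeo_def)
  then have ef: "embedding_map S S f" by (simp add: surjective_embedding_map[symmetric])
  have em: "embedding_map (top_of_set annulus) S (f \<circ> e)"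
    using e ef by (auto simp: annular_neighbourhood_def intro: embedding_map_compose)
  have eA: "annulus_in_surface e" using annular_neighbourhoodD[OF e] by simp
  note eI = annulus_in_surface_open[OF eA open_interior interior_subset]
  have in_top: "e ` interior annulus \<subseteq> topspace S" using openin_subset[OF eI(3)] .
  have "orients \<A> (interior annulus) (f \<circ> e) \<longleftrightarrow> (\<forall>z\<in>interior annulus. orients_at \<A> (f \<circ> e) z)"
  proof (rule orients_iff)
    show "continuous_map (top_of_set (interior annulus)) S (f \<circ> e)"
      using eI(1) homeomorphic_imp_continuous_map[OF hf] by (rule continuous_map_compose)
    show "inj_on (f \<circ> e) (interior annulus)"
      using eI(2) homeomorphic_imp_injective_map[OF hf] in_top by (blast intro: comp_inj_on inj_on_subset)
  qed simp
  moreover have "orients_at \<A> (f \<circ> e) z" if "z \<in> interior annulus" for z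
  proof (rule orientation_homeo_comp_orients_at[OF f open_interior that eI(1,2)])
    show "orients_at \<A> e z"
      using orients_iff[OF open_interior eI(1,2)] that e by (simp add: annular_neighbourhood_def)
  qed
  moreover have "(f \<circ> e) ` sphere 0 (3/2) = C"
    using e fC by (auto simp: annular_neighbourhood_def image_comp[symmetric] simp del: o_apply)
  ultimately show ?thesis using em by (simp add: annular_neighbourhood_def)
qed

lemma conjugate_twist:
  assumes f: "f \<in> carrier \<H>" and e: "annular_neighbourhood S \<A> C e" and fC: "f ` C = C"
  shows "f \<otimes>\<^bsub>\<H>\<^esub> twist_along S e = twist_along S (f \<circ> e) \<otimes>\<^bsub>\<H>\<^esub> f"
proof -
  have of: "orientation_homeo f" "homeomorphic_map S S f"
    using f by (auto simp: carrier_Homeo_plus orientation_homeo_def)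
  have T: "twist_along S e \<in> carrier \<H>" "twist_along S (f \<circ> e) \<in> carrier \<H>"
    using twist_along_carrier e annular_neighbourhood_image[OF of(1) e fC] by auto
  show ?thesis
    using twist_along_comp[OF of(2) annular_neighbourhoodD(1)[OF e]] f T
    by (auto simp: mult_Homeo_plus compose_def)
qed

end

section \<open>Annuli with a common core\<close>

text \<open>A twist that is completed at radius 3/2, conjugated by \<open>v\<close> on every circle:
  this is how a plain twist looks after the circles have been reparametrized by
  \<open>v\<close>.\<close>

definition inner_profile :: "(real \<Rightarrow> real) \<Rightarrow> real \<Rightarrow> real \<Rightarrow> real" where
  "inner_profile v r x = v (inv_into UNIV v x + 2 * pi * min 1 (2 * (r - 1)))"

text \<open>All turning takes place in the collar between the radii 3/2 and
  \<open>3/2 + \<delta>\<close>.\<close>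

definition outer_profile :: "real \<Rightarrow> real \<Rightarrow> real \<Rightarrow> real" where
  "outer_profile \<delta> r x = x + 2 * pi * max 0 (min 1 ((r - 3/2) / \<delta>))"

lemma twist_profile_inner:
  assumes v: "circle_lift v"
  shows "twist_profile (inner_profile v)"
proof (rule twist_profileI)
  let ?u = "inv_into UNIV v"
  have u: "circle_lift ?u" "\<And>x. v (?u x) = x" using circle_lift_inverse[OF v] by auto
  have v': "v (x + 2 * pi) = v x + 2 * pi" "x < y \<Longrightarrow> v x < v y" for x y
    using v by (auto simp: circle_lift_def strict_mono_def)
  have u': "?u (x + 2 * pi) = ?u x + 2 * pi" "x < y \<Longrightarrow> ?u x < ?u y" for x y
    using u(1) by (auto simp: circle_lift_def strict_mono_def)
  have c: "continuous_on UNIV v" "continuous_on UNIV ?u" using v u(1) by (auto simp: circle_lift_def)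
  show "continuous_on ({1..2} \<times> UNIV) (\<lambda>(r, x). inner_profile v r x)"
    unfolding inner_profile_def case_prod_unfold
    by (intro continuous_on_compose2[OF c(1)] continuous_on_compose2[OF c(2)] continuous_intros subset_UNIV)
  show "inner_profile v r x < inner_profile v r y" if "x < y" for r x y
    using u'(2)[OF that] by (simp add: inner_profile_def v'(2))
  show "inner_profile v r (x + 2 * pi) = inner_profile v r x + 2 * pi" for r x
    using v'(1)[of "?u x + 2 * pi * min 1 (2 * (r - 1))"] by (simp add: inner_profile_def u'(1) add_ac)
qed (use circle_lift_inverse[OF v] v in \<open>auto simp: inner_profile_def circle_lift_def\<close>)

lemma twist_profile_outer:
  assumes "0 < \<delta>" "\<delta> \<le> 1/2"
  shows "twist_profile (outer_profile \<delta>)"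
proof (rule twist_profileI)
  show "continuous_on ({1..2} \<times> UNIV) (\<lambda>(r, x). outer_profile \<delta> r x)"
    unfolding outer_profile_def case_prod_unfold using assms by (intro continuous_intros) auto
  have "(1 - 3/2) / \<delta> \<le> 0" "1 \<le> (2 - 3/2) / \<delta>" using assms by (simp_all add: divide_le_0_iff)
  then show "outer_profile \<delta> 1 x = x" "outer_profile \<delta> 2 x = x + 2 * pi" for x
    by (simp_all add: outer_profile_def)
qed (simp_all add: outer_profile_def)

context closed_surface
begin

lemma fibred_twist_eq_self:
  assumes "annulus_in_surface e" "twist_profile m"
    and "\<And>r x. r \<in> {1..2} \<Longrightarrow> y = e (polar r x) \<Longrightarrow> m r x = x \<or> m r x = x + 2 * pi"
  shows "fibred_twist e m y = y"
proof (cases "y \<in> e ` annulus")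
  case True
  then obtain r x where rx: "r \<in> {1..2}" "y = e (polar r x)" by (auto elim: annulus_cases)
  have "fibred_twist e m (e (polar r x)) = e (polar r (m r x))"
    using rx assms annulus_in_surfaceD(2) by (intro fibred_twist_polar) (auto simp: twist_profile_def)
  then show ?thesis using assms(3)[OF rx] rx polar_angle_shift[of r x 1] by auto
qed (simp add: fibred_twist_outside)

text \<open>
  The inner half of the first annulus and a collar on the outer side of the second one fit
  together to a third annulus. A twist along it can be supported in either half, where it is also
  a twist along one of the given annuli.
\<close>

lemma twists_with_common_core_isotopic:
  assumes e: "annulus_in_surface e" and e': "annulus_in_surface e'"
    and v: "circle_lift v" and \<delta>: "0 < \<delta>" "\<delta> \<le> 1/2"
    and core: "\<And>x. e' (polar (3/2) x) = e (polar (3/2) (v x))"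
    and side: "\<And>r x. 3/2 < r \<Longrightarrow> r \<le> 3/2 + \<delta> \<Longrightarrow> e' (polar r x) \<notin> e ` {z \<in> annulus. cmod z \<le> 3/2}"
  shows "isotopic S (fibred_twist e left_profile) (fibred_twist e' left_profile)"
proof -
  note eD = annulus_in_surfaceD[OF e] and eD' = annulus_in_surfaceD[OF e']
  note u = circle_lift_inverse[OF v]
  \<comment> \<open>The slope \<open>2 * \<delta>\<close> compresses the outer half, of width 1/2,
    to the collar of width \<open>\<delta>\<close>.\<close>
  define \<rho> where "\<rho> r = 3/2 + 2 * \<delta> * (r - 3/2)" for r
  \<comment> \<open>The inner half has to be reparametrized by \<open>v\<close> because only then do
    the two formulas agree at radius 3/2, by \<open>core\<close>.\<close>
  define E where "E z = (if cmod z \<le> 3/2 then e (polar (cmod z) (v (Arg z)))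
                         else e' (polar (\<rho> (cmod z)) (Arg z)))" for z
  have \<rho>_range: "\<rho> r \<in> {1..2}" "3/2 < r \<Longrightarrow> 3/2 < \<rho> r \<and> \<rho> r \<le> 3/2 + \<delta>" if "r \<in> {1..2}" for r
  proof -
    have "\<bar>r - 3/2\<bar> \<le> 1/2" using that unfolding abs_le_iff by auto
    then have "2 * \<delta> * \<bar>r - 3/2\<bar> \<le> 2 * \<delta> * (1/2)" using \<delta> by (intro mult_left_mono) auto
    then have *: "\<bar>\<rho> r - 3/2\<bar> \<le> \<delta>" using \<delta> by (simp add: abs_mult \<rho>_def)
    then show "\<rho> r \<in> {1..2}" using \<delta> unfolding abs_le_iff atLeastAtMost_iff by linarith
    assume "3/2 < r"
    then have "0 < \<rho> r - 3/2" using \<delta> by (simp add: \<rho>_def)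
    then show "3/2 < \<rho> r \<and> \<rho> r \<le> 3/2 + \<delta>" using * unfolding abs_le_iff by linarith
  qed
  have Arg_polar: "\<exists>k::int. Arg (polar r x) = x + of_int k * (2 * pi)" if "0 < r" for r x
    using polar_norm_Arg[of "polar r x"] norm_polar[of r x] polar_eq_iff[of r r] that by simp
  have E_inner: "E (polar r x) = e (polar r (v x))" if r: "r \<in> {1..3/2}" for r x
  proof -
    obtain k :: int where "Arg (polar r x) = x + of_int k * (2 * pi)" using Arg_polar[of r x] r by auto
    then show ?thesis
      using r by (simp add: E_def norm_polar circle_lift_int[OF v] polar_angle_shift)
  qed
  have E_outer: "E (polar r x) = e' (polar (\<rho> r) x)" if r: "r \<in> {3/2..2}" for r x
  proof (cases "r = 3/2")
    case True
    have "E (polar (3/2) x) = e' (polar (\<rho> (3/2)) x)"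
      using E_inner[of "3/2" x] core by (simp add: \<rho>_def)
    then show ?thesis by (simp only: True)
  next
    case False
    obtain k :: int where "Arg (polar r x) = x + of_int k * (2 * pi)" using Arg_polar[of r x] r by auto
    then show ?thesis
      using r False by (simp add: E_def norm_polar polar_angle_shift)
  qed
  have E_outside: "E (polar r x) \<notin> e ` {z \<in> annulus. cmod z \<le> 3/2}" if "r \<in> {1..2}" "3/2 < r" for r x
    using E_outer[of r x] side \<rho>_range[OF that(1)] that by simp
  have E_in_inner: "E (polar r x) \<in> e ` {z \<in> annulus. cmod z \<le> 3/2}" if "r \<in> {1..2}" "r \<le> 3/2" for r x
    using E_inner[of r x] that by (auto simp: polar_in_annulus norm_polar)
  \<comment> \<open>Continuity is again tested on a rectangle of radii and angles, here pasted along
    radius 3/2. That the two halves do not meet beyond the core is \<open>E_outside\<close>, which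
    rests on \<open>side\<close>.\<close>
  have E: "annulus_in_surface E"
    unfolding annulus_in_surface_def
  proof
    let ?K = "{1..2::real} \<times> {0..2 * pi}" and ?Q = "\<lambda>(r, x). polar r x"
    have "continuous_on UNIV v" using v by (simp add: circle_lift_def)
    then have cv: "continuous_on X (\<lambda>p. v (f p))" if "continuous_on X f" for X :: "(real \<times> real) set" and f
      using that by (rule continuous_on_compose2) simp
    have "quotient_map (top_of_set ?K) (top_of_set annulus) ?Q"
    proof (rule continuous_imp_quotient_map)
      show "continuous_map (top_of_set ?K) (top_of_set annulus) ?Q"
        by (auto simp: case_prod_unfold polar_in_annulus intro!: continuous_intros)
      show "compact_space (top_of_set ?K)"
        by (intro compact_space_subtopology) (simp add: compact_Times)
    qed (use annulus_image_polar in \<open>auto simp: Hausdorff_space_subtopology\<close>)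
    moreover have "continuous_map (top_of_set ?K) S (E \<circ> ?Q)"
    proof (rule pasting_lemma_closed[where I="UNIV::bool set"
          and T="\<lambda>b. if b then {1..3/2} \<times> {0..2 * pi} else {3/2..2} \<times> {0..2 * pi}"
          and f="\<lambda>_. E \<circ> ?Q"])
      fix b :: bool
      show "closedin (top_of_set ?K) (if b then {1..3/2} \<times> {0..2 * pi} else {3/2..2} \<times> {0..2 * pi})"
        by (intro closed_subset) (auto intro: closed_Times)
      have "continuous_map (top_of_set ({1..3/2} \<times> {0..2 * pi})) (top_of_set annulus) (\<lambda>p. polar (fst p) (v (snd p)))"
        by (auto simp: polar_in_annulus intro!: continuous_intros cv)
      then have "continuous_map (top_of_set ({1..3/2} \<times> {0..2 * pi})) S (e \<circ> (\<lambda>p. polar (fst p) (v (snd p))))"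
        using eD(1) by (rule continuous_map_compose)
      then have c1: "continuous_map (top_of_set ({1..3/2} \<times> {0..2 * pi})) S (E \<circ> ?Q)"
        by (rule continuous_map_eq) (auto simp: E_inner)
      have "continuous_map (top_of_set ({3/2..2} \<times> {0..2 * pi})) (top_of_set annulus) (\<lambda>p. polar (\<rho> (fst p)) (snd p))"
      proof -
        have "continuous_on X (\<lambda>p. \<rho> (fst p))" for X :: "(real \<times> real) set"
          unfolding \<rho>_def by (intro continuous_intros)
        then have "continuous_on X (\<lambda>p. polar (\<rho> (fst p)) (snd p))" for X :: "(real \<times> real) set"
          by (intro continuous_intros)
        moreover have "polar (\<rho> (fst p)) (snd p) \<in> annulus" if "p \<in> {3/2..2} \<times> {0..2 * pi}" for p
          using that \<rho>_range(1)[of "fst p"] by (cases p) (auto simp: polar_in_annulus)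
        ultimately show ?thesis by auto
      qed
      then have "continuous_map (top_of_set ({3/2..2} \<times> {0..2 * pi})) S (e' \<circ> (\<lambda>p. polar (\<rho> (fst p)) (snd p)))"
        using eD'(1) by (rule continuous_map_compose)
      then have c2: "continuous_map (top_of_set ({3/2..2} \<times> {0..2 * pi})) S (E \<circ> ?Q)"
        by (rule continuous_map_eq) (auto simp: E_outer)
      have "?K \<inter> ({1..3/2} \<times> {0..2 * pi}) = {1..3/2} \<times> {0..2 * pi}"
        "?K \<inter> ({3/2..2} \<times> {0..2 * pi}) = {3/2..2} \<times> {0..2 * pi}" by auto
      then show "continuous_map (subtopology (top_of_set ?K)
          (if b then {1..3/2} \<times> {0..2 * pi} else {3/2..2} \<times> {0..2 * pi})) S (E \<circ> ?Q)"
        using c1 c2 by (simp add: subtopology_subtopology)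
    next
      fix p assume "p \<in> topspace (top_of_set ?K)"
      then have "p \<in> {1..3/2} \<times> {0..2 * pi} \<or> p \<in> {3/2..2} \<times> {0..2 * pi}" by auto
      then show "\<exists>b. b \<in> UNIV \<and> p \<in> (if b then {1..3/2} \<times> {0..2 * pi} else {3/2..2} \<times> {0..2 * pi})
          \<and> (E \<circ> ?Q) p = (E \<circ> ?Q) p" by (metis (full_types) UNIV_I)
    qed auto
    ultimately show "continuous_map (top_of_set annulus) S E"
      by (rule continuous_compose_quotient_map)
    show "inj_on E annulus"
    proof (rule inj_onI)
      fix z z' assume z: "z \<in> annulus" "z' \<in> annulus" and eq: "E z = E z'"
      obtain r x where rx: "r \<in> {1..2}" "z = polar r x" using z(1) by (rule annulus_cases)
      obtain r' x' where rx': "r' \<in> {1..2}" "z' = polar r' x'" using z(2) by (rule annulus_cases)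
      show "z = z'"
      proof (cases "r \<le> 3/2")
        case True
        then have r': "r' \<le> 3/2" using E_outside[OF rx'(1)] E_in_inner[OF rx(1)] eq rx rx' by (metis not_le)
        then have "e (polar r (v x)) = e (polar r' (v x'))" using True eq rx rx' E_inner by simp
        then have "polar r (v x) = polar r' (v x')"
          using rx rx' by (intro inj_onD[OF eD(2)]) (auto simp: polar_in_annulus)
        then obtain k :: int where "r = r'" "v x = v (x' + of_int k * (2 * pi))"
          using rx rx' polar_eq_iff[of r r'] circle_lift_int[OF v] by fastforce
        then show ?thesis using rx rx' circle_lift_eq_iff[OF v] by (simp add: polar_angle_shift)
      next
        case False
        then have r': "\<not> r' \<le> 3/2" using E_outside[OF rx(1)] E_in_inner[OF rx'(1)] eq rx rx' by (metis not_le)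
        then have "e' (polar (\<rho> r) x) = e' (polar (\<rho> r') x')"
          using False eq rx rx' E_outer[of r x] E_outer[of r' x'] by simp
        then have "polar (\<rho> r) x = polar (\<rho> r') x'"
          using \<rho>_range(1)[OF rx(1)] \<rho>_range(1)[OF rx'(1)]
          by (intro inj_onD[OF eD'(2)]) (auto simp: polar_in_annulus)
        then obtain k :: int where "\<rho> r = \<rho> r'" "x = x' + of_int k * (2 * pi)"
          using polar_eq_iff[of "\<rho> r" "\<rho> r'"] \<rho>_range(1)[OF rx(1)] \<rho>_range(1)[OF rx'(1)] by auto
        moreover from this have "r = r'" using \<delta> by (simp add: \<rho>_def)
        ultimately show ?thesis using rx rx' by (simp add: polar_angle_shift)
      qed
    qed
  qed
  note ED = annulus_in_surfaceD[OF E]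
  \<comment> \<open>Both are profiles on \<open>E\<close>: the turning of \<open>m\<close> fills the
    inner half, and that of \<open>m'\<close>, with collar width 1/2, the outer half.\<close>
  define m where "m = inner_profile (\<lambda>x. x)"
  define m' where "m' = outer_profile (1/2)"
  have lift_id: "circle_lift (\<lambda>x. x)" by (simp add: circle_lift_def strict_mono_def)
  have m_eq: "m r x = x + 2 * pi * min 1 (2 * (r - 1))" for r x
    using circle_lift_inverse(2)[OF lift_id] by (simp add: m_def inner_profile_def)
  have prof: "twist_profile m" "twist_profile m'" "twist_profile (inner_profile v)" "twist_profile (outer_profile \<delta>)"
    unfolding m_def m'_def using twist_profile_inner[OF lift_id] twist_profile_inner[OF v] twist_profile_outer \<delta> by auto
  have ev: "fibred_twist a k (a (polar r x)) = a (polar r (k r x))"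
    if "annulus_in_surface a" "twist_profile k" "r \<in> {1..2}" for a k r x
    using that annulus_in_surfaceD(2) by (intro fibred_twist_polar) (auto simp: twist_profile_def)
  \<comment> \<open>On the inner half \<open>E\<close> differs from \<open>e\<close> by
    \<open>v\<close> on each circle, so the plain twist \<open>m\<close> of \<open>E\<close> becomes
    its conjugate by \<open>v\<close>. At larger radii both profiles have completed the full
    turn.\<close>
  have inner: "fibred_twist E m y = fibred_twist e (inner_profile v) y" for y
  proof (cases "y \<in> e ` {z \<in> annulus. cmod z \<le> 3/2}")
    case True
    then obtain z where z: "z \<in> annulus" "cmod z \<le> 3/2" "y = e z" by blast
    obtain r x where rx: "r \<in> {1..2}" "z = polar r x" using z(1) by (rule annulus_cases)
    then have r: "r \<in> {1..3/2}" using z by (simp add: norm_polar)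
    have y: "y = E (polar r (inv_into UNIV v x))" using E_inner[OF r] z rx u by simp
    show ?thesis
      using ev[OF E prof(1) rx(1), of "inv_into UNIV v x"] ev[OF e prof(3) rx(1), of x] E_inner[OF r]
      by (simp add: m_eq inner_profile_def u(2) z rx)
  next
    case False
    have "fibred_twist E m y = y"
    proof (rule fibred_twist_eq_self[OF E prof(1)])
      fix r x assume "r \<in> {1..2}" "y = E (polar r x)"
      then show "m r x = x \<or> m r x = x + 2 * pi"
        using False E_in_inner[of r x] by (cases "r \<le> 3/2") (auto simp: m_eq)
    qed
    moreover have "fibred_twist e (inner_profile v) y = y"
    proof (rule fibred_twist_eq_self[OF e prof(3)])
      fix r x assume rx: "r \<in> {1..2}" "y = e (polar r x)"
      then have "3/2 < r" using False by (force simp: polar_in_annulus norm_polar)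
      then show "inner_profile v r x = x \<or> inner_profile v r x = x + 2 * pi"
        using u v by (simp add: inner_profile_def circle_lift_def)
    qed
    ultimately show ?thesis by simp
  qed
  \<comment> \<open>\<open>\<rho>\<close> matches the outer half of \<open>E\<close> with the collar
    of \<open>e'\<close>, and the profiles correspond. Within smaller radii neither has begun to
    turn, and beyond the collar \<open>outer_profile \<delta>\<close> has completed its
    turn.\<close>
  have outer: "fibred_twist E m' y = fibred_twist e' (outer_profile \<delta>) y" for y
  proof (cases "\<exists>r x. r \<in> {3/2..3/2 + \<delta>} \<and> y = e' (polar r x)")
    case True
    then obtain r x where rx: "r \<in> {3/2..3/2 + \<delta>}" "y = e' (polar r x)" by blast
    define r' where "r' = 3/2 + (r - 3/2) / (2 * \<delta>)"
    have "(r - 3/2) / (2 * \<delta>) \<le> 1/2" "0 \<le> (r - 3/2) / (2 * \<delta>)" using rx \<delta> by (auto simp: field_simps)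
    then have "r' \<in> {3/2..2}" unfolding r'_def atLeastAtMost_iff by linarith
    moreover have "\<rho> r' = r" using \<delta> by (simp add: r'_def \<rho>_def)
    ultimately have r': "r' \<in> {3/2..2}" "\<rho> r' = r" by auto
    then have y: "y = E (polar r' x)" using E_outer rx by simp
    have "(r' - 3/2) / (1/2) = (r - 3/2) / \<delta>" using \<delta> by (simp add: r'_def field_simps)
    then have "m' r' x = outer_profile \<delta> r x" unfolding m'_def outer_profile_def by (simp only:)
    then show ?thesis
      using ev[OF E prof(2), of r' x] ev[OF e' prof(4), of r x] r' rx \<delta> E_outer[OF r'(1)]
      by (simp add: y)
  next
    case False
    have "fibred_twist E m' y = y"
    proof (rule fibred_twist_eq_self[OF E prof(2)])
      fix r x assume rx: "r \<in> {1..2}" "y = E (polar r x)"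
      have "r < 3/2"
      proof (rule ccontr)
        assume "\<not> r < 3/2"
        then have "3/2 \<le> r" by simp
        then have "3/2 \<le> \<rho> r \<and> \<rho> r \<le> 3/2 + \<delta>"
          using \<rho>_range(2)[OF rx(1)] \<delta> by (cases "3/2 < r") (auto simp: \<rho>_def)
        moreover have "y = e' (polar (\<rho> r) x)" using E_outer[of r x] rx \<open>3/2 \<le> r\<close> by simp
        ultimately show False using False by (metis atLeastAtMost_iff)
      qed
      then show "m' r x = x \<or> m' r x = x + 2 * pi" by (simp add: m'_def outer_profile_def)
    qed
    moreover have "fibred_twist e' (outer_profile \<delta>) y = y"
    proof (rule fibred_twist_eq_self[OF e' prof(4)])
      fix r x assume rx: "r \<in> {1..2}" "y = e' (polar r x)"
      then have "r < 3/2 \<or> 3/2 + \<delta> < r" using False by (metis atLeastAtMost_iff not_le)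
      then have "(r - 3/2) / \<delta> \<le> 0 \<or> 1 \<le> (r - 3/2) / \<delta>" using \<delta> by (auto simp: field_simps)
      then show "outer_profile \<delta> r x = x \<or> outer_profile \<delta> r x = x + 2 * pi"
        by (auto simp: outer_profile_def)
    qed
    ultimately show ?thesis by simp
  qed
  \<comment> \<open>The twist of \<open>e\<close> is concentrated in its inner half, slid along
    \<open>E\<close> to the outer half, and spread over \<open>e'\<close>.\<close>
  have "isotopic S (fibred_twist e left_profile) (fibred_twist e (inner_profile v))"
    using e twist_profile_left prof(3) by (rule fibred_twists_isotopic)
  moreover have "fibred_twist e (inner_profile v) = fibred_twist E m" using inner by auto
  moreover have "isotopic S (fibred_twist E m) (fibred_twist E m')"
    using E prof(1,2) by (rule fibred_twists_isotopic)
  moreover have "fibred_twist E m' = fibred_twist e' (outer_profile \<delta>)" using outer by auto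
  moreover have "isotopic S (fibred_twist e' (outer_profile \<delta>)) (fibred_twist e' left_profile)"
    using e' prof(4) twist_profile_left by (rule fibred_twists_isotopic)
  ultimately show ?thesis by (metis isotopic_trans)
qed

end

text \<open>The half turn: in polar coordinates \<open>r\<close> becomes \<open>3 - r\<close>, with
  3 the sum of the boundary radii, and the angle changes sign. Two reversals together preserve
  orientation.\<close>

definition annulus_flip :: "complex \<Rightarrow> complex" where
  "annulus_flip z = of_real ((3 - cmod z) / cmod z) * cnj z"

lemma annulus_flip_polar: "0 < r \<Longrightarrow> annulus_flip (polar r x) = polar (3 - r) (- x)"
  by (simp add: annulus_flip_def polar_def norm_mult cis_cnj)

lemma annulus_flip_in: "z \<in> annulus \<Longrightarrow> annulus_flip z \<in> annulus"
  by (rule annulus_cases) (auto simp: annulus_flip_polar polar_in_annulus)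

lemma annulus_flip_flip: "z \<in> annulus \<Longrightarrow> annulus_flip (annulus_flip z) = z"
  by (rule annulus_cases) (auto simp: annulus_flip_polar)

context closed_surface
begin

lemma annulus_in_surface_flip:
  assumes "annulus_in_surface e"
  shows "annulus_in_surface (e \<circ> annulus_flip)"
proof -
  note eD = annulus_in_surfaceD[OF assms]
  have "continuous_map (top_of_set annulus) (top_of_set annulus) annulus_flip"
  proof -
    have "continuous_on annulus annulus_flip"
      unfolding annulus_flip_def by (intro continuous_intros) (auto simp: annulus_def)
    then show ?thesis using annulus_flip_in by auto
  qed
  then have "continuous_map (top_of_set annulus) S (e \<circ> annulus_flip)"
    using eD(1) by (rule continuous_map_compose)
  moreover have "inj_on (e \<circ> annulus_flip) annulus"
  proof (rule comp_inj_on)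
    show "inj_on annulus_flip annulus" using annulus_flip_flip by (rule inj_on_inverseI)
    show "inj_on e (annulus_flip ` annulus)"
      using eD(2) by (rule inj_on_subset) (use annulus_flip_in in auto)
  qed
  ultimately show ?thesis by (simp add: annulus_in_surface_def)
qed

text \<open>Turning left does not depend on the direction of crossing: in flipped coordinates the
  resulting angle differs from \<open>left_profile r x\<close> by exactly one full turn, the same
  for all \<open>r\<close>.\<close>

lemma fibred_twist_flip:
  assumes e: "annulus_in_surface e"
  shows "fibred_twist (e \<circ> annulus_flip) left_profile = fibred_twist e left_profile"
proof
  fix y
  have f: "annulus_in_surface (e \<circ> annulus_flip)" using e by (rule annulus_in_surface_flip)
  have img: "(e \<circ> annulus_flip) ` annulus = e ` annulus"
  proof -
    have "annulus_flip ` annulus = annulus"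
      using annulus_flip_in annulus_flip_flip by (metis (no_types, lifting) image_eqI subsetI subset_antisym image_subsetI)
    then show ?thesis by (simp add: image_comp[symmetric] del: o_apply)
  qed
  show "fibred_twist (e \<circ> annulus_flip) left_profile y = fibred_twist e left_profile y"
  proof (cases "y \<in> e ` annulus")
    case True
    then obtain r x where rx: "r \<in> {1..2}" "y = e (polar r x)" by (auto elim: annulus_cases)
    have cl: "circle_lift (left_profile s)" if "s \<in> {1..2}" for s
      using twist_profile_left that by (simp add: twist_profile_def)
    have y: "y = (e \<circ> annulus_flip) (polar (3 - r) (- x))" using rx by (simp add: annulus_flip_polar)
    have "fibred_twist (e \<circ> annulus_flip) left_profile ((e \<circ> annulus_flip) (polar (3 - r) (- x)))
        = (e \<circ> annulus_flip) (polar (3 - r) (left_profile (3 - r) (- x)))"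
      using rx cl[of "3 - r"] annulus_in_surfaceD(2)[OF f] by (intro fibred_twist_polar) auto
    also have "\<dots> = e (polar r (left_profile r x + of_int (-1) * (2 * pi)))"
      using rx by (simp add: annulus_flip_polar left_profile_def algebra_simps)
    also have "\<dots> = fibred_twist e left_profile (e (polar r x))"
      using fibred_twist_polar[OF annulus_in_surfaceD(2)[OF e], of left_profile r x] rx cl[OF rx(1)]
      by (simp only: polar_angle_shift)
    finally show ?thesis using y rx by simp
  next
    case False
    then have "y \<notin> (e \<circ> annulus_flip) ` annulus" unfolding img .
    then show ?thesis using False fibred_twist_outside by metis
  qed
qed

end

section \<open>Sides and orientation of the core\<close>

lemma dist_polar: "dist (polar r x) (polar s x) = \<bar>r - s\<bar>"
proof -
  have "polar r x - polar s x = of_real (r - s) * cis x" by (simp add: polar_def algebra_simps)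
  then show ?thesis by (simp only: dist_norm norm_mult norm_of_real norm_cis mult_1_right)
qed

text \<open>A convex combination of two reals of the same strict sign is not zero, and one
  coordinate with this property is enough.\<close>

lemma zero_notin_closed_segment:
  assumes "0 < Re a * Re b \<or> 0 < Im a * Im b"
  shows "0 \<notin> closed_segment a b"
proof
  assume "0 \<in> closed_segment a b"
  then obtain u where u: "0 \<le> u" "u \<le> 1" "0 = (1 - u) *\<^sub>R a + u *\<^sub>R b" by (auto simp: in_segment)
  have pos: "0 < (1 - u) * x + u * y" if "0 < x" "0 < y" for x y :: real
    using that u by (cases "u = 0") (auto intro: add_nonneg_pos)
  have no: "\<not> 0 < x * y" if "0 = (1 - u) * x + u * y" for x y :: real
    using that pos[of x y] pos[of "- x" "- y"] by (auto simp: zero_less_mult_iff)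
  have "0 = (1 - u) * Re a + u * Re b" "0 = (1 - u) * Im a + u * Im b"
    using arg_cong[OF u(3), of Re] arg_cong[OF u(3), of Im] by simp_all
  then show False using no assms by blast
qed

lemma oriented_at_mult:
  assumes "a \<noteq> 0"
  shows "oriented_at (\<lambda>w. a * w) z"
proof (rule oriented_atI[of UNIV _ _ 1])
  have "winding_number ((\<lambda>w. a * w) \<circ> circlepath z 1) (a * z)
      = ((Ln a + 2 * of_real pi * \<i> * of_real 1) - (Ln a + 2 * of_real pi * \<i> * of_real 0)) / (2 * of_real pi * \<i>)"
  proof (rule winding_number_exp_path)
    show "path (\<lambda>t. Ln a + 2 * of_real pi * \<i> * of_real t)"
      unfolding path_def by (intro continuous_intros)
    show "((\<lambda>w. a * w) \<circ> circlepath z 1) t = a * z + exp (Ln a + 2 * of_real pi * \<i> * of_real t)" for t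
      using assms by (simp add: circlepath exp_add algebra_simps)
  qed
  then show "winding_number ((\<lambda>w. a * w) \<circ> circlepath z 1) (a * z) = 1" by simp
qed (use assms in \<open>auto intro!: continuous_intros injI\<close>)

text \<open>
  In logarithmic coordinates a map that treats the sides of the core and the direction of the core
  inconsistently is homotopic to a reflection of the punctured plane.
\<close>

lemma core_orientation:
  fixes \<sigma> \<tau> :: real
  assumes g: "oriented_at g (polar (3/2) 0)"
    and \<sigma>: "\<sigma> = 1 \<or> \<sigma> = -1" and \<tau>: "\<tau> = 1 \<or> \<tau> = -1"
    and U: "open U" "polar (3/2) 0 \<in> U"
    and side: "\<And>z. z \<in> U \<Longrightarrow> cmod z \<noteq> 3/2 \<Longrightarrow> 0 < \<sigma> * (cmod z - 3/2) * (cmod (g z) - 3/2)"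
    and core: "\<And>x. g (polar (3/2) x) = polar (3/2) (v x)"
    and v: "continuous_on UNIV v" "\<And>x y. x < y \<Longrightarrow> \<tau> * v x < \<tau> * v y"
  shows "\<sigma> = \<tau>"
proof (rule ccontr)
  assume "\<sigma> \<noteq> \<tau>"
  then have \<sigma>\<tau>: "\<sigma> = - \<tau>" using \<sigma> \<tau> by auto
  define p where "p = polar (3/2) 0"
  define q where "q = polar (3/2) (v 0)"
  \<comment> \<open>Logarithmic coordinates at \<open>0\<close>: \<open>w\<close> stands for
    \<open>p * exp w\<close> before \<open>g\<close> and for \<open>q * exp w\<close> after it. In
    them \<open>g\<close> becomes \<open>G\<close>, with \<open>E \<circ> G = F\<close> near
    \<open>0\<close>, and the core becomes the imaginary axis.\<close>
  define F where "F w = g (p * exp w)" for w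
  define E where "E w = q * exp w" for w
  define G where "G w = Ln (F w / q)" for w
  have p: "p \<noteq> 0" "cmod p = 3/2" and q: "q \<noteq> 0" "cmod q = 3/2"
    by (simp_all add: p_def q_def norm_polar) (simp_all add: polar_def)
  have gp: "g p = q" using core[of 0] by (simp add: p_def q_def)
  have "oriented_at ((\<lambda>w. p * w) \<circ> exp) 0"
    using oriented_at_exp oriented_at_mult[OF p(1)] by (rule oriented_at_comp)
  then have "oriented_at (g \<circ> ((\<lambda>w. p * w) \<circ> exp)) 0"
    by (rule oriented_at_comp) (use g in \<open>simp add: p_def\<close>)
  then have "oriented_at F 0" by (simp add: F_def[abs_def] o_def)
  then obtain RF where RF: "RF > 0" "\<And>r. 0 < r \<Longrightarrow> r \<le> RF \<Longrightarrow>
     continuous_on (ball 0 r) F \<and> inj_on F (ball 0 r) \<and>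
     (\<forall>s. 0 < s \<and> s < r \<longrightarrow> winding_number (F \<circ> circlepath 0 s) (F 0) = 1)"
    using oriented_at_mono_ball[of F 0] by blast
  have "oriented_at ((\<lambda>w. q * w) \<circ> exp) 0"
    using oriented_at_exp oriented_at_mult[OF q(1)] by (rule oriented_at_comp)
  then have "oriented_at E 0" by (simp add: E_def[abs_def] o_def)
  then obtain RE where RE: "RE > 0" "\<And>r. 0 < r \<Longrightarrow> r \<le> RE \<Longrightarrow>
     continuous_on (ball 0 r) E \<and> inj_on E (ball 0 r) \<and>
     (\<forall>s. 0 < s \<and> s < r \<longrightarrow> winding_number (E \<circ> circlepath 0 s) (E 0) = 1)"
    using oriented_at_mono_ball[of E 0] by blast
  have F0: "F 0 = q" by (simp add: F_def gp)
  have cF: "continuous_on (ball 0 RF) F" using RF by blast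
  then have "isCont F 0" using RF(1) by (simp add: continuous_on_eq_continuous_at)
  then have cFq: "isCont (\<lambda>w. F w / q) 0" using q by (intro continuous_intros) auto
  have "isCont Ln 1" by (intro continuous_intros) (auto simp: complex_nonpos_Reals_iff)
  then have cG: "isCont G 0"
    unfolding G_def using cFq F0 q by (intro isCont_o2[of 0 "\<lambda>w. F w / q" Ln]) auto
  have nh: "(f \<longlongrightarrow> f 0) (nhds 0)" if "isCont f 0" for f :: "complex \<Rightarrow> complex"
    using that by (simp add: isCont_def tendsto_at_iff_tendsto_nhds)
  have "\<forall>\<^sub>F w in nhds 0. w \<in> ball 0 RF" by (rule eventually_nhds_in_open) (use RF in auto)
  moreover have "\<forall>\<^sub>F w in nhds 0. dist (F w / q) 1 < 1"
    using tendstoD[OF nh[OF cFq], of 1] F0 q by simp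
  moreover have "\<forall>\<^sub>F w in nhds 0. dist (G w) 0 < RE"
    using tendstoD[OF nh[OF cG] RE(1)] F0 q by (simp add: G_def)
  moreover have "\<forall>\<^sub>F w in nhds 0. p * exp w \<in> U"
  proof -
    have "isCont (\<lambda>w. p * exp w) 0" by (intro continuous_intros)
    from nh[OF this] show ?thesis using U by (auto intro: topological_tendstoD simp: p_def)
  qed
  moreover have "\<forall>\<^sub>F w in nhds 0. \<bar>v (Im w) - v 0\<bar> < pi"
  proof -
    have "isCont v 0" using v(1) by (simp add: continuous_on_eq_continuous_at)
    then have "isCont (\<lambda>w. of_real (v (Im w)) :: complex) 0"
      by (intro continuous_intros isCont_o2[of 0 Im v]) auto
    from tendstoD[OF nh[OF this] pi_gt_zero] show ?thesis
      by (simp add: dist_of_real dist_real_def)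
  qed
  ultimately have "\<forall>\<^sub>F w in nhds 0. w \<in> ball 0 RF \<and> dist (F w / q) 1 < 1 \<and> dist (G w) 0 < RE
      \<and> p * exp w \<in> U \<and> \<bar>v (Im w) - v 0\<bar> < pi"
    by (intro eventually_conj)
  \<comment> \<open>Within distance \<open>d\<close>, \<open>F w / q\<close> stays in the right half
    plane, where the principal logarithm is continuous. The last bound makes \<open>G\<close> return
    \<open>v (Im w) - v 0\<close> itself on the core, not a value shifted by whole turns.\<close>
  then obtain d where d: "d > 0" "\<And>w. dist w 0 < d \<Longrightarrow> w \<in> ball 0 RF \<and> dist (F w / q) 1 < 1
      \<and> dist (G w) 0 < RE \<and> p * exp w \<in> U \<and> \<bar>v (Im w) - v 0\<bar> < pi"
    unfolding eventually_nhds_metric by blast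
  define \<epsilon> where "\<epsilon> = min (d/2) (RF/2)"
  have \<epsilon>: "0 < \<epsilon>" "\<epsilon> < d" "\<epsilon> < RF" using d RF by (auto simp: \<epsilon>_def)
  let ?c = "circlepath 0 \<epsilon>"
  have c: "?c t \<noteq> 0" "dist (?c t) 0 < d" "?c t \<in> ball 0 RF" for t
    using circlepath_in_cball[of \<epsilon> 0 t] circlepath_neq[of \<epsilon> 0 t] \<epsilon> by auto
  have near: "F w / q \<noteq> 0" "Re (F w / q) > 0" "exp (G w) = F w / q" if "dist w 0 < d" for w
  proof -
    have "cmod (F w / q - 1) < 1" using d(2)[OF that] by (simp add: dist_norm)
    then have "\<bar>Re (F w / q - 1)\<bar> < 1" using abs_Re_le_cmod le_less_trans by blast
    then show "Re (F w / q) > 0" by simp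
    then show "F w / q \<noteq> 0" by (metis less_irrefl zero_complex.simps(1))
    then show "exp (G w) = F w / q" by (simp add: G_def)
  qed
  \<comment> \<open>\<open>G\<close> is compared with the reflection
    \<open>\<lambda>w. of_real \<sigma> * cnj w\<close>. Off the imaginary axis the real parts agree
    in sign by \<open>side\<close>. On the axis the imaginary parts agree in sign because
    \<open>\<sigma> = - \<tau>\<close> and \<open>\<tau> * v\<close> increases.\<close>
  have seg: "0 \<notin> closed_segment (G w) (of_real \<sigma> * cnj w)" if w: "dist w 0 < d" "w \<noteq> 0" for w
  proof (rule zero_notin_closed_segment, cases "Re w = 0")
    case False
    have pw: "cmod (p * exp w) = 3/2 * exp (Re w)" using p by (simp add: norm_mult)
    have "exp (Re (G w)) = cmod (F w / q)" using near(3)[OF w(1)] by (metis norm_exp_eq_Re)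
    then have gw: "cmod (g (p * exp w)) = 3/2 * exp (Re (G w))"
      using q by (simp add: norm_divide F_def)
    have "0 < \<sigma> * (3/2 * exp (Re w) - 3/2) * (3/2 * exp (Re (G w)) - 3/2)"
      using side[of "p * exp w"] d(2)[OF w(1)] False pw gw by auto
    also have "\<dots> = 9/4 * (\<sigma> * (exp (Re w) - 1) * (exp (Re (G w)) - 1))" by (simp add: algebra_simps)
    finally have "0 < \<sigma> * (exp (Re w) - 1) * (exp (Re (G w)) - 1)" by simp
    then have "0 < Re (G w) * Re (of_real \<sigma> * cnj w)"
      using \<sigma> by (auto simp: zero_less_mult_iff mult_less_0_iff)
    then show "0 < Re (G w) * Re (of_real \<sigma> * cnj w) \<or> 0 < Im (G w) * Im (of_real \<sigma> * cnj w)" by blast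
  next
    case True
    let ?y = "Im w"
    have wy: "w = \<i> * of_real ?y" using True by (simp add: complex_eq_iff)
    have "p * exp w = polar (3/2) ?y"
      by (subst wy) (simp add: p_def polar_def cis_conv_exp)
    then have "F w / q = polar (3/2) (v ?y) / polar (3/2) (v 0)"
      by (simp only: F_def core q_def)
    then have "F w / q = cis (v ?y - v 0)" by (simp add: polar_def cis_divide)
    then have "G w = \<i> * of_real (v ?y - v 0)"
    proof -
      have "\<bar>v ?y - v 0\<bar> < pi" using d(2)[OF w(1)] by blast
      then have "Ln (exp (\<i> * of_real (v ?y - v 0))) = \<i> * of_real (v ?y - v 0)"
        by (intro Ln_exp) auto
      then show ?thesis using \<open>F w / q = cis (v ?y - v 0)\<close> by (simp only: G_def cis_conv_exp)
    qed
    then have "Im (G w) * Im (of_real \<sigma> * cnj w) = (v ?y - v 0) * (\<tau> * ?y)"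
      by (simp add: \<sigma>\<tau>)
    moreover have "?y \<noteq> 0" using w(2) True by (simp add: complex_eq_iff)
    then have "0 < (\<tau> * v ?y - \<tau> * v 0) * ?y"
      using v(2)[of 0 ?y] v(2)[of ?y 0] by (cases "0 < ?y") (auto simp: zero_less_mult_iff)
    ultimately show "0 < Re (G w) * Re (of_real \<sigma> * cnj w) \<or> 0 < Im (G w) * Im (of_real \<sigma> * cnj w)"
      by (simp add: algebra_simps)
  qed
  have pathG: "path (G \<circ> ?c)"
  proof -
    have "continuous_on {w. dist w 0 < d} G"
      unfolding G_def
    proof (intro continuous_intros)
      show "continuous_on {w. dist w 0 < d} F" using cF d(2) by (auto intro: continuous_on_subset)
      show "F w / q \<notin> \<real>\<^sub>\<le>\<^sub>0" if "w \<in> {w. dist w 0 < d}" for w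
        using near(2)[of w] that by (auto simp: complex_nonpos_Reals_iff)
    qed (use q in auto)
    then show ?thesis
      by (intro path_continuous_image) (use c in \<open>auto simp: path_image_def intro: continuous_on_subset\<close>)
  qed
  have "winding_number (\<lambda>t. of_real \<sigma> * cnj (?c t)) 0 = winding_number (G \<circ> ?c) 0"
  proof (rule winding_number_loops_linear_eq[OF pathG])
    show "path (\<lambda>t. of_real \<sigma> * cnj (?c t))"
      unfolding path_def circlepath by (intro continuous_intros)
    show "0 \<notin> closed_segment ((G \<circ> ?c) t) (of_real \<sigma> * cnj (?c t))" for t
      using seg c by simp
  qed (auto simp: pathfinish_def pathstart_def circlepath)
  \<comment> \<open>Conjugation reverses the circle, so the logarithm loses
    \<open>2 * pi * \<i>\<close> over one turn.\<close>
  moreover have "winding_number (\<lambda>t. of_real \<sigma> * cnj (?c t)) 0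
     = ((Ln (of_real \<sigma> * of_real \<epsilon>) - 2 * of_real pi * \<i> * of_real 1)
       - (Ln (of_real \<sigma> * of_real \<epsilon>) - 2 * of_real pi * \<i> * of_real 0)) / (2 * of_real pi * \<i>)"
  proof (rule winding_number_exp_path)
    show "path (\<lambda>t. Ln (of_real \<sigma> * of_real \<epsilon>) - 2 * of_real pi * \<i> * of_real t)"
      unfolding path_def by (intro continuous_intros)
    show "of_real \<sigma> * cnj (?c t) = 0 + exp (Ln (of_real \<sigma> * of_real \<epsilon>) - 2 * of_real pi * \<i> * of_real t)" for t
      using \<sigma> \<epsilon> by (auto simp: circlepath exp_diff exp_minus exp_cnj field_simps)
  qed
  ultimately have wG: "winding_number (G \<circ> ?c) 0 = -1" by simp
  have G_ne: "G (?c t) \<noteq> 0" for t using seg[OF c(2,1)[of t]] by auto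
  \<comment> \<open>\<open>E\<close> has degree 1, so \<open>E \<circ> G = F\<close> would wind -1
    times around \<open>q\<close>, while the orientation of \<open>g\<close> gives degree 1.\<close>
  have "winding_number (E \<circ> (G \<circ> ?c)) (E 0)
      = winding_number (G \<circ> ?c) 0 * winding_number (E \<circ> circlepath 0 (RE/2)) (E 0)"
  proof (rule winding_number_comp_circle[where R=RE])
    show "E w \<noteq> E 0" if "w \<in> ball 0 RE" "w \<noteq> 0" for w
      using RE(2)[of RE] RE(1) that by (auto dest: inj_onD)
    show "path_image (G \<circ> ?c) \<subseteq> ball 0 RE - {0}"
      using G_ne d(2)[OF c(2)] by (auto simp: path_image_def)
  qed (use RE pathG in \<open>auto simp: pathfinish_def pathstart_def circlepath\<close>)
  also have "\<dots> = -1" using RE(2)[of RE] RE(1) wG by simp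
  also have "E \<circ> (G \<circ> ?c) = F \<circ> ?c"
    using near(3)[OF c(2)] q by (simp add: fun_eq_iff E_def)
  also have "E 0 = F 0" by (simp add: E_def F0)
  also have "winding_number (F \<circ> ?c) (F 0) = 1" using RF(2)[of RF] RF(1) \<epsilon> by auto
  finally show False by simp
qed

section \<open>Monotone lifts of circle homeomorphisms\<close>

lemma connected_nonzero_sign:
  fixes f :: "'b::topological_space \<Rightarrow> real"
  assumes "connected X" "continuous_on X f" "\<And>x. x \<in> X \<Longrightarrow> f x \<noteq> 0"
  obtains s :: real where "s = 1 \<or> s = -1" "\<And>x. x \<in> X \<Longrightarrow> 0 < s * f x"
proof -
  have con: "connected (f ` X)" using assms(2,1) by (rule connected_continuous_image)
  have "\<not> (f a < 0 \<and> 0 < f b)" if "a \<in> X" "b \<in> X" for a b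
  proof
    assume "f a < 0 \<and> 0 < f b"
    then have "0 \<in> {f a..f b}" by simp
    then show False using connected_contains_Icc[OF con, of "f a" "f b"] that assms(3) by force
  qed
  then have "(\<forall>x\<in>X. 0 < f x) \<or> (\<forall>x\<in>X. f x < 0)"
    using assms(3) by (metis linorder_neqE_linordered_idom)
  then show ?thesis using that[of 1] that[of "-1"] by auto
qed

text \<open>A full turn raises \<open>v\<close> by a positive multiple \<open>k\<close> of
  \<open>2 * pi\<close>. If \<open>k > 1\<close>, the value \<open>v x + 2 * pi\<close> is already
  taken strictly inside the turn, although no angle there represents the same point of the circle as
  \<open>x\<close>.\<close>

lemma circle_lift_if_strict_mono:
  assumes v: "continuous_on UNIV v" "strict_mono v"
    and iff: "\<And>x y. (\<exists>k::int. v x = v y + of_int k * (2 * pi)) \<longleftrightarrow> (\<exists>k::int. x = y + of_int k * (2 * pi))"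
  shows "circle_lift v"
proof -
  have "v (x + 2 * pi) = v x + 2 * pi" for x
  proof -
    have "\<exists>k::int. v (x + 2 * pi) = v x + of_int k * (2 * pi)"
      by (subst iff) (intro exI[of _ 1], simp)
    then obtain k :: int where k: "v (x + 2 * pi) = v x + of_int k * (2 * pi)" ..
    have "v x < v (x + 2 * pi)" using v(2) by (simp add: strict_mono_def)
    then have "0 < of_int k * (2 * pi)" using k by simp
    then have "0 < k" by (simp add: zero_less_mult_iff)
    moreover have "\<not> 1 < k"
    proof
      assume "1 < k"
      then have "1 * (2 * pi) < of_int k * (2 * pi)" by (intro mult_strict_right_mono) auto
      then have "\<exists>y. x \<le> y \<and> y \<le> x + 2 * pi \<and> v y = v x + 2 * pi"
        using k by (intro IVT' continuous_on_subset[OF v(1)]) auto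
      then obtain y where y: "x \<le> y" "y \<le> x + 2 * pi" "v y = v x + 2 * pi" by blast
      then have "v y = v x + of_int 1 * (2 * pi)" by simp
      then obtain j :: int where j: "y = x + of_int j * (2 * pi)" using iff by blast
      have "y \<noteq> x" "y \<noteq> x + 2 * pi" using y k \<open>1 * (2 * pi) < of_int k * (2 * pi)\<close> by auto
      then have "x < y" "y < x + 2 * pi" using y by auto
      then have "0 < of_int j * (2 * pi)" "of_int j * (2 * pi) < 1 * (2 * pi)" using j by auto
      then have "0 < real_of_int j" "real_of_int j < 1" by (auto simp: zero_less_mult_iff)
      then show False by simp
    qed
    ultimately show ?thesis using k by (simp add: order_antisym_conv)
  qed
  then show ?thesis using v by (simp add: circle_lift_def)
qed

text \<open>The increment \<open>v (x + h) - v x\<close> has no zero on the connected strip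
  \<open>0 < h < 2 * pi\<close>, hence one sign there. A longer interval is cut into equal steps
  shorter than a turn.\<close>

lemma circle_homeomorphism_lift_monotone:
  assumes v: "continuous_on UNIV v"
    and iff: "\<And>x y. (\<exists>k::int. v x = v y + of_int k * (2 * pi)) \<longleftrightarrow> (\<exists>k::int. x = y + of_int k * (2 * pi))"
  obtains \<tau> :: real where "\<tau> = 1 \<or> \<tau> = -1" "\<And>x y. x < y \<Longrightarrow> \<tau> * v x < \<tau> * v y"
proof -
  let ?X = "(UNIV :: real set) \<times> {0<..<2 * pi}"
  have ne: "v (x + h) - v x \<noteq> 0" if h: "h \<in> {0<..<2 * pi}" for x h
  proof
    assume "v (x + h) - v x = 0"
    then have "v (x + h) = v x + of_int 0 * (2 * pi)" by simp
    then obtain j :: int where "x + h = x + of_int j * (2 * pi)" using iff by blast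
    then have "0 < of_int j * (2 * pi)" "of_int j * (2 * pi) < 1 * (2 * pi)" using h by auto
    then have "0 < real_of_int j" "real_of_int j < 1" by (auto simp: zero_less_mult_iff)
    then show False by simp
  qed
  have "connected ?X" by (intro convex_connected convex_Times) auto
  moreover have "continuous_on ?X (\<lambda>p. v (fst p + snd p) - v (fst p))"
    by (intro continuous_intros continuous_on_compose2[OF v] subset_UNIV)
  moreover have "v (fst p + snd p) - v (fst p) \<noteq> 0" if "p \<in> ?X" for p
    using ne[of "snd p" "fst p"] that by auto
  ultimately obtain \<tau> :: real where \<tau>: "\<tau> = 1 \<or> \<tau> = -1"
      "\<And>p. p \<in> ?X \<Longrightarrow> 0 < \<tau> * (v (fst p + snd p) - v (fst p))"
    using connected_nonzero_sign[of ?X "\<lambda>p. v (fst p + snd p) - v (fst p)"] by blast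
  have step: "\<tau> * v x < \<tau> * v y" if "x < y" "y < x + 2 * pi" for x y
    using \<tau>(2)[of "(x, y - x)"] that by (simp add: algebra_simps)
  have "\<tau> * v x < \<tau> * v (x + real (Suc n) * h)" if h: "0 < h" "h < 2 * pi" for x h n
  proof (induction n)
    case 0
    then show ?case using step[of x "x + h"] h by simp
  next
    case (Suc n)
    then show ?case
      using step[of "x + real (Suc n) * h" "x + real (Suc n) * h + h"] h by (simp add: algebra_simps)
  qed
  moreover have "\<exists>n h. 0 < h \<and> h < 2 * pi \<and> y = x + real (Suc n) * h" if "x < y" for x y
  proof -
    obtain n where "(y - x) / (2 * pi) < real n" using reals_Archimedean2 by blast
    then have n: "y - x < real (Suc n) * (2 * pi)"
      by (simp add: field_simps) (smt (verit) pi_gt_zero)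
    show ?thesis
      using that n by (intro exI[of _ n] exI[of _ "(y - x) / real (Suc n)"]) (auto simp: field_simps)
  qed
  ultimately have "\<tau> * v x < \<tau> * v y" if "x < y" for x y using that by metis
  then show ?thesis using \<tau>(1) that by blast
qed

section \<open>Comparison of two annuli with the same core\<close>

context closed_surface
begin

lemma annulus_inverse_continuous:
  assumes e: "annulus_in_surface e"
  shows "continuous_map (subtopology S (e ` annulus)) (top_of_set annulus) (inv_into annulus e)"
proof (rule continuous_inverse_map[OF _ Hausdorff annulus_in_surfaceD(1)[OF e]])
  show "compact_space (top_of_set annulus)"
    using compact_annulus by (intro compact_space_subtopology) simp
qed (use annulus_in_surfaceD(2)[OF e] in auto)

lemma annulus_comparison_continuous:
  assumes e: "annulus_in_surface e" and e': "annulus_in_surface e'"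
    and f: "continuous_on X f" "\<And>x. x \<in> X \<Longrightarrow> f x \<in> annulus \<and> e' (f x) \<in> e ` annulus"
  shows "continuous_on X (\<lambda>x. inv_into annulus e (e' (f x)))"
proof -
  have "continuous_map (top_of_set X) (top_of_set annulus) f" using f by auto
  then have "continuous_map (top_of_set X) S (e' \<circ> f)"
    using annulus_in_surfaceD(1)[OF e'] by (rule continuous_map_compose)
  then have "continuous_map (top_of_set X) (subtopology S (e ` annulus)) (e' \<circ> f)"
    using f(2) by (auto simp: continuous_map_in_subtopology)
  then have "continuous_map (top_of_set X) (top_of_set annulus) (inv_into annulus e \<circ> (e' \<circ> f))"
    using annulus_inverse_continuous[OF e] by (rule continuous_map_compose)
  then show ?thesis by (simp add: o_def continuous_map_in_subtopology)
qed

lemma sphere_core: "z \<in> sphere 0 (3/2) \<longleftrightarrow> (\<exists>x. z = polar (3/2) x)"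
proof
  assume "z \<in> sphere 0 (3/2)"
  then have "cmod z = 3/2" by simp
  then show "\<exists>x. z = polar (3/2) x" using polar_norm_Arg[of z] by metis
qed (auto simp: norm_polar)

text \<open>The comparison of the cores, as a map on the line, has a complex logarithm because the
  line is contractible; the imaginary part is the angle \<open>v\<close>. The last property says
  that the comparison is well defined and injective on the circle, which later makes
  \<open>v\<close> monotone.\<close>

lemma core_lift:
  assumes e: "annulus_in_surface e" and e': "annulus_in_surface e'"
    and C: "e ` sphere 0 (3/2) = e' ` sphere 0 (3/2)"
  obtains v where "continuous_on UNIV v" "\<And>x. e' (polar (3/2) x) = e (polar (3/2) (v x))"
    "\<And>x y. (\<exists>k::int. v x = v y + of_int k * (2 * pi)) \<longleftrightarrow> (\<exists>k::int. x = y + of_int k * (2 * pi))"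
proof -
  define \<phi> where "\<phi> x = inv_into annulus e (e' (polar (3/2) x))" for x
  have \<phi>: "\<phi> x \<in> sphere 0 (3/2) \<and> e (\<phi> x) = e' (polar (3/2) x)" for x
  proof -
    have "e' (polar (3/2) x) \<in> e ` sphere 0 (3/2)" unfolding C sphere_core[symmetric]
      using sphere_core by blast
    then obtain z where z: "z \<in> sphere 0 (3/2)" "e' (polar (3/2) x) = e z" by blast
    then have "z \<in> annulus" by (simp add: annulus_def)
    then show ?thesis using z annulus_in_surfaceD(2)[OF e] by (simp add: \<phi>_def)
  qed
  have in_ann: "\<phi> x \<in> annulus" for x using \<phi>[of x] by (simp add: annulus_def)
  have "continuous_on UNIV \<phi>"
    unfolding \<phi>_def
  proof (rule annulus_comparison_continuous[OF e e'])
    show "polar (3/2) x \<in> annulus \<and> e' (polar (3/2) x) \<in> e ` annulus" for x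
      using \<phi>[of x] in_ann[of x] by (auto simp: polar_in_annulus intro: image_eqI[of _ _ "\<phi> x"])
  qed (intro continuous_intros)
  moreover have "\<phi> x \<noteq> 0" for x using in_ann[of x] by (auto simp: annulus_def)
  ultimately obtain L where L: "continuous_on UNIV L" "\<And>x. \<phi> x = exp (L x)"
    using continuous_logarithm_on_contractible[of UNIV \<phi>] by (auto simp: convex_imp_contractible)
  have \<phi>v: "\<phi> x = polar (3/2) (Im (L x))" for x
  proof -
    have "exp (Re (L x)) = 3/2" using \<phi>[of x] L(2)[of x] by simp
    moreover have "exp (L x) = polar (exp (Re (L x))) (Im (L x))"
      by (simp add: exp_eq_polar polar_def)
    ultimately show ?thesis using L(2)[of x] by (simp only:)
  qed
  show ?thesis
  proof (rule that[of "\<lambda>x. Im (L x)"])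
    show "continuous_on UNIV (\<lambda>x. Im (L x))" using L(1) by (intro continuous_intros)
    show "e' (polar (3/2) x) = e (polar (3/2) (Im (L x)))" for x using \<phi>[of x] \<phi>v[of x] by simp
    fix x y
    have "(\<exists>k::int. Im (L x) = Im (L y) + of_int k * (2 * pi)) \<longleftrightarrow> \<phi> x = \<phi> y"
      by (simp add: \<phi>v polar_eq_iff)
    also have "\<dots> \<longleftrightarrow> e' (polar (3/2) x) = e' (polar (3/2) y)"
      using \<phi>[of x] \<phi>[of y] by (metis \<phi>_def)
    also have "\<dots> \<longleftrightarrow> polar (3/2) x = polar (3/2) y"
      using inj_on_eq_iff[OF annulus_in_surfaceD(2)[OF e']] by (simp add: polar_in_annulus)
    finally show "(\<exists>k::int. Im (L x) = Im (L y) + of_int k * (2 * pi)) \<longleftrightarrow>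
        (\<exists>k::int. x = y + of_int k * (2 * pi))" by (simp add: polar_eq_iff)
  qed
qed

text \<open>The signed distance from the core, measured in \<open>e\<close>, vanishes on no point of
  a thin collar of \<open>e'\<close> off the core, so it has a constant sign on each of the two
  connected halves. \<open>\<sigma>\<close> tells whether the sides correspond or are
  swapped.\<close>

lemma core_sides:
  assumes e: "annulus_in_surface e" and e': "annulus_in_surface e'"
    and C: "e ` sphere 0 (3/2) = e' ` sphere 0 (3/2)"
  obtains \<delta> \<sigma> :: real where "0 < \<delta>" "\<delta> \<le> 1/4" "\<sigma> = 1 \<or> \<sigma> = -1"
    "\<And>r x. \<bar>r - 3/2\<bar> \<le> \<delta> \<Longrightarrow> e' (polar r x) \<in> e ` open_annulus"
    "\<And>r x. r \<noteq> 3/2 \<Longrightarrow> \<bar>r - 3/2\<bar> \<le> \<delta> \<Longrightarrow>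
       0 < \<sigma> * (r - 3/2) * (cmod (inv_into annulus e (e' (polar r x))) - 3/2)"
proof -
  let ?\<iota> = "inv_into annulus e"
  note eD = annulus_in_surfaceD[OF e] and eD' = annulus_in_surfaceD[OF e']
  note eO = annulus_in_surface_open[OF e open_open_annulus open_annulus_subset]
  note eO' = annulus_in_surface_open[OF e' open_open_annulus open_annulus_subset]
  define V where "V = {z \<in> open_annulus. e' z \<in> e ` open_annulus}"
  have "openin (top_of_set open_annulus) {z \<in> topspace (top_of_set open_annulus). e' z \<in> e ` open_annulus}"
    using eO'(1) eO(3) by (rule openin_continuous_map_preimage)
  then have "open V" using open_open_annulus by (simp add: V_def openin_open_eq)
  have KA: "sphere 0 (3/2) \<subseteq> open_annulus" by (auto simp: dist_norm)
  have "sphere 0 (3/2) \<subseteq> V"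
  proof
    fix z :: complex assume z: "z \<in> sphere 0 (3/2)"
    then have "e' z \<in> e ` sphere 0 (3/2)" unfolding C by blast
    then show "z \<in> V" using z KA by (auto simp: V_def)
  qed
  then obtain \<epsilon> where \<epsilon>: "\<epsilon> > 0" "(\<Union>z\<in>sphere 0 (3/2). cball z \<epsilon>) \<subseteq> V"
    using compact_subset_open_imp_cball_epsilon_subset[OF compact_sphere \<open>open V\<close>, of 0 "3/2"] by blast
  define \<delta> where "\<delta> = min \<epsilon> (1/4)"
  have \<delta>: "0 < \<delta>" "\<delta> \<le> \<epsilon>" "\<delta> \<le> 1/4" using \<epsilon> by (auto simp: \<delta>_def)
  have thin: "polar r x \<in> V" if "\<bar>r - 3/2\<bar> \<le> \<delta>" for r x
  proof -
    have "polar r x \<in> cball (polar (3/2) x) \<epsilon>"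
      using that \<delta> by (simp add: dist_polar abs_minus_commute)
    moreover have "polar (3/2) x \<in> sphere 0 (3/2)" using sphere_core by blast
    ultimately show ?thesis using \<epsilon>(2) by blast
  qed
  have \<iota>: "?\<iota> (e' z) \<in> open_annulus \<and> e (?\<iota> (e' z)) = e' z" if z: "z \<in> V" for z
  proof -
    obtain w where w: "w \<in> open_annulus" "e' z = e w" using z by (auto simp: V_def)
    then have "?\<iota> (e' z) = w" using open_annulus_subset eD(2) by auto
    then show ?thesis using w by simp
  qed
  define N where "N p = cmod (?\<iota> (e' (polar (fst p) (snd p)))) - 3/2" for p :: "real \<times> real"
  have N_cont: "continuous_on X N" if "\<And>p. p \<in> X \<Longrightarrow> \<bar>fst p - 3/2\<bar> \<le> \<delta>" for X
    unfolding N_def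
  proof (intro continuous_intros annulus_comparison_continuous[OF e e'])
    fix p assume "p \<in> X"
    then have "polar (fst p) (snd p) \<in> V" using thin that by blast
    then show "polar (fst p) (snd p) \<in> annulus \<and> e' (polar (fst p) (snd p)) \<in> e ` annulus"
      using open_annulus_subset by (auto simp: V_def)
  qed
  have N_zero: "N p \<noteq> 0" if p: "\<bar>fst p - 3/2\<bar> \<le> \<delta>" "fst p \<noteq> 3/2" for p
  proof
    assume "N p = 0"
    then have "?\<iota> (e' (polar (fst p) (snd p))) \<in> sphere 0 (3/2)" by (simp add: N_def)
    moreover have V: "polar (fst p) (snd p) \<in> V" using thin p by blast
    from \<iota>[OF this]
    have "e' (polar (fst p) (snd p)) = e (?\<iota> (e' (polar (fst p) (snd p))))" by simp
    ultimately have "e' (polar (fst p) (snd p)) \<in> e ` sphere 0 (3/2)" by blast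
    then have "e' (polar (fst p) (snd p)) \<in> e' ` sphere 0 (3/2)" unfolding C .
    then obtain z where z: "z \<in> sphere 0 (3/2)" "e' (polar (fst p) (snd p)) = e' z" by blast
    then have "polar (fst p) (snd p) = z"
      using V KA open_annulus_subset
      by (intro inj_onD[OF eD'(2)]) (auto simp: V_def)
    moreover have "0 \<le> fst p" using p(1) \<delta> unfolding abs_le_iff by linarith
    ultimately show False using z(1) p(2) norm_polar[of "fst p" "snd p"] by simp
  qed
  let ?X1 = "{3/2<..3/2 + \<delta>} \<times> (UNIV :: real set)" and ?X2 = "{3/2 - \<delta>..<3/2} \<times> (UNIV :: real set)"
  have con: "connected ?X1" "connected ?X2" by (intro convex_connected convex_Times; auto)+
  have cN: "continuous_on ?X1 N" "continuous_on ?X2 N" by (intro N_cont; force simp: abs_le_iff)+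
  have ne: "N p \<noteq> 0" if "p \<in> ?X1 \<or> p \<in> ?X2" for p
    using that by (intro N_zero) (auto simp: abs_le_iff)
  obtain \<sigma> :: real where \<sigma>: "\<sigma> = 1 \<or> \<sigma> = -1" "\<And>p. p \<in> ?X1 \<Longrightarrow> 0 < \<sigma> * N p"
    using connected_nonzero_sign[OF con(1) cN(1)] ne by blast
  obtain \<sigma>' :: real where \<sigma>': "\<sigma>' = 1 \<or> \<sigma>' = -1" "\<And>p. p \<in> ?X2 \<Longrightarrow> 0 < \<sigma>' * N p"
    using connected_nonzero_sign[OF con(2) cN(2)] ne by blast
  have "\<sigma>' \<noteq> \<sigma>"
  proof
    \<comment> \<open>If both halves of the collar lay on one side of \<open>C\<close> in
      \<open>e\<close>, the image of the strip \<open>W\<close> would miss the other side; but it is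
      open and contains \<open>C\<close>.\<close>
    assume same: "\<sigma>' = \<sigma>"
    define W where "W = {z. \<bar>cmod z - 3/2\<bar> < \<delta>}"
    have "open W" unfolding W_def by (intro open_Collect_less continuous_intros)
    have WA: "W \<subseteq> annulus" using \<delta> by (auto simp: W_def annulus_def abs_less_iff)
    have "openin S (e' ` W)" using annulus_in_surface_open[OF e' \<open>open W\<close> WA] by simp
    with eD(1) have "openin (top_of_set annulus) {z \<in> topspace (top_of_set annulus). e z \<in> e' ` W}"
      by (rule openin_continuous_map_preimage)
    then have op: "openin (top_of_set annulus) {z \<in> annulus. e z \<in> e' ` W}" by simp
    have "e (polar (3/2) 0) \<in> e' ` W"
    proof -
      have "e (polar (3/2) 0) \<in> e' ` sphere 0 (3/2)" unfolding C[symmetric] using sphere_core by blast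
      then show ?thesis using \<delta> by (auto simp: W_def)
    qed
    then have "polar (3/2) 0 \<in> {z \<in> annulus. e z \<in> e' ` W}" by (simp add: polar_in_annulus)
    then obtain \<eta> where \<eta>: "\<eta> > 0"
        "ball (polar (3/2) 0) \<eta> \<inter> annulus \<subseteq> {z \<in> annulus. e z \<in> e' ` W}"
      using op unfolding openin_contains_ball by blast
    \<comment> \<open>A radius on the side that \<open>e'\<close> is supposed to miss, so close to
      the core that \<open>e (polar s 0)\<close> lies in the image of \<open>W\<close>; the bound
      1/4 keeps \<open>s\<close> between 1 and 2.\<close>
    define s where "s = 3/2 - \<sigma> * min (\<eta>/2) (1/4)"
    have s: "s \<in> {1..2}" "\<bar>s - 3/2\<bar> < \<eta>" "\<sigma> * (s - 3/2) < 0" using \<sigma>(1) \<eta>(1) by (auto simp: s_def min_def)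
    have "polar s 0 \<in> ball (polar (3/2) 0) \<eta> \<inter> annulus"
      using s by (simp add: dist_polar polar_in_annulus abs_minus_commute)
    then obtain z where z: "z \<in> W" "e (polar s 0) = e' z" using \<eta>(2) by blast
    define r where "r = cmod z"
    have r: "\<bar>r - 3/2\<bar> \<le> \<delta>" using z by (simp add: W_def r_def)
    have "?\<iota> (e' z) = polar s 0" using eD(2) s by (simp add: z(2)[symmetric] polar_in_annulus)
    then have N: "N (r, Arg z) = s - 3/2" using s by (simp add: N_def r_def polar_norm_Arg norm_polar)
    have "r \<noteq> 3/2"
    proof
      assume "r = 3/2"
      then have "z \<in> sphere 0 (3/2)" by (simp add: r_def)
      then have "e (polar s 0) \<in> e ` sphere 0 (3/2)" unfolding C z(2) by blast
      then obtain z' where z': "z' \<in> sphere 0 (3/2)" "e (polar s 0) = e z'" by blast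
      then have "polar s 0 = z'"
        using s KA open_annulus_subset by (intro inj_onD[OF eD(2)]) (auto simp: polar_in_annulus)
      then have "s - 3/2 = 0" using z'(1) s(1) norm_polar[of s 0] by simp
      then show False using s(3) by (simp only: mult_zero_right less_irrefl)
    qed
    then have "(r, Arg z) \<in> ?X1 \<union> ?X2" using r by (auto simp: abs_le_iff)
    then have "0 < \<sigma> * N (r, Arg z)" using \<sigma>(2) \<sigma>'(2) same by blast
    then show False using s N by simp
  qed
  then have \<sigma>'_eq: "\<sigma>' = - \<sigma>" using \<sigma>(1) \<sigma>'(1) by auto
  show ?thesis
  proof (rule that[OF \<delta>(1,3) \<sigma>(1)])
    show "e' (polar r x) \<in> e ` open_annulus" if "\<bar>r - 3/2\<bar> \<le> \<delta>" for r x
      using thin[OF that] by (simp add: V_def)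
    fix r x assume r: "r \<noteq> 3/2" "\<bar>r - 3/2\<bar> \<le> \<delta>"
    have "0 < \<sigma> * (r - 3/2) * N (r, x)"
    proof (cases "3/2 < r")
      case True
      then have "0 < \<sigma> * N (r, x)" using r by (intro \<sigma>(2)) (auto simp: abs_le_iff)
      then have "0 < (r - 3/2) * (\<sigma> * N (r, x))" using True by simp
      then show ?thesis by (simp add: mult_ac)
    next
      case False
      then have "0 < \<sigma>' * N (r, x)" using r by (intro \<sigma>'(2)) (auto simp: abs_le_iff)
      then have "0 < (3/2 - r) * (\<sigma>' * N (r, x))" using False r by simp
      then show ?thesis by (simp add: \<sigma>'_eq algebra_simps)
    qed
    then show "0 < \<sigma> * (r - 3/2) * (cmod (?\<iota> (e' (polar r x))) - 3/2)" by (simp add: N_def)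
  qed
qed

text \<open>A chart around \<open>e' z\<close> factors the comparison into a reading of
  \<open>e'\<close> and a left inverse of \<open>e\<close>, both oriented.\<close>

lemma comparison_oriented_at:
  assumes e: "annular_neighbourhood S \<A> C e" and e': "annular_neighbourhood S \<A> C e'"
    and z: "z \<in> open_annulus" "e' z \<in> e ` open_annulus"
  shows "oriented_at (inv_into annulus e \<circ> e') z"
proof -
  note eN = annular_neighbourhoodD[OF e] and eN' = annular_neighbourhoodD[OF e']
  note eO = annulus_in_surface_open[OF eN(1) open_open_annulus open_annulus_subset]
  note eO' = annulus_in_surface_open[OF eN'(1) open_open_annulus open_annulus_subset]
  obtain w where w: "w \<in> open_annulus" "e' z = e w" using z(2) by blast
  have "e' z \<in> topspace S" using eO'(1) z by (auto simp: continuous_map_def)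
  then obtain q where q: "q \<in> \<A>" "e' z \<in> range q" using chart_cover by blast
  let ?y = "inv_into UNIV q (e' z)"
  have inv: "inv_into annulus e (e u) = u" if "u \<in> open_annulus" for u
    using that open_annulus_subset annulus_in_surfaceD(2)[OF eN(1)] by (intro inv_into_f_f) auto
  have "q ?y = e w" using q w by (simp add: f_inv_into_f)
  from open_open_annulus w(1) eO(1,2) inv q(1) this eN(3)[OF w(1)]
  have "oriented_at (inv_into annulus e \<circ> q) ?y" by (rule left_inverse_oriented_at)
  moreover have "oriented_at (inv_into UNIV q \<circ> e') z"
    using eN'(3)[OF z(1)] q by (simp add: orients_at_def)
  ultimately have "oriented_at ((inv_into annulus e \<circ> q) \<circ> (inv_into UNIV q \<circ> e')) z"
    by (intro oriented_at_comp) auto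
  then show ?thesis
    by (rule oriented_at_cong[where U="{u \<in> open_annulus. e' u \<in> range q}"])
       (use chart_read_open[OF open_open_annulus eO'(1,2) q(1)] z q in \<open>auto simp: f_inv_into_f\<close>)
qed

theorem Dehn_twist_unique:
  assumes e: "annular_neighbourhood S \<A> C e" and e': "annular_neighbourhood S \<A> C e'"
  shows "isotopic S (twist_along S e) (twist_along S e')"
proof -
  note eN = annular_neighbourhoodD[OF e] and eN' = annular_neighbourhoodD[OF e']
  let ?\<iota> = "inv_into annulus e"
  have C: "e ` sphere 0 (3/2) = e' ` sphere 0 (3/2)" using eN(2) eN'(2) by simp
  obtain v where v: "continuous_on UNIV v" "\<And>x. e' (polar (3/2) x) = e (polar (3/2) (v x))"
      "\<And>x y. (\<exists>k::int. v x = v y + of_int k * (2 * pi)) \<longleftrightarrow> (\<exists>k::int. x = y + of_int k * (2 * pi))"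
    using core_lift[OF eN(1) eN'(1) C] by blast
  obtain \<tau> :: real where \<tau>: "\<tau> = 1 \<or> \<tau> = -1" "\<And>x y. x < y \<Longrightarrow> \<tau> * v x < \<tau> * v y"
    using circle_homeomorphism_lift_monotone[OF v(1,3)] by blast
  obtain \<delta> \<sigma> :: real where \<delta>: "0 < \<delta>" "\<delta> \<le> 1/4" and \<sigma>: "\<sigma> = 1 \<or> \<sigma> = -1"
    and thin: "\<And>r x. \<bar>r - 3/2\<bar> \<le> \<delta> \<Longrightarrow> e' (polar r x) \<in> e ` open_annulus"
    and side: "\<And>r x. r \<noteq> 3/2 \<Longrightarrow> \<bar>r - 3/2\<bar> \<le> \<delta> \<Longrightarrow>
       0 < \<sigma> * (r - 3/2) * (cmod (?\<iota> (e' (polar r x))) - 3/2)"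
    using core_sides[OF eN(1) eN'(1) C] by blast
  have inv: "?\<iota> (e z) = z" if "z \<in> annulus" for z
    using that annulus_in_surfaceD(2)[OF eN(1)] by simp
  \<comment> \<open>The comparison map has degree 1 at a point of the core, which ties the exchange
    of sides to the reversal of the core.\<close>
  have "\<sigma> = \<tau>"
  proof (rule core_orientation[OF _ \<sigma> \<tau>(1) _ _ _ _ v(1) \<tau>(2)])
    show "oriented_at (?\<iota> \<circ> e') (polar (3/2) 0)"
      using thin[of "3/2" 0] \<delta> by (intro comparison_oriented_at[OF e e']) (auto simp: norm_polar)
    show "open {z. \<bar>cmod z - 3/2\<bar> < \<delta>}" by (intro open_Collect_less continuous_intros)
    show "polar (3/2) 0 \<in> {z. \<bar>cmod z - 3/2\<bar> < \<delta>}" using \<delta> by (simp add: norm_polar)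
    show "0 < \<sigma> * (cmod z - 3/2) * (cmod ((?\<iota> \<circ> e') z) - 3/2)"
      if "z \<in> {z. \<bar>cmod z - 3/2\<bar> < \<delta>}" "cmod z \<noteq> 3/2" for z
      using side[of "cmod z" "Arg z"] that by (simp add: polar_norm_Arg)
    show "(?\<iota> \<circ> e') (polar (3/2) x) = polar (3/2) (v x)" for x
      by (simp add: v(2) inv polar_in_annulus)
  qed
  have outside: "e' (polar r x) \<notin> e ` {z \<in> annulus. cmod z \<le> 3/2}"
    if "r \<noteq> 3/2" "\<bar>r - 3/2\<bar> \<le> \<delta>" "0 < \<sigma> * (r - 3/2)" for r x
  proof
    assume "e' (polar r x) \<in> e ` {z \<in> annulus. cmod z \<le> 3/2}"
    then have "cmod (?\<iota> (e' (polar r x))) \<le> 3/2" using inv by auto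
    moreover have "0 < cmod (?\<iota> (e' (polar r x))) - 3/2"
      using side[OF that(1,2), of x] that(3) by (metis zero_less_mult_pos)
    ultimately show False by simp
  qed
  have "isotopic S (fibred_twist e left_profile) (fibred_twist e' left_profile)"
  proof (cases "\<sigma> = 1")
    case True
    then have "circle_lift v"
      using \<tau>(2) \<open>\<sigma> = \<tau>\<close> v by (intro circle_lift_if_strict_mono) (auto simp: strict_mono_def)
    then show ?thesis
      using \<delta> v(2) True
      by (intro twists_with_common_core_isotopic[OF eN(1) eN'(1), where v=v and \<delta>=\<delta>] outside) auto
  next
    case False
    then have neg: "\<sigma> = -1" "\<tau> = -1" using \<sigma> \<open>\<sigma> = \<tau>\<close> by auto
    \<comment> \<open>Sides and core direction are both reversed. The flip reverses both once more
      and restores the positive case, with \<open>v (- x)\<close> as the lift and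
      \<open>3 - r\<close> as the radius.\<close>
    have "isotopic S (fibred_twist e left_profile) (fibred_twist (e' \<circ> annulus_flip) left_profile)"
    proof (rule twists_with_common_core_isotopic[OF eN(1) annulus_in_surface_flip[OF eN'(1)],
          where v="\<lambda>x. v (- x)" and \<delta>=\<delta>])
      show "circle_lift (\<lambda>x. v (- x))"
      proof (rule circle_lift_if_strict_mono)
        show "continuous_on UNIV (\<lambda>x. v (- x))"
          by (intro continuous_on_compose2[OF v(1)] continuous_intros subset_UNIV)
        show "strict_mono (\<lambda>x. v (- x))" using \<tau>(2) neg by (auto simp: strict_mono_def)
        have "(\<exists>k::int. - x = - y + of_int k * (2 * pi)) \<longleftrightarrow> (\<exists>k::int. x = y + of_int k * (2 * pi))"
          for x y :: real
        proof (intro iffI; elim exE)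
          fix k :: int assume "- x = - y + of_int k * (2 * pi)"
          then show "\<exists>k::int. x = y + of_int k * (2 * pi)" by (intro exI[of _ "- k"]) simp
        next
          fix k :: int assume "x = y + of_int k * (2 * pi)"
          then show "\<exists>j::int. - x = - y + of_int j * (2 * pi)" by (intro exI[of _ "- k"]) simp
        qed
        then show "(\<exists>k::int. v (- x) = v (- y) + of_int k * (2 * pi)) \<longleftrightarrow>
            (\<exists>k::int. x = y + of_int k * (2 * pi))" for x y
          using v(3) by simp
      qed
      show "(e' \<circ> annulus_flip) (polar (3/2) x) = e (polar (3/2) (v (- x)))" for x
        by (simp add: annulus_flip_polar v(2))
      show "(e' \<circ> annulus_flip) (polar r x) \<notin> e ` {z \<in> annulus. cmod z \<le> 3/2}"
        if "3/2 < r" "r \<le> 3/2 + \<delta>" for r x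
        using outside[of "3 - r" "- x"] that neg by (simp add: annulus_flip_polar)
    qed (use \<delta> in auto)
    then show ?thesis by (simp only: fibred_twist_flip[OF eN'(1)])
  qed
  then show ?thesis by (rule isotopic_cong) (simp_all add: twist_along_fibred)
qed

end

section \<open>Fractional powers commute with the twist\<close>

context closed_surface
begin

lemma twist_commutes:
  assumes t: "is_left_Dehn_twist S \<A> C t" and h: "h \<in> carrier (MCG S \<A>)" and f: "f \<in> h" "f ` C = C"
  shows "t \<in> carrier (MCG S \<A>)" and "h \<otimes>\<^bsub>MCG S \<A>\<^esub> t = t \<otimes>\<^bsub>MCG S \<A>\<^esub> h"
proof -
  obtain e where e: "annular_neighbourhood S \<A> C e" "t = mapping_class S \<A> (twist_along S e)"
    using t by (auto simp: is_left_Dehn_twist_def)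
  note fH = mapping_class_representative[OF h f(1)]
  have T: "twist_along S e \<in> carrier \<H>" using e(1) by (rule twist_along_carrier)
  show "t \<in> carrier (MCG S \<A>)" using T e(2) by (auto simp: carrier_MCG)
  have fe: "annular_neighbourhood S \<A> C (f \<circ> e)"
    using fH(1) e(1) f(2) by (intro annular_neighbourhood_image) (auto simp: carrier_Homeo_plus)
  have T': "twist_along S (f \<circ> e) \<in> carrier \<H>" using fe by (rule twist_along_carrier)
  have "mapping_class S \<A> (twist_along S (f \<circ> e)) = t"
    unfolding e(2) using T' T Dehn_twist_unique[OF fe e(1)] by (rule mapping_class_eqI)
  moreover have "mapping_class S \<A> f \<otimes>\<^bsub>MCG S \<A>\<^esub> mapping_class S \<A> (twist_along S e)
      = mapping_class S \<A> (twist_along S (f \<circ> e)) \<otimes>\<^bsub>MCG S \<A>\<^esub> mapping_class S \<A> f"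
    using fH(1) T T' conjugate_twist[OF fH(1) e(1) f(2)] by (simp add: mapping_class_mult)
  ultimately show "h \<otimes>\<^bsub>MCG S \<A>\<^esub> t = t \<otimes>\<^bsub>MCG S \<A>\<^esub> h"
    using fH(2) e(2) by simp
qed

end

section \<open>Roots from Bezout coefficients\<close>

lemma (in group) coprime_power_root:
  fixes l n :: nat
  assumes xy: "x \<in> carrier G" "y \<in> carrier G" "x \<otimes> y = y \<otimes> x"
    and pow: "x [^] n = y [^] l" and l: "l \<noteq> 0" and gcd: "gcd l n = 1"
  obtains z where "z \<in> carrier G" "z [^] n = y" "z [^] l = x"
proof -
  \<comment> \<open>Bezout with natural coefficients and the 1 on the side of \<open>n\<close>, so
    that only \<open>y\<close> has to be inverted.\<close>
  obtain a b where ab: "l * a = n * b + 1" using bezout_nat[OF l, of n] gcd by auto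
  define z where "z = x [^] a \<otimes> inv y [^] b"
  \<comment> \<open>Commutation is transferred to the inverse and then to powers, so that powers of
    \<open>z\<close> can be taken factor by factor.\<close>
  have "x \<otimes> inv y = inv y \<otimes> x"
    using xy by (metis inv_closed inv_solve_left inv_solve_right m_assoc m_closed)
  then have "x [^] a \<otimes> inv y = inv y \<otimes> x [^] a"
    using xy by (intro group_commutes_pow) auto
  then have "inv y [^] b \<otimes> x [^] a = x [^] a \<otimes> inv y [^] b"
    using xy by (intro group_commutes_pow) auto
  then have zk: "z [^] k = x [^] (a * k) \<otimes> inv (y [^] (b * k))" for k :: nat
    unfolding z_def using xy by (subst pow_mult_distrib) (auto simp: nat_pow_pow nat_pow_inv)
  show ?thesis
  proof (rule that)
    show "z \<in> carrier G" using xy by (simp add: z_def)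
    have "x [^] (a * n) = (x [^] n) [^] a" using xy by (simp add: nat_pow_pow mult.commute)
    also have "\<dots> = y [^] (1 + b * n)" using xy ab by (simp add: pow nat_pow_pow mult.commute)
    also have "\<dots> = y \<otimes> y [^] (b * n)" using xy nat_pow_mult[of y 1 "b * n"] by simp
    finally show "z [^] n = y" using xy by (simp add: zk m_assoc)
    have "x [^] (a * l) = x [^] (1 + n * b)" using ab by (simp add: mult.commute)
    also have "\<dots> = x \<otimes> (x [^] n) [^] b" using xy nat_pow_mult[of x 1 "n * b"] by (simp add: nat_pow_pow)
    also have "\<dots> = x \<otimes> y [^] (b * l)" using xy by (simp add: pow nat_pow_pow mult.commute)
    finally show "z [^] l = x" using xy by (simp add: zk m_assoc)
  qed
qed

theorem proposition2p4:
  fixes S :: "'a topology" and \<A> :: "(complex \<Rightarrow> 'a) set" and C :: "'a set"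
    and t h :: "('a \<Rightarrow> 'a) set" and n l :: nat
  assumes "closed_oriented_surface S \<A>" and "genus S \<ge> 2"
    and "simple_closed_curve S C" and "nonseparating S C"
    and "is_left_Dehn_twist S \<A> C t"
    and "n > 1" and "1 \<le> l" and "l < n" and "gcd l n = 1"
    and "is_fractional_power (MCG S \<A>) t l n h" and "side_preserving S \<A> C h"
  shows "\<exists>h'. is_root (MCG S \<A>) t n h' \<and> h = h' [^]\<^bsub>MCG S \<A>\<^esub> l"
proof -
  interpret closed_surface S \<A> using assms(1) by unfold_locales
  interpret MCG: group "MCG S \<A>" by (rule group_MCG)
  have h: "h \<in> carrier (MCG S \<A>)" "h [^]\<^bsub>MCG S \<A>\<^esub> n = t [^]\<^bsub>MCG S \<A>\<^esub> l"
    using assms(10) by (auto simp: is_fractional_power_def)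
  \<comment> \<open>A representative that maps \<open>C\<close> to itself is the form in which the
    invariance of the isotopy class of \<open>C\<close> is used.\<close>
  obtain f where "f \<in> h" "f ` C = C" using assms(11) by (auto simp: side_preserving_def)
  note tw = twist_commutes[OF assms(5) h(1) this]
  obtain h' where "h' \<in> carrier (MCG S \<A>)" "h' [^]\<^bsub>MCG S \<A>\<^esub> n = t" "h' [^]\<^bsub>MCG S \<A>\<^esub> l = h"
    using MCG.coprime_power_root[OF h(1) tw h(2)] assms(7,9) by auto
  then show ?thesis unfolding is_root_def by blast
qed

end
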